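(* Let $(M,H)$ be an $n$-dimensional Carnot manifold, $a\in M$, and $(X_1,\ldots,X_n)$ an $H$-frame near $a$. The canonical coordinates of the first kind at $a$, i.e. the local coordinates near $a$ given by the local inverse of the local diffeomorphism $$(x_1,\ldots,x_n)\longmapsto \exp(x_1X_1+\cdots+x_nX_n)(a)$$ from a neighborhood of $0\in\mathbb{R}^n$ onto a neighborhood of $a$, are Carnot coordinates at $a$ adapted to the $H$-frame $(X_1,\ldots,X_n)$.
   Context: $\exp(X)(a)$ denotes the time-one flow of the vector field $X$ starting at $a$. A Carnot manifold of step $r$ is a smooth manifold $M$ ($\dim M=n$) with a filtration by subbundles $H_1\subset\cdots\subset H_r=TM$ such that the Lie bracket of local sections of $H_w$ and $H_{w'}$ is a section of $H_{w+w'}$ whenever $w+w'\le r$. Its weights are $w_j=\min\{w:\ j\le \mathrm{rk}\,H_w\}$, $1\le j\le n$. An $H$-frame near $a$ is a tangent frame $(X_1,\ldots,X_n)$ near $a$ with each $X_j$ a section of $H_{w_j}$; then $[X_i,X_j]=\sum_{w_k\le w_i+w_j}L_{ij}^k X_k$ with smooth functions $L_{ij}^k$ near $a$. Dilations on $\mathbb{R}^n$: $\delta_t(x)=t\cdot x=(t^{w_1}x_1,\ldots,t^{w_n}x_n)$. For a vector field $X=\sum a_j(x)\partial_j$, $\delta_t^*X=\sum_j t^{-w_j}a_j(t\cdot x)\partial_j$. Order and privileged coordinates: for $I=(i_1,\ldots,i_k)$, $k\ge 0$, put $X_I=X_{i_1}\cdots X_{i_k}$, $\langle I\rangle=w_{i_1}+\cdots+w_{i_k}$.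 A smooth $f$ near $a$ has order $N$ at $a$ if $X_If(a)=0$ whenever $\langle I\rangle<N$ and $X_If(a)\ne0$ for some $I$ with $\langle I\rangle=N$. Local coordinates centered at $a$ are linearly adapted to the $H$-frame if $X_j(0)=\partial_j$ for all $j$; they are privileged coordinates at $a$ adapted to $(X_1,\ldots,X_n)$ if moreover each coordinate $x_j$ has order $w_j$ at $a$. In privileged coordinates, $t^{w_j}\delta_t^*X_j$ converges as $t\to0$ ($C^\infty$ uniformly on compact sets) to a polynomial vector field $X_j^{(a)}$ on $\mathbb{R}^n$, the model vector field of $X_j$. The group $G(a)$: equip $\mathbb{R}^n$, with canonical basis $(\epsilon_j)$, with the nilpotent Lie bracket $[\epsilon_i,\epsilon_j]=\sum_{w_k=w_i+w_j}L_{ij}^k(a)\epsilon_k$ (zero if $w_i+w_j>r$). $G(a)$ is $\mathbb{R}^n$ with the Dynkin (Baker-Campbell-Hausdorff) product $x\cdot y=x+y+\frac12[x,y]+\frac1{12}([x,[x,y]]+[y,[y,x]])+\cdots$ (finite sum). $X_j^a$ is the left-invariant vector field on $G(a)$ with $X_j^a(0)=\partial_j$. Carnot coordinates at $a$ adapted to $(X_1,\ldots,X_n)$ are privileged coordinates at $a$ adapted to $(X_1,\ldots,X_n)$ in which the model vector field of $X_j$ is $X_j^a$ for every $j$. *)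

theory Defs
  imports "HOL-Analysis.Analysis"
begin

section \<open>Smooth maps between Euclidean spaces\<close>

text \<open>Intended for open \<open>S\<close>; \<open>at x\<close> is the full neighbourhood filter.\<close>

primrec Ck_on :: "nat \<Rightarrow> 'a::euclidean_space set \<Rightarrow> ('a \<Rightarrow> 'b::real_normed_vector) \<Rightarrow> bool" where
  "Ck_on 0 S f \<longleftrightarrow> continuous_on S f"
| "Ck_on (Suc k) S f \<longleftrightarrow> (\<forall>x\<in>S. f differentiable (at x)) \<and>
     (\<forall>v. Ck_on k S (\<lambda>x. frechet_derivative f (at x) v))"

definition smooth_on :: "'a::euclidean_space set \<Rightarrow> ('a \<Rightarrow> 'b::real_normed_vector) \<Rightarrow> bool" where
  "smooth_on S f \<longleftrightarrow> (\<forall>k. Ck_on k S f)"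

text \<open>Iterated partial derivatives, the multi-index being given as a list of directions.\<close>

primrec partials :: "'n list \<Rightarrow> (real^'n \<Rightarrow> 'b::real_normed_vector) \<Rightarrow> real^'n \<Rightarrow> 'b" where
  "partials [] f = f"
| "partials (j # js) f = (\<lambda>x. frechet_derivative (partials js f) (at x) (axis j 1))"


section \<open>Smooth manifolds\<close>

text \<open>
  The manifold is the whole type \<open>'m\<close>; its dimension is \<open>CARD('n)\<close>. A chart is a pair of
  a domain and a coordinate map, whose values outside the domain are irrelevant.
\<close>

type_synonym ('m, 'n) chart = "'m set \<times> ('m \<Rightarrow> real^'n)"

abbreviation chart_inv :: "('m, 'n) chart \<Rightarrow> real^'n \<Rightarrow> 'm" where
  "chart_inv c \<equiv> inv_into (fst c) (snd c)"

definition is_chart :: "('m::topological_space, 'n::finite) chart \<Rightarrow> bool" where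
  "is_chart c \<longleftrightarrow> open (fst c) \<and> open (snd c ` fst c) \<and>
     homeomorphism (fst c) (snd c ` fst c) (snd c) (chart_inv c)"

definition compatible :: "('m, 'n::finite) chart \<Rightarrow> ('m, 'n) chart \<Rightarrow> bool" where
  "compatible c d \<longleftrightarrow>
     smooth_on (snd c ` (fst c \<inter> fst d)) (snd d \<circ> chart_inv c) \<and>
     smooth_on (snd d ` (fst c \<inter> fst d)) (snd c \<circ> chart_inv d)"

definition smooth_manifold ::
  "('m::{t2_space, second_countable_topology}, 'n::finite) chart set \<Rightarrow> bool" where
  "smooth_manifold A \<longleftrightarrow> (\<forall>c\<in>A. is_chart c) \<and> (\<Union>c\<in>A. fst c) = UNIV \<and>
     (\<forall>c\<in>A. \<forall>d\<in>A. compatible c d)"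

text \<open>Local coordinates need not belong to the given atlas, only to the maximal one.\<close>

definition smooth_chart ::
  "('m::topological_space, 'n::finite) chart set \<Rightarrow> ('m, 'n) chart \<Rightarrow> bool" where
  "smooth_chart A c \<longleftrightarrow> is_chart c \<and> (\<forall>d\<in>A. compatible c d)"

definition smooth_fun_on ::
  "('m::topological_space, 'n::finite) chart set \<Rightarrow> 'm set \<Rightarrow> ('m \<Rightarrow> real) \<Rightarrow> bool" where
  "smooth_fun_on A U f \<longleftrightarrow> (\<forall>c\<in>A. smooth_on (snd c ` (U \<inter> fst c)) (f \<circ> chart_inv c))"

definition smooth_near ::
  "('m::topological_space, 'n::finite) chart set \<Rightarrow> 'm \<Rightarrow> ('m \<Rightarrow> real) \<Rightarrow> bool" where
  "smooth_near A p f \<longleftrightarrow> (\<exists>U. open U \<and> p \<in> U \<and> smooth_fun_on A U f)"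


section \<open>Tangent vectors and vector fields\<close>

text \<open>
  Tangent vectors at \<open>p\<close> are the derivations of the algebra of germs at \<open>p\<close> of smooth
  functions. As HOL functions are total, they are given the value 0 on functions that are not
  smooth near \<open>p\<close>, so that equality of tangent vectors is equality of functions.
\<close>

type_synonym 'm tvec = "('m \<Rightarrow> real) \<Rightarrow> real"
type_synonym 'm vfield = "'m \<Rightarrow> 'm tvec"

definition tangent_space ::
  "('m::topological_space, 'n::finite) chart set \<Rightarrow> 'm \<Rightarrow> 'm tvec set" where
  "tangent_space A p = {D.
     (\<forall>f g. smooth_near A p f \<and> smooth_near A p g \<longrightarrow>
        D (\<lambda>q. f q + g q) = D f + D g \<and>
        D (\<lambda>q. f q * g q) = f p * D g + g p * D f) \<and>
     (\<forall>c f. smooth_near A p f \<longrightarrow> D (\<lambda>q. c * f q) = c * D f) \<and>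
     (\<forall>f g. smooth_near A p f \<and> (\<forall>\<^sub>F q in nhds p. f q = g q) \<longrightarrow> D f = D g) \<and>
     (\<forall>f. \<not> smooth_near A p f \<longrightarrow> D f = 0)}"

definition lincomb :: "'i set \<Rightarrow> ('i \<Rightarrow> real) \<Rightarrow> ('i \<Rightarrow> 'm tvec) \<Rightarrow> 'm tvec" where
  "lincomb I c Y = (\<lambda>f. \<Sum>i\<in>I. c i * Y i f)"

definition basis_of :: "'i set \<Rightarrow> ('i \<Rightarrow> 'm tvec) \<Rightarrow> 'm tvec set \<Rightarrow> bool" where
  "basis_of I Y S \<longleftrightarrow> S = {lincomb I c Y | c. True} \<and>
     (\<forall>c d. lincomb I c Y = lincomb I d Y \<longrightarrow> (\<forall>i\<in>I. c i = d i))"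

definition smooth_vfield ::
  "('m::topological_space, 'n::finite) chart set \<Rightarrow> 'm set \<Rightarrow> 'm vfield \<Rightarrow> bool" where
  "smooth_vfield A U X \<longleftrightarrow> (\<forall>p\<in>U. X p \<in> tangent_space A p) \<and>
     (\<forall>c\<in>A. \<forall>j. smooth_fun_on A (U \<inter> fst c) (\<lambda>p. X p (\<lambda>q. snd c q $ j)))"

definition app :: "'m vfield \<Rightarrow> ('m \<Rightarrow> real) \<Rightarrow> 'm \<Rightarrow> real" where
  "app X f = (\<lambda>p. X p f)"

definition lie_bracket ::
  "('m::topological_space, 'n::finite) chart set \<Rightarrow> 'm vfield \<Rightarrow> 'm vfield \<Rightarrow> 'm vfield" where
  "lie_bracket A X Y =
     (\<lambda>p f. if smooth_near A p f then X p (app Y f) - Y p (app X f) else 0)"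


section \<open>Carnot manifolds\<close>

type_synonym 'm distribution = "'m \<Rightarrow> 'm tvec set"

definition subbundle ::
  "('m::topological_space, 'n::finite) chart set \<Rightarrow> nat \<Rightarrow> 'm distribution \<Rightarrow> bool" where
  "subbundle A k E \<longleftrightarrow> (\<forall>p. \<exists>U Y. open U \<and> p \<in> U \<and> (\<forall>i<k. smooth_vfield A U (Y i)) \<and>
     (\<forall>q\<in>U. basis_of {..<k} (\<lambda>i. Y i q) (E q)))"

definition rk :: "('m::topological_space, 'n::finite) chart set \<Rightarrow> 'm distribution \<Rightarrow> nat" where
  "rk A E = (THE k. subbundle A k E)"

definition section_on ::
  "('m::topological_space, 'n::finite) chart set \<Rightarrow> 'm set \<Rightarrow> 'm distribution \<Rightarrow> 'm vfield \<Rightarrow> bool"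
  where
  "section_on A U E X \<longleftrightarrow> smooth_vfield A U X \<and> (\<forall>p\<in>U. X p \<in> E p)"

definition carnot_manifold ::
  "('m::{t2_space, second_countable_topology}, 'n::finite) chart set \<Rightarrow> nat \<Rightarrow>
   (nat \<Rightarrow> 'm distribution) \<Rightarrow> bool" where
  "carnot_manifold A r H \<longleftrightarrow> smooth_manifold A \<and> r \<ge> 1 \<and>
     (\<forall>w\<in>{1..r}. \<exists>k. subbundle A k (H w)) \<and>
     (\<forall>w\<in>{1..<r}. \<forall>p. H w p \<subseteq> H (Suc w) p) \<and>
     (\<forall>p. H r p = tangent_space A p) \<and>
     (\<forall>w\<ge>1. \<forall>w'\<ge>1. w + w' \<le> r \<longrightarrow>
        (\<forall>U X Y. open U \<and> section_on A U (H w) X \<and> section_on A U (H w') Y \<longrightarrow>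
           section_on A U (H (w + w')) (lie_bracket A X Y)))"

text \<open>
  The indices \<open>1, \<dots>, n\<close> are represented by a finite linearly ordered type \<open>'n\<close>; the number
  corresponding to \<open>j :: 'n\<close> is \<open>card {..j}\<close>.
\<close>

definition wt :: "('m::topological_space, 'n::{finite, linorder}) chart set \<Rightarrow>
    (nat \<Rightarrow> 'm distribution) \<Rightarrow> 'n \<Rightarrow> nat" where
  "wt A H j = (LEAST w. w \<ge> 1 \<and> card {..j} \<le> rk A (H w))"

definition H_frame :: "('m::topological_space, 'n::{finite, linorder}) chart set \<Rightarrow>
    (nat \<Rightarrow> 'm distribution) \<Rightarrow> 'm set \<Rightarrow> ('n \<Rightarrow> 'm vfield) \<Rightarrow> bool" where
  "H_frame A H U X \<longleftrightarrow> open U \<and> (\<forall>j. section_on A U (H (wt A H j)) (X j)) \<and>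
     (\<forall>p\<in>U. basis_of UNIV (\<lambda>j. X j p) (tangent_space A p))"

text \<open>The functions $L_{ij}^k$ with $[X_i,X_j]=\sum_k L_{ij}^k X_k$.\<close>

definition structure_fun :: "('m::topological_space, 'n::finite) chart set \<Rightarrow>
    ('n \<Rightarrow> 'm vfield) \<Rightarrow> 'n \<Rightarrow> 'n \<Rightarrow> 'n \<Rightarrow> 'm \<Rightarrow> real" where
  "structure_fun A X i j k p =
     (THE c. lie_bracket A (X i) (X j) p = lincomb UNIV c (\<lambda>l. X l p)) k"


section \<open>Order and privileged coordinates\<close>

definition iter_app :: "('n \<Rightarrow> 'm vfield) \<Rightarrow> 'n list \<Rightarrow> ('m \<Rightarrow> real) \<Rightarrow> 'm \<Rightarrow> real" where
  "iter_app X I f = foldr (\<lambda>i. app (X i)) I f"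

definition has_order :: "('n \<Rightarrow> nat) \<Rightarrow> ('n \<Rightarrow> 'm vfield) \<Rightarrow> 'm \<Rightarrow> ('m \<Rightarrow> real) \<Rightarrow> nat \<Rightarrow> bool"
  where
  "has_order w X a f N \<longleftrightarrow>
     (\<forall>I. sum_list (map w I) < N \<longrightarrow> iter_app X I f a = 0) \<and>
     (\<exists>I. sum_list (map w I) = N \<and> iter_app X I f a \<noteq> 0)"

text \<open>The components of a vector field in local coordinates.\<close>

definition coord_field :: "('m, 'n::finite) chart \<Rightarrow> 'm vfield \<Rightarrow> real^'n \<Rightarrow> real^'n" where
  "coord_field c Y x = (\<chi> j. Y (chart_inv c x) (\<lambda>p. snd c p $ j))"

definition centered_chart ::
  "('m::topological_space, 'n::finite) chart set \<Rightarrow> 'm \<Rightarrow> ('m, 'n) chart \<Rightarrow> bool" where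
  "centered_chart A a c \<longleftrightarrow> smooth_chart A c \<and> a \<in> fst c \<and> snd c a = 0"

definition privileged :: "('m::topological_space, 'n::finite) chart set \<Rightarrow> ('n \<Rightarrow> nat) \<Rightarrow>
    ('n \<Rightarrow> 'm vfield) \<Rightarrow> 'm \<Rightarrow> ('m, 'n) chart \<Rightarrow> bool" where
  "privileged A w X a c \<longleftrightarrow> centered_chart A a c \<and>
     (\<forall>j. coord_field c (X j) 0 = axis j 1) \<and>
     (\<forall>j. has_order w X a (\<lambda>p. snd c p $ j) (w j))"

definition dil :: "('n \<Rightarrow> nat) \<Rightarrow> real \<Rightarrow> real^'n \<Rightarrow> real^'n::finite" where
  "dil w t x = (\<chi> j. t ^ w j * x $ j)"

definition dil_pullback ::
  "('n \<Rightarrow> nat) \<Rightarrow> real \<Rightarrow> (real^'n \<Rightarrow> real^'n) \<Rightarrow> real^'n \<Rightarrow> real^'n::finite" where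
  "dil_pullback w t Y x = (\<chi> j. inverse (t ^ w j) * Y (dil w t x) $ j)"

text \<open>
  Convergence in $C^\infty$, uniformly on compact sets, of $t^{w_j}\delta_t^*X_j$ as $t \to 0$.
  For a fixed compact \<open>K\<close> the pullback is meaningful near \<open>K\<close> only for small \<open>t\<close>.
\<close>

definition model_field :: "('n \<Rightarrow> nat) \<Rightarrow> ('n \<Rightarrow> 'm vfield) \<Rightarrow> ('m, 'n::finite) chart \<Rightarrow>
    'n \<Rightarrow> (real^'n \<Rightarrow> real^'n) \<Rightarrow> bool" where
  "model_field w X c j Z \<longleftrightarrow>
     (\<forall>K ds. compact K \<longrightarrow>
        uniform_limit K
          (\<lambda>t. partials ds (\<lambda>x. t ^ w j *\<^sub>R dil_pullback w t (coord_field c (X j)) x))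
          (partials ds Z) (at 0))"


section \<open>The tangent group\<close>

definition graded_bracket ::
  "('n \<Rightarrow> nat) \<Rightarrow> ('n \<Rightarrow> 'n \<Rightarrow> 'n \<Rightarrow> real) \<Rightarrow> real^'n \<Rightarrow> real^'n \<Rightarrow> real^'n::finite" where
  "graded_bracket w L x y =
     (\<chi> k. \<Sum>i\<in>UNIV. \<Sum>j\<in>UNIV. if w k = w i + w j then L i j k * x $ i * y $ j else 0)"

fun nested_bracket :: "('v::zero \<Rightarrow> 'v \<Rightarrow> 'v) \<Rightarrow> 'v list \<Rightarrow> 'v" where
  "nested_bracket br [] = 0"
| "nested_bracket br [u] = u"
| "nested_bracket br (u # v # us) = br u (nested_bracket br (v # us))"

text \<open>
  Dynkin's formula
  \[ x \cdot y = \sum_{m \ge 1} \frac{(-1)^{m-1}}{m} \sum_{p_i + q_i > 0}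
       \frac{[x^{p_1} y^{q_1} \cdots x^{p_m} y^{q_m}]}
            {\sum_i (p_i + q_i) \prod_i p_i!\, q_i!} \]
  with right-nested brackets, restricted to words of length at most \<open>r\<close>. For a nilpotent
  bracket of step \<open>r\<close> the longer words do not contribute.
\<close>

definition dynkin_product ::
  "nat \<Rightarrow> ('v::real_vector \<Rightarrow> 'v \<Rightarrow> 'v) \<Rightarrow> 'v \<Rightarrow> 'v \<Rightarrow> 'v" where
  "dynkin_product r br x y =
     (\<Sum>ps \<in> {ps :: (nat \<times> nat) list. ps \<noteq> [] \<and> (\<forall>(p, q)\<in>set ps. p + q > 0) \<and>
                (\<Sum>(p, q)\<leftarrow>ps. p + q) \<le> r}.
        ((-1) ^ (length ps - 1) /
          (real (length ps) * real (\<Sum>(p, q)\<leftarrow>ps. p + q) * (\<Prod>(p, q)\<leftarrow>ps. fact p * fact q)))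
        *\<^sub>R nested_bracket br (concat (map (\<lambda>(p, q). replicate p x @ replicate q y) ps)))"

definition tangent_group_mult :: "('m::topological_space, 'n::{finite, linorder}) chart set \<Rightarrow>
    nat \<Rightarrow> (nat \<Rightarrow> 'm distribution) \<Rightarrow> ('n \<Rightarrow> 'm vfield) \<Rightarrow> 'm \<Rightarrow>
    (real, 'n) vec \<Rightarrow> (real, 'n) vec \<Rightarrow> (real, 'n) vec" where
  "tangent_group_mult A r H X a =
     dynkin_product r (graded_bracket (wt A H) (\<lambda>i j k. structure_fun A X i j k a))"

text \<open>
  The left-invariant vector field with value \<open>v\<close> at the unit 0 is $x \mapsto d(L_x)_0(v)$,
  where $L_x$ is left translation by $x$.
\<close>

definition left_inv_field :: "(real^'n \<Rightarrow> real^'n \<Rightarrow> real^'n) \<Rightarrow> real^'n \<Rightarrow>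
    real^'n \<Rightarrow> real^'n::finite" where
  "left_inv_field m v x = frechet_derivative (m x) (at 0) v"


section \<open>Carnot coordinates and canonical coordinates of the first kind\<close>

definition carnot_coords :: "('m::topological_space, 'n::{finite, linorder}) chart set \<Rightarrow>
    nat \<Rightarrow> (nat \<Rightarrow> 'm distribution) \<Rightarrow> ('n \<Rightarrow> 'm vfield) \<Rightarrow> 'm \<Rightarrow> ('m, 'n) chart \<Rightarrow> bool" where
  "carnot_coords A r H X a c \<longleftrightarrow> privileged A (wt A H) X a c \<and>
     (\<forall>j. model_field (wt A H) X c j
            (left_inv_field (tangent_group_mult A r H X a) (axis j 1)))"

text \<open>
  \<open>time_one_flow A U Y a q\<close> says that $\exp(Y)(a)$ is defined and equals \<open>q\<close>, for a vector
  field \<open>Y\<close> on \<open>U\<close>.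
\<close>

definition time_one_flow :: "('m::topological_space, 'n::finite) chart set \<Rightarrow> 'm set \<Rightarrow>
    'm vfield \<Rightarrow> 'm \<Rightarrow> 'm \<Rightarrow> bool" where
  "time_one_flow A U Y a q \<longleftrightarrow> (\<exists>\<gamma> :: real \<Rightarrow> 'm.
     continuous_on {0..1} \<gamma> \<and> \<gamma> ` {0..1} \<subseteq> U \<and> \<gamma> 0 = a \<and> \<gamma> 1 = q \<and>
     (\<forall>t\<in>{0..1}. \<forall>f. smooth_near A (\<gamma> t) f \<longrightarrow>
        ((f \<circ> \<gamma>) has_real_derivative Y (\<gamma> t) f) (at t within {0..1})))"

text \<open>
  The chart \<open>c\<close> is a local inverse of $x \mapsto \exp(x_1X_1+\cdots+x_nX_n)(a)$ near
  $x = 0$.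
\<close>

definition canonical_coords_1 :: "('m::topological_space, 'n::finite) chart set \<Rightarrow> 'm set \<Rightarrow>
    ('n \<Rightarrow> 'm vfield) \<Rightarrow> 'm \<Rightarrow> ('m, 'n) chart \<Rightarrow> bool" where
  "canonical_coords_1 A U X a c \<longleftrightarrow> centered_chart A a c \<and>
     (\<forall>x \<in> snd c ` fst c.
        time_one_flow A U (\<lambda>p. lincomb UNIV (\<lambda>j. x $ j) (\<lambda>j. X j p)) a (chart_inv c x))"

end

theory Submission
  imports Defs
begin

text \<open>
  In canonical coordinates of the first kind the rays through the origin are the integral curves
  of the fields \<open>\<Sum>\<^sub>i x\<^sub>i X\<^sub>i\<close>, so that \<open>\<Sum>\<^sub>i x\<^sub>i X\<^sub>i\<close> is the Euler field \<open>E = \<Sum>\<^sub>k x\<^sub>k \<partial>\<^sub>k\<close>. Let \<open>X\<^sub>j = \<Sum>\<^sub>k B\<^sub>j\<^sub>k \<partial>\<^sub>k\<close> and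
  \<open>B = 1 + C\<close>. Expanding the brackets \<open>[E, X\<^sub>j]\<close> in the frame gives the Riccati equation
  \<open>(1 + E) C = A + A C - C\<^sup>2\<close>, where \<open>A\<^sub>j\<^sub>l = \<Sum>\<^sub>i x\<^sub>i L\<^sub>i\<^sub>j\<^sup>l\<close>. It determines the Taylor expansion of
  \<open>C\<close> at 0 recursively. As \<open>L\<^sub>i\<^sub>j\<^sup>l = 0\<close> for \<open>w\<^sub>l > w\<^sub>i + w\<^sub>j\<close>, induction shows that \<open>C\<^sub>j\<^sub>k\<close> has
  weighted order at least \<open>w\<^sub>k - w\<^sub>j\<close>, whence the coordinates are privileged; and the part of weight exactly
  \<open>w\<^sub>k - w\<^sub>j\<close> solves the same equation with \<open>L\<^sub>i\<^sub>j\<^sup>l\<close> replaced by the structure constants of the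
  graded algebra. By Dynkin's formula the left-invariant fields are \<open>f(ad\<^sub>x) \<epsilon>\<^sub>j\<close> with
  \<open>f(z) = z / (1 - e\<^sup>-\<^sup>z)\<close>, and \<open>z f' = f - f\<^sup>2 + z f\<close> says that they solve that equation as well.

  The coordinates exist because the time-one map is a fixed point of
  \<open>\<phi>(x) = \<integral>\<^sub>0\<^sup>1 \<Sum>\<^sub>i x\<^sub>i X\<^sub>i(\<phi>(s x)) ds\<close>; the Picard iterates converge with all derivatives, and the inverse
  function theorem applies.
\<close>


section \<open>Sequences converging with all derivatives\<close>


text \<open>Two demands shape the proof. The second half concerns every chart that inverts the
  exponential map, not just the one constructed; such a chart provides, for each \<open>x\<close>
  separately, some integral curve ending at the point with coordinates \<open>x\<close>. Uniqueness
  of integral curves on a Hausdorff manifold makes these curves fit together into rays. The first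
  half has to produce a chart of the maximal smooth atlas, so the flow must depend on
  \<open>x\<close> smoothly to all orders. Weighted order is expressed by the vanishing of
  \<open>partials ds f 0\<close> for lists \<open>ds\<close> of small weight. To stay at that level
  the Riccati equation is used in integrated form, 1 + E being inverted by an integral along rays.
  This integral commutes with partial derivatives up to a power of the integration variable, and as
  \<open>A\<close> and \<open>C\<close> vanish at 0, the quadratic terms involve only derivatives of
  \<open>C\<close> of smaller order. Two solutions whose coefficients agree up to the critical
  weight therefore agree up to that weight; the model is one of them, and the difference dies under
  rescaling by dilations.\<close>

abbreviation dir_deriv :: "'a::real_normed_vector \<Rightarrow> ('a \<Rightarrow> 'b::real_normed_vector) \<Rightarrow> 'a \<Rightarrow> 'b" where
  "dir_deriv v f x \<equiv> frechet_derivative f (at x) v"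

lemma has_derivative_cong_open:
  assumes "open S" "x \<in> S" "\<And>y. y \<in> S \<Longrightarrow> f y = g y"
  shows "(f has_derivative D) (at x) \<longleftrightarrow> (g has_derivative D) (at x)"
  using has_derivative_transform_within_open[OF _ assms(1,2), of f D UNIV g]
    has_derivative_transform_within_open[OF _ assms(1,2), of g D UNIV f] assms(3)
  by auto

lemma differentiable_cong_open:
  assumes "open S" "x \<in> S" "\<And>y. y \<in> S \<Longrightarrow> f y = g y"
  shows "f differentiable (at x) \<longleftrightarrow> g differentiable (at x)"
  unfolding differentiable_def using has_derivative_cong_open[OF assms] by simp

lemma frechet_derivative_cong_open:
  assumes "open S" "x \<in> S" "\<And>y. y \<in> S \<Longrightarrow> f y = g y"
  shows "frechet_derivative f (at x) = frechet_derivative g (at x)"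
  unfolding frechet_derivative_def using has_derivative_cong_open[OF assms] by simp

lemma has_derivative_dir_deriv:
  "(f has_derivative D) (at x) \<Longrightarrow> dir_deriv v f x = D v"
  by (metis frechet_derivative_at)

lemma differentiable_has_derivative:
  "f differentiable (at x) \<Longrightarrow> (f has_derivative (\<lambda>v. dir_deriv v f x)) (at x)"
  using frechet_derivative_works by blast

lemma Ck_on_cong:
  assumes "open S" "\<And>y. y \<in> S \<Longrightarrow> f y = g y"
  shows "Ck_on k S f \<longleftrightarrow> Ck_on k S g"
  using assms(2)
proof (induction k arbitrary: f g)
  case 0
  then show ?case by (simp cong: continuous_on_cong)
next
  case (Suc k)
  have "Ck_on k S (\<lambda>x. dir_deriv v f x) \<longleftrightarrow> Ck_on k S (\<lambda>x. dir_deriv v g x)" for v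
    by (rule Suc.IH) (simp add: frechet_derivative_cong_open[OF assms(1) _ Suc.prems])
  then show ?case
    using differentiable_cong_open[OF assms(1) _ Suc.prems] by simp
qed

lemma Ck_on_SucD:
  assumes "Ck_on (Suc k) S f"
  shows "Ck_on k S f"
  using assms
proof (induction k arbitrary: f)
  case 0
  then show ?case
    by (simp add: continuous_at_imp_continuous_on differentiable_imp_continuous_within)
next
  case (Suc k)
  then show ?case by (metis Ck_on.simps(2))
qed

lemma Ck_on_SucI:
  assumes "open S" "\<And>x. x \<in> S \<Longrightarrow> (f has_derivative f' x) (at x)"
    "\<And>v. Ck_on k S (\<lambda>x. f' x v)"
  shows "Ck_on (Suc k) S f"
proof -
  have "Ck_on k S (\<lambda>x. dir_deriv v f x)" for v
    using assms(3)[of v] Ck_on_cong[OF assms(1), of "\<lambda>x. dir_deriv v f x" "\<lambda>x. f' x v"]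
      has_derivative_dir_deriv[OF assms(2)] by auto
  then show ?thesis using assms(2) by (auto simp: differentiable_def)
qed

lemma Ck_on_subset: "Ck_on k S f \<Longrightarrow> T \<subseteq> S \<Longrightarrow> Ck_on k T f"
  by (induction k arbitrary: f) (auto intro: continuous_on_subset)

lemma Ck_on_locally:
  assumes "\<And>x. x \<in> S \<Longrightarrow> \<exists>T. open T \<and> x \<in> T \<and> Ck_on k T f"
  shows "Ck_on k S f"
  using assms
proof (induction k arbitrary: f)
  case 0
  show ?case unfolding Ck_on.simps
  proof (rule continuous_at_imp_continuous_on, rule ballI)
    fix x assume "x \<in> S"
    then obtain T where "open T" "x \<in> T" "continuous_on T f" using 0 by auto
    then show "isCont f x" using continuous_on_eq_continuous_at by blast
  qed
next
  case (Suc k)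
  show ?case unfolding Ck_on.simps
  proof (intro conjI ballI allI)
    fix x assume "x \<in> S" then show "f differentiable (at x)" using Suc.prems by auto
  next
    fix v show "Ck_on k S (\<lambda>x. dir_deriv v f x)"
      by (rule Suc.IH) (use Suc.prems in fastforce)
  qed
qed

definition cvg0 :: "'a::euclidean_space set \<Rightarrow> (nat \<Rightarrow> 'a \<Rightarrow> real) \<Rightarrow> bool" where
  "cvg0 S f \<longleftrightarrow> (\<forall>n. continuous_on S (f n)) \<and>
     (\<forall>K. compact K \<longrightarrow> K \<subseteq> S \<longrightarrow> uniformly_convergent_on K f)"

text \<open>Locally uniform convergence of all derivatives of order at most \<open>k\<close>. A constant sequence
  converges in this sense iff its value is \<open>C\<^sup>k\<close>, so closure properties of both notions are
  proved together.\<close>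

primrec cvg :: "nat \<Rightarrow> 'a::euclidean_space set \<Rightarrow> (nat \<Rightarrow> 'a \<Rightarrow> real) \<Rightarrow> bool" where
  "cvg 0 S f \<longleftrightarrow> cvg0 S f"
| "cvg (Suc k) S f \<longleftrightarrow> cvg0 S f \<and> (\<forall>n. \<forall>x\<in>S. f n differentiable (at x)) \<and>
     (\<forall>v. cvg k S (\<lambda>n. dir_deriv v (f n)))"

lemma cvg0_cong:
  assumes "\<And>n y. y \<in> S \<Longrightarrow> f n y = g n y"
  shows "cvg0 S f \<longleftrightarrow> cvg0 S g"
proof -
  have "continuous_on S (f n) \<longleftrightarrow> continuous_on S (g n)" for n
    using assms by (simp cong: continuous_on_cong)
  moreover have "uniformly_convergent_on K f \<longleftrightarrow> uniformly_convergent_on K g" if "K \<subseteq> S" for K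
    by (rule uniformly_convergent_cong) (use that assms in \<open>auto simp: subset_iff\<close>)
  ultimately show ?thesis by (metis cvg0_def)
qed

lemma cvg_cong:
  assumes "open S" "\<And>n y. y \<in> S \<Longrightarrow> f n y = g n y"
  shows "cvg k S f \<longleftrightarrow> cvg k S g"
  using assms(2)
proof (induction k arbitrary: f g)
  case 0
  then show ?case using cvg0_cong[of S f g] by simp
next
  case (Suc k)
  have "cvg k S (\<lambda>n. dir_deriv v (f n)) \<longleftrightarrow> cvg k S (\<lambda>n. dir_deriv v (g n))" for v
    by (rule Suc.IH) (simp add: frechet_derivative_cong_open[OF assms(1) _ Suc.prems])
  then show ?case
    using differentiable_cong_open[OF assms(1) _ Suc.prems] cvg0_cong[of S f g] Suc.prems by simp
qed

lemma cvg_imp_cvg0: "cvg k S f \<Longrightarrow> cvg0 S f"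
  by (cases k) simp_all

lemma cvg_SucD: "cvg (Suc k) S f \<Longrightarrow> cvg k S f"
proof (induction k arbitrary: f)
  case 0 then show ?case by simp
next
  case (Suc k) then show ?case by (metis cvg.simps(2))
qed

lemma cvg_SucI:
  assumes "open S" "cvg0 S f" "\<And>n x. x \<in> S \<Longrightarrow> (f n has_derivative f' n x) (at x)"
    "\<And>v. cvg k S (\<lambda>n x. f' n x v)"
  shows "cvg (Suc k) S f"
proof -
  have "cvg k S (\<lambda>n. dir_deriv v (f n))" for v
    using assms(4)[of v] cvg_cong[OF assms(1), of "\<lambda>n. dir_deriv v (f n)" "\<lambda>n x. f' n x v"]
      has_derivative_dir_deriv[OF assms(3)] by auto
  then show ?thesis using assms(2,3) unfolding cvg.simps(2) differentiable_def by blast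
qed

lemma uniformly_convergent_on_const: "uniformly_convergent_on K (\<lambda>n. f)"
  by (auto simp: uniformly_convergent_on_def intro!: exI[of _ f])

lemma cvg_const_iff: "cvg k S (\<lambda>n. f) \<longleftrightarrow> Ck_on k S f"
proof (induction k arbitrary: f)
  case 0
  then show ?case by (simp add: cvg0_def uniformly_convergent_on_const)
next
  case (Suc k)
  have "Ck_on (Suc k) S f \<Longrightarrow> Ck_on 0 S f"
    by (simp add: continuous_at_imp_continuous_on differentiable_imp_continuous_within)
  then show ?case using Suc.IH by (auto simp: cvg0_def uniformly_convergent_on_const)
qed

lemma cvg_imp_Ck: "cvg k S f \<Longrightarrow> Ck_on k S (f n)"
proof (induction k arbitrary: f)
  case 0 then show ?case by (simp add: cvg0_def)
next
  case (Suc k)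
  show ?case using Suc.prems Suc.IH[of "\<lambda>n. dir_deriv v (f n)" for v] by simp
qed

lemma cvg_has_derivative:
  "cvg (Suc k) S f \<Longrightarrow> x \<in> S \<Longrightarrow> (f n has_derivative (\<lambda>v. dir_deriv v (f n) x)) (at x)"
  by (simp add: differentiable_has_derivative)

lemma Ck_has_derivative:
  "Ck_on (Suc k) S f \<Longrightarrow> x \<in> S \<Longrightarrow> (f has_derivative (\<lambda>v. dir_deriv v f x)) (at x)"
  by (simp add: differentiable_has_derivative)

lemma cvg_add:
  assumes "open S" "cvg k S f" "cvg k S g"
  shows "cvg k S (\<lambda>n x. f n x + g n x)"
  using assms(2,3)
proof (induction k arbitrary: f g)
  case 0
  then show ?case by (auto simp: cvg0_def intro!: continuous_intros uniformly_convergent_add)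
next
  case (Suc k)
  have 0: "cvg0 S (\<lambda>n x. f n x + g n x)"
    using Suc.prems by (auto simp: cvg0_def intro!: continuous_intros uniformly_convergent_add)
  show ?case
    by (rule cvg_SucI[OF assms(1) 0 has_derivative_add[OF Suc.prems(1)[THEN cvg_has_derivative] Suc.prems(2)[THEN cvg_has_derivative]]])
      (use Suc in auto)
qed

lemma uniformly_convergent_mult_compact:
  fixes f g :: "nat \<Rightarrow> 'a::metric_space \<Rightarrow> real"
  assumes "compact K" "\<And>n. continuous_on K (f n)" "\<And>n. continuous_on K (g n)"
    "uniformly_convergent_on K f" "uniformly_convergent_on K g"
  shows "uniformly_convergent_on K (\<lambda>n x. f n x * g n x)"
proof -
  obtain l m where l: "uniform_limit K f l sequentially" and m: "uniform_limit K g m sequentially"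
    using assms by (auto simp: uniformly_convergent_on_def)
  have "continuous_on K l" "continuous_on K m"
    using uniform_limit_theorem[OF _ l] uniform_limit_theorem[OF _ m] assms(2,3) by auto
  then have "bounded (l ` K)" "bounded (m ` K)"
    using assms(1) compact_continuous_image compact_imp_bounded by blast+
  then show ?thesis using uniform_lim_mult[OF l m] by (auto simp: uniformly_convergent_on_def)
qed

lemma cvg_mult:
  assumes "open S" "cvg k S f" "cvg k S g"
  shows "cvg k S (\<lambda>n x. f n x * g n x)"
  using assms(2,3)
proof (induction k arbitrary: f g)
  case 0
  then show ?case
    by (auto simp: cvg0_def intro!: continuous_intros uniformly_convergent_mult_compact intro: continuous_on_subset)
next
  case (Suc k)
  have 0: "cvg0 S (\<lambda>n x. f n x * g n x)"
    using Suc.prems[THEN cvg_imp_cvg0]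
    by (auto simp: cvg0_def intro!: continuous_intros uniformly_convergent_mult_compact intro: continuous_on_subset)
  show ?case
  proof (rule cvg_SucI[OF assms(1) 0 has_derivative_mult[OF Suc.prems(1)[THEN cvg_has_derivative] Suc.prems(2)[THEN cvg_has_derivative]]])
    fix v
    show "cvg k S (\<lambda>n x. f n x * dir_deriv v (g n) x + dir_deriv v (f n) x * g n x)"
      using Suc.prems Suc.prems[THEN cvg_SucD] by (intro cvg_add Suc.IH assms(1)) auto
  qed
qed

lemma Ck_on_const [simp]: "Ck_on k S (\<lambda>x. c)"
proof (induction k arbitrary: c)
  case (Suc k) then show ?case by simp
qed simp

lemma cvg_const [simp]: "cvg k S (\<lambda>n x. c)"
  by (simp add: cvg_const_iff)

lemma cvg_sum:
  assumes "open S" "\<And>i. i \<in> I \<Longrightarrow> cvg k S (f i)"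
  shows "cvg k S (\<lambda>n x. \<Sum>i\<in>I. f i n x)"
  using assms(2) by (induction I rule: infinite_finite_induct) (auto intro!: cvg_add assms(1))

lemma Ck_on_bounded_linear:
  assumes "bounded_linear f"
  shows "Ck_on k S f"
proof (cases k)
  case 0
  then show ?thesis using assms by (simp add: linear_continuous_on)
next
  case (Suc m)
  show ?thesis unfolding Suc
    by (simp add: bounded_linear_imp_differentiable[OF assms]
      has_derivative_dir_deriv[OF bounded_linear_imp_has_derivative[OF assms]])
qed

lemma uniform_limit_sum_on:
  fixes f :: "'i \<Rightarrow> nat \<Rightarrow> 'a \<Rightarrow> 'b::real_normed_vector"
  assumes "\<And>i. i \<in> I \<Longrightarrow> uniform_limit K (f i) (l i) F"
  shows "uniform_limit K (\<lambda>n x. \<Sum>i\<in>I. f i n x) (\<lambda>x. \<Sum>i\<in>I. l i x) F"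
  using assms
  by (induction I rule: infinite_finite_induct) (auto intro!: uniform_limit_add uniform_limit_const)

text \<open>The values of the inner functions on a compact set have to stay in a fixed compact set
  for uniform convergence to survive the composition.\<close>

lemma cvg_compose:
  fixes G :: "'b::euclidean_space \<Rightarrow> real" and f :: "nat \<Rightarrow> 'a::euclidean_space \<Rightarrow> 'b"
  assumes S: "open S" and T: "open T" and G: "Ck_on k T G"
    and f: "\<And>b. b \<in> Basis \<Longrightarrow> cvg k S (\<lambda>n x. f n x \<bullet> b)"
    and C: "\<And>K. compact K \<Longrightarrow> K \<subseteq> S \<Longrightarrow> \<exists>C. compact C \<and> C \<subseteq> T \<and> (\<forall>n. \<forall>x\<in>K. f n x \<in> C)"
  shows "cvg k S (\<lambda>n x. G (f n x))"
  using G f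
proof (induction k arbitrary: G)
  case 0
  show ?case unfolding cvg.simps cvg0_def
  proof (intro conjI allI impI)
    fix n
    have "continuous_on S (f n)" 
      by (subst continuous_on_componentwise) (use 0 in \<open>auto simp: cvg0_def\<close>)
    moreover have "f n ` S \<subseteq> T" using C[of "{x}" for x] by fastforce
    ultimately show "continuous_on S (\<lambda>x. G (f n x))"
      using 0 by (auto intro: continuous_on_compose2)
  next
    fix K assume K: "compact K" "K \<subseteq> S"
    obtain C' where C': "compact C'" "C' \<subseteq> T" "\<And>n x. x \<in> K \<Longrightarrow> f n x \<in> C'" using C[OF K] by auto
    have "\<exists>l. uniform_limit K (\<lambda>n x. f n x \<bullet> b) l sequentially" if "b \<in> Basis" for b
      using 0 that K by (auto simp: cvg0_def uniformly_convergent_on_def)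
    then obtain l where l: "\<And>b. b \<in> Basis \<Longrightarrow> uniform_limit K (\<lambda>n x. f n x \<bullet> b) (l b) sequentially"
      by metis
    have "uniform_limit K (\<lambda>n x. \<Sum>b\<in>Basis. (f n x \<bullet> b) *\<^sub>R b) (\<lambda>x. \<Sum>b\<in>Basis. l b x *\<^sub>R b) sequentially"
      by (rule uniform_limit_sum_on) (intro bounded_linear.uniform_limit[OF bounded_linear_scaleR_left] l)
    then have lim: "uniform_limit K f (\<lambda>x. \<Sum>b\<in>Basis. l b x *\<^sub>R b) sequentially"
      by (simp add: euclidean_representation)
    have uc: "uniformly_continuous_on C' G"
      using 0 C' by (auto intro: compact_uniformly_continuous continuous_on_subset)
    \<comment> \<open>Limits of points of the compact set \<open>C'\<close> stay in
      \<open>C'\<close>, where \<open>G\<close> is uniformly continuous.\<close>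
    have "(\<Sum>b\<in>Basis. l b x *\<^sub>R b) \<in> C'" if "x \<in> K" for x
      using closed_sequentially[OF compact_imp_closed[OF C'(1)], of "\<lambda>n. f n x"] C'(3)[OF that]
        tendsto_uniform_limitI[OF lim that] by blast
    then have "uniform_limit K (\<lambda>n x. G (f n x)) (G \<circ> (\<lambda>x. \<Sum>b\<in>Basis. l b x *\<^sub>R b)) sequentially"
      using C'(3) by (intro uniform_limit_compose[OF lim uc]) (auto simp: image_subset_iff)
    then show "uniformly_convergent_on K (\<lambda>n x. G (f n x))"
      by (auto simp: uniformly_convergent_on_def)
  qed
next
  case (Suc k)
  have fT: "f n x \<in> T" if "x \<in> S" for n x using C[of "{x}"] that by auto
  have f': "(f n has_derivative (\<lambda>v. \<Sum>b\<in>Basis. dir_deriv v (\<lambda>x. f n x \<bullet> b) x *\<^sub>R b)) (at x)"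
    if "x \<in> S" for n x
    by (subst has_derivative_componentwise_within)
      (use Suc.prems(2)[THEN cvg_has_derivative] that in \<open>auto simp: inner_sum_left inner_Basis if_distrib cong: if_cong\<close>)
  have d: "((\<lambda>x. G (f n x)) has_derivative
      (\<lambda>v. \<Sum>b\<in>Basis. dir_deriv v (\<lambda>x. f n x \<bullet> b) x * dir_deriv b G (f n x))) (at x)"
    if "x \<in> S" for n x
  proof -
    have G': "(G has_derivative (\<lambda>v. dir_deriv v G (f n x))) (at (f n x))"
      by (rule Ck_has_derivative[OF Suc.prems(1) fT[OF that]])
    have lin: "linear (\<lambda>v. dir_deriv v G (f n x))" using G' has_derivative_linear by blast
    show ?thesis
      using has_derivative_compose[OF f'[OF that] G']
      by (simp add: linear_sum[OF lin] linear_cmul[OF lin])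
  qed
  have IH0: "cvg k S (\<lambda>n x. G (f n x))"
    by (rule Suc.IH) (use Suc.prems Ck_on_SucD cvg_SucD in blast)+
  show ?case
  proof (rule cvg_SucI[OF S cvg_imp_cvg0[OF IH0] d])
    fix v
    show "cvg k S (\<lambda>n x. \<Sum>b\<in>Basis. dir_deriv v (\<lambda>x. f n x \<bullet> b) x * dir_deriv b G (f n x))"
    proof (intro cvg_sum cvg_mult S)
      fix b :: 'b assume b: "b \<in> Basis"
      show "cvg k S (\<lambda>n x. dir_deriv v (\<lambda>x. f n x \<bullet> b) x)" using Suc.prems(2)[OF b] by simp
      show "cvg k S (\<lambda>n x. dir_deriv b G (f n x))"
        by (rule Suc.IH[of "dir_deriv b G"]) (use Suc.prems(1) in simp, rule cvg_SucD[OF Suc.prems(2)])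
    qed
  qed
qed


section \<open>Integration along rays from the origin\<close>

definition radial_int :: "nat \<Rightarrow> ('a::real_normed_vector \<Rightarrow> real) \<Rightarrow> 'a \<Rightarrow> real" where
  "radial_int m f x = integral {0..1} (\<lambda>s. s ^ m * f (s *\<^sub>R x))"

definition star0 :: "'a::real_normed_vector set \<Rightarrow> bool" where
  "star0 S \<longleftrightarrow> (\<forall>x\<in>S. \<forall>s\<in>{0..1}. s *\<^sub>R x \<in> S)"

lemma star0D: "star0 S \<Longrightarrow> x \<in> S \<Longrightarrow> 0 \<le> s \<Longrightarrow> s \<le> 1 \<Longrightarrow> s *\<^sub>R x \<in> S"
  by (simp add: star0_def)

lemma star0_ball [simp]: "star0 (ball 0 r)"
proof -
  have "s * norm x < r" if "norm x < r" "0 \<le> s" "s \<le> 1" for s and x :: 'a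
    using mult_left_le_one_le[of "norm x" s] that by simp
  then show ?thesis by (auto simp: star0_def)
qed

lemma radial_continuous:
  assumes "star0 S" "continuous_on S f" "x \<in> S"
  shows "continuous_on {0..1} (\<lambda>s. s ^ m * f (s *\<^sub>R x))"
  using assms by (intro continuous_intros continuous_on_compose2[OF assms(2)]) (auto simp: star0D)

lemma radial_integrable:
  assumes "star0 S" "continuous_on S f" "x \<in> S"
  shows "(\<lambda>s. s ^ m * f (s *\<^sub>R x)) integrable_on {0..1}"
  using radial_continuous[OF assms] integrable_continuous_interval by blast

lemma radial_int_cong:
  assumes "star0 S" "x \<in> S" "\<And>y. y \<in> S \<Longrightarrow> f y = g y"
  shows "radial_int m f x = radial_int m g x"
  unfolding radial_int_def by (rule integral_cong) (use assms in \<open>auto simp: star0D\<close>)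

lemma radial_int_bound:
  assumes "star0 S" "continuous_on S f" "x \<in> S" "\<And>y. y \<in> S \<Longrightarrow> \<bar>f y\<bar> \<le> B"
  shows "\<bar>radial_int m f x\<bar> \<le> B"
proof -
  have "norm (integral {0..1} (\<lambda>s. s ^ m * f (s *\<^sub>R x))) \<le> B * (1 - 0)"
  proof (rule integral_bound)
    show "norm (s ^ m * f (s *\<^sub>R x)) \<le> B" if "s \<in> {0..1}" for s :: real
    proof -
      have "\<bar>s ^ m\<bar> * \<bar>f (s *\<^sub>R x)\<bar> \<le> 1 * B"
        using that assms by (intro mult_mono) (auto simp: star0D power_le_one)
      then show ?thesis by (simp add: abs_mult)
    qed
  qed (use radial_continuous[OF assms(1-3)] in auto)
  then show ?thesis by (simp add: radial_int_def)
qed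

lemma radial_int_diff:
  assumes "star0 S" "continuous_on S f" "continuous_on S g" "x \<in> S"
  shows "radial_int m (\<lambda>y. f y - g y) x = radial_int m f x - radial_int m g x"
  unfolding radial_int_def
  by (subst integral_diff[symmetric])
    (auto intro: radial_integrable[OF assms(1)] assms simp: algebra_simps)

lemma radial_int_add:
  assumes "star0 S" "continuous_on S f" "continuous_on S g" "x \<in> S"
  shows "radial_int m (\<lambda>y. f y + g y) x = radial_int m f x + radial_int m g x"
  unfolding radial_int_def
  by (subst integral_add[symmetric])
    (auto intro: radial_integrable[OF assms(1)] assms simp: algebra_simps)

lemma radial_int_continuous:
  fixes f :: "'a::euclidean_space \<Rightarrow> real"
  assumes "star0 S" "continuous_on S f"
  shows "continuous_on S (radial_int m f)"
proof -
  have "continuous_on (S \<times> cbox 0 1) (\<lambda>(x, s). s ^ m * f (s *\<^sub>R x))"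
    unfolding split_beta
    by (intro continuous_intros continuous_on_compose2[OF assms(2)]) (auto simp: star0D[OF assms(1)])
  from integral_continuous_on_param[OF this] show ?thesis
    by (simp add: radial_int_def[abs_def])
qed

text \<open>A radial integral at points of \<open>K\<close> sees the integrand on the segments from
  0 to \<open>K\<close>. Uniform estimates are therefore made on this hull, which is still compact
  and inside \<open>S\<close>.\<close>

lemma compact_star_hull:
  fixes K :: "'a::euclidean_space set"
  assumes "compact K" "K \<subseteq> S" "star0 S"
  obtains K' where "compact K'" "K \<subseteq> K'" "K' \<subseteq> S" "star0 K'"
proof
  let ?K = "(\<lambda>(s, x). s *\<^sub>R x) ` ({0..1::real} \<times> K)"
  show "compact ?K"
    by (intro compact_continuous_image compact_Times assms) (auto simp: split_beta intro!: continuous_intros)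
  show "K \<subseteq> ?K"
  proof
    fix x assume "x \<in> K"
    then show "x \<in> ?K" by (intro image_eqI[of _ _ "(1, x)"]) auto
  qed
  show "?K \<subseteq> S" using assms by (auto simp: star0D)
  show "star0 ?K" unfolding star0_def
  proof (intro ballI)
    fix y s assume "y \<in> ?K" "s \<in> {0..1::real}"
    then obtain t x where "t \<in> {0..1}" "x \<in> K" "y = t *\<^sub>R x" by auto
    then show "s *\<^sub>R y \<in> ?K" using \<open>s \<in> _\<close>
      by (intro image_eqI[of _ _ "(s * t, x)"]) (auto simp: mult_le_one)
  qed
qed

text \<open>The chain rule brings down one more factor \<open>s\<close>; this is why
  \<open>radial_int\<close> carries an exponent \<open>m\<close>. With it the family of radial
  integrals is closed under differentiation.\<close>

lemma radial_int_has_derivative: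
  fixes f :: "'a::euclidean_space \<Rightarrow> real"
  assumes S: "open S" "star0 S" and f: "Ck_on 1 S f" and x: "x \<in> S"
  shows "(radial_int m f has_derivative (\<lambda>v. radial_int (Suc m) (dir_deriv v f) x)) (at x)"
proof -
  obtain e where e: "e > 0" "ball x e \<subseteq> S" using S(1) x open_contains_ball by blast
  have lin: "bounded_linear (\<lambda>v. dir_deriv v f y)" if "y \<in> S" for y
    using Ck_has_derivative[of 0 S f] that f has_derivative_bounded_linear by fastforce
  \<comment> \<open>The Leibniz rule asks for a derivative that is jointly continuous as a bounded
    linear map; in finite dimension this can be checked on single vectors.\<close>
  define fx where "fx y s = Blinfun (\<lambda>v. s ^ Suc m * dir_deriv v f (s *\<^sub>R y))" for y and s :: real
  have ball: "s *\<^sub>R y \<in> S" if "y \<in> ball x e" "s \<in> cbox 0 1" for y s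
    using that e S by (auto intro!: star0D)
  have fx: "blinfun_apply (fx y s) = (\<lambda>v. s ^ Suc m * dir_deriv v f (s *\<^sub>R y))"
    if "y \<in> ball x e" "s \<in> cbox 0 1" for y s
    unfolding fx_def
    by (intro bounded_linear_Blinfun_apply bounded_linear_compose[OF bounded_linear_mult_right lin[OF ball[OF that]]])
  have contd: "continuous_on S (dir_deriv v f)" for v using f by simp
  have contf: "continuous_on S f" using Ck_on_SucD[of 0 S f] f by simp
  have cfx: "continuous_on (ball x e \<times> cbox 0 1) (\<lambda>(y, s). fx y s)"
  proof (rule continuous_on_blinfun_componentwise)
    fix i :: 'a
    have "continuous_on (ball x e \<times> cbox 0 1) (\<lambda>p. snd p ^ Suc m * dir_deriv i f (snd p *\<^sub>R fst p))"
      by (intro continuous_intros continuous_on_compose2[OF contd]) (use ball in auto)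
    then show "continuous_on (ball x e \<times> cbox 0 1) (\<lambda>p. blinfun_apply (case p of (y, s) \<Rightarrow> fx y s) i)"
      by (rule continuous_on_eq) (use fx in auto)
  qed
  have "((\<lambda>y. integral (cbox 0 1) (\<lambda>s. s ^ m * f (s *\<^sub>R y))) has_derivative integral (cbox 0 1) (fx x))
      (at x within ball x e)"
  proof (rule leibniz_rule[OF _ _ cfx])
    fix y and s :: real assume y: "y \<in> ball x e" and s: "s \<in> cbox 0 1"
    have "((\<lambda>y. f (s *\<^sub>R y)) has_derivative (\<lambda>v. dir_deriv (s *\<^sub>R v) f (s *\<^sub>R y))) (at y)"
      by (rule has_derivative_compose[OF _ Ck_has_derivative[of 0 S f]])
        (use f ball[OF y s] in \<open>auto intro!: derivative_eq_intros\<close>)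
    then have "((\<lambda>y. s ^ m * f (s *\<^sub>R y)) has_derivative (\<lambda>v. s ^ m * dir_deriv (s *\<^sub>R v) f (s *\<^sub>R y))) (at y)"
      by (rule has_derivative_mult_right)
    moreover have "(\<lambda>v. s ^ m * dir_deriv (s *\<^sub>R v) f (s *\<^sub>R y)) = blinfun_apply (fx y s)"
      unfolding fx[OF y s] using linear_cmul[OF bounded_linear.linear[OF lin[OF ball[OF y s]]]]
      by (auto simp: fun_eq_iff)
    ultimately show "((\<lambda>y. s ^ m * f (s *\<^sub>R y)) has_derivative blinfun_apply (fx y s)) (at y within ball x e)"
      using has_derivative_at_withinI by metis
  next
    fix y assume "y \<in> ball x e"
    then show "(\<lambda>s. s ^ m * f (s *\<^sub>R y)) integrable_on cbox 0 1"
      using radial_integrable[OF S(2) contf, of y m] e by auto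
  qed (use e in auto)
  then have D: "(radial_int m f has_derivative integral (cbox 0 1) (fx x)) (at x)"
    using e by (simp add: radial_int_def[abs_def] at_within_open[of x "ball x e"])
  have "blinfun_apply (integral (cbox 0 1) (fx x)) = (\<lambda>v. radial_int (Suc m) (dir_deriv v f) x)"
  proof
    fix v
    have "continuous_on (cbox 0 1) (fx x)"
    proof -
      have "continuous_on (cbox 0 1) (\<lambda>s::real. (x, s))" by (intro continuous_intros)
      from continuous_on_compose2[OF cfx this] show ?thesis using e by (auto simp: image_subset_iff)
    qed
    then have "fx x integrable_on cbox 0 1" by (rule integrable_continuous)
    then have "blinfun_apply (integral (cbox 0 1) (fx x)) v = integral (cbox 0 1) (\<lambda>s. blinfun_apply (fx x s) v)"
      by (rule blinfun_apply_integral)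
    also have "\<dots> = radial_int (Suc m) (dir_deriv v f) x"
      unfolding radial_int_def by (simp, rule integral_cong) (use fx[of x] e in auto)
    finally show "blinfun_apply (integral (cbox 0 1) (fx x)) v = radial_int (Suc m) (dir_deriv v f) x" .
  qed
  from D[unfolded this] show ?thesis .
qed

lemma cvg0_radial_int:
  assumes "star0 S" "cvg0 S f"
  shows "cvg0 S (\<lambda>n. radial_int m (f n))"
  unfolding cvg0_def
proof (intro conjI allI impI)
  show "continuous_on S (radial_int m (f n))" for n
    using assms by (auto simp: cvg0_def intro: radial_int_continuous)
next
  fix K assume K: "compact K" "K \<subseteq> S"
  obtain K' where K': "compact K'" "K \<subseteq> K'" "K' \<subseteq> S" "star0 K'"
    using compact_star_hull[OF K assms(1)] .
  have cont: "continuous_on K' (f n)" for n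
    using assms K' by (auto simp: cvg0_def intro: continuous_on_subset)
  have "uniformly_Cauchy_on K' f"
    using assms K' by (auto simp: cvg0_def uniformly_convergent_eq_Cauchy)
  then have "uniformly_Cauchy_on K (\<lambda>n. radial_int m (f n))"
    unfolding uniformly_Cauchy_on_def
  proof (intro allI impI)
    fix e :: real assume H: "\<forall>e>0. \<exists>M. \<forall>x\<in>K'. \<forall>m\<ge>M. \<forall>n\<ge>M. dist (f m x) (f n x) < e" and e: "e > 0"
    obtain M where M: "\<And>x p q. x \<in> K' \<Longrightarrow> p \<ge> M \<Longrightarrow> q \<ge> M \<Longrightarrow> dist (f p x) (f q x) < e / 2"
      using H e half_gt_zero by metis
    have "dist (radial_int m (f p) x) (radial_int m (f q) x) < e" if "x \<in> K" "p \<ge> M" "q \<ge> M" for x p q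
    proof -
      have x: "x \<in> K'" using that K' by auto
      have "\<bar>radial_int m (\<lambda>y. f p y - f q y) x\<bar> \<le> e / 2"
        by (rule radial_int_bound[OF K'(4) _ x])
          (use M that in \<open>auto intro!: continuous_intros cont simp: dist_real_def less_imp_le\<close>)
      then show ?thesis using e by (simp add: dist_real_def radial_int_diff[OF K'(4) cont cont x])
    qed
    then show "\<exists>M. \<forall>x\<in>K. \<forall>p\<ge>M. \<forall>n\<ge>M. dist (radial_int m (f p) x) (radial_int m (f n) x) < e" by blast
  qed
  then show "uniformly_convergent_on K (\<lambda>n. radial_int m (f n))"
    by (simp add: uniformly_convergent_eq_Cauchy)
qed

lemma cvg_radial_int:
  assumes "open S" "star0 S" "cvg k S f"
  shows "cvg k S (\<lambda>n. radial_int m (f n))"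
  using assms(3)
proof (induction k arbitrary: f m)
  case 0
  then show ?case using cvg0_radial_int[OF assms(2)] by simp
next
  case (Suc k)
  have "Ck_on 1 S (f n)" for n using Suc.prems by (simp add: cvg0_def) (metis cvg_imp_cvg0 cvg0_def)
  then show ?case
    using Suc.prems
    by (intro cvg_SucI[OF assms(1) cvg0_radial_int[OF assms(2)] radial_int_has_derivative[OF assms(1,2)]] Suc.IH) auto
qed

lemma dir_deriv_radial_int:
  fixes f :: "'a::euclidean_space \<Rightarrow> real"
  assumes "open S" "star0 S" "Ck_on 1 S f" "x \<in> S"
  shows "dir_deriv v (radial_int m f) x = radial_int (Suc m) (dir_deriv v f) x"
  using has_derivative_dir_deriv[OF radial_int_has_derivative[OF assms]] .

lemma radial_has_vector_derivative:
  fixes f :: "'a::euclidean_space \<Rightarrow> real"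
  assumes "star0 S" "Ck_on 1 S f" "x \<in> S" "s \<in> {0..1}"
  shows "((\<lambda>s. f (s *\<^sub>R x)) has_real_derivative dir_deriv x f (s *\<^sub>R x)) (at s within T)"
proof -
  have D: "(f has_derivative (\<lambda>v. dir_deriv v f (s *\<^sub>R x))) (at (s *\<^sub>R x))"
    using Ck_has_derivative[of 0 S f] assms by (auto simp: star0D)
  have "((\<lambda>s. f (s *\<^sub>R x)) has_derivative (\<lambda>h. dir_deriv (h *\<^sub>R x) f (s *\<^sub>R x))) (at s within T)"
  proof -
    have "((\<lambda>s. s *\<^sub>R x) has_derivative (\<lambda>h. h *\<^sub>R x)) (at s within T)"
      by (auto intro!: derivative_eq_intros)
    from has_derivative_compose[OF this D] show ?thesis .
  qed
  moreover have "(\<lambda>h. dir_deriv (h *\<^sub>R x) f (s *\<^sub>R x)) = (*) (dir_deriv x f (s *\<^sub>R x))"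
    using linear_cmul[OF has_derivative_linear[OF D]] by (auto simp: mult.commute)
  ultimately show ?thesis by (simp add: has_field_derivative_def)
qed

text \<open>Radial integration inverts the operator \<open>1 + E\<close>, where \<open>E\<close> is the Euler field.\<close>

lemma radial_int_euler:
  fixes f :: "'a::euclidean_space \<Rightarrow> real"
  assumes "star0 S" "Ck_on 1 S f" "x \<in> S"
  shows "radial_int 0 (\<lambda>y. f y + dir_deriv y f y) x = f x"
proof -
  have "((\<lambda>s. f (s *\<^sub>R x) + dir_deriv (s *\<^sub>R x) f (s *\<^sub>R x)) has_integral 1 * f (1 *\<^sub>R x) - 0 * f (0 *\<^sub>R x)) {0..1}"
  proof (rule fundamental_theorem_of_calculus)
    fix s :: real assume s: "s \<in> {0..1}"
    have D: "(f has_derivative (\<lambda>v. dir_deriv v f (s *\<^sub>R x))) (at (s *\<^sub>R x))"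
      using Ck_has_derivative[of 0 S f] assms s by (auto simp: star0D)
    show "((\<lambda>s. s * f (s *\<^sub>R x)) has_vector_derivative f (s *\<^sub>R x) + dir_deriv (s *\<^sub>R x) f (s *\<^sub>R x)) (at s within {0..1})"
      unfolding has_real_derivative_iff_has_vector_derivative[symmetric] linear_cmul[OF has_derivative_linear[OF D]]
      by (auto intro!: derivative_eq_intros radial_has_vector_derivative[OF assms s])
  qed simp
  then show ?thesis by (auto simp: radial_int_def dest: integral_unique)
qed

text \<open>The direction of differentiation is the endpoint \<open>x\<close>, fixed during the
  integration, whereas in \<open>radial_int_euler\<close> it moves with the point of evaluation.
  This form yields the coefficients in Hadamard's lemma.\<close>

lemma radial_int_hadamard:
  fixes f :: "'a::euclidean_space \<Rightarrow> real"
  assumes "star0 S" "Ck_on 1 S f" "x \<in> S"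
  shows "f x = f 0 + radial_int 0 (\<lambda>y. dir_deriv x f y) x"
proof -
  have "((\<lambda>s. dir_deriv x f (s *\<^sub>R x)) has_integral f (1 *\<^sub>R x) - f (0 *\<^sub>R x)) {0..1}"
    by (rule fundamental_theorem_of_calculus)
      (auto simp: has_real_derivative_iff_has_vector_derivative[symmetric] intro!: radial_has_vector_derivative[OF assms])
  then show ?thesis by (auto simp: radial_int_def dest: integral_unique)
qed


section \<open>Closure properties of smooth functions\<close>

lemma Ck_on_le: "Ck_on m S f \<Longrightarrow> k \<le> m \<Longrightarrow> Ck_on k S f"
  by (induction m) (auto simp: le_Suc_eq dest: Ck_on_SucD simp del: Ck_on.simps(2))

lemma Ck_on_imp_continuous: "Ck_on k S f \<Longrightarrow> continuous_on S f"
  using Ck_on_le[of k S f 0] by simp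

lemma smooth_on_Ck: "smooth_on S f \<Longrightarrow> Ck_on k S f"
  by (simp add: smooth_on_def)

lemma smooth_on_continuous: "smooth_on S f \<Longrightarrow> continuous_on S f"
  using smooth_on_Ck[of S f 0] by simp

lemma smooth_on_cong: "open S \<Longrightarrow> (\<And>y. y \<in> S \<Longrightarrow> f y = g y) \<Longrightarrow> smooth_on S f \<longleftrightarrow> smooth_on S g"
  unfolding smooth_on_def using Ck_on_cong by metis

lemma smooth_on_subset: "smooth_on S f \<Longrightarrow> T \<subseteq> S \<Longrightarrow> smooth_on T f"
  unfolding smooth_on_def using Ck_on_subset by blast

lemma smooth_on_locally:
  "(\<And>x. x \<in> S \<Longrightarrow> \<exists>T. open T \<and> x \<in> T \<and> smooth_on T f) \<Longrightarrow> smooth_on S f"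
  unfolding smooth_on_def by (intro allI Ck_on_locally) meson

lemma smooth_on_has_derivative:
  "smooth_on S f \<Longrightarrow> x \<in> S \<Longrightarrow> (f has_derivative (\<lambda>v. dir_deriv v f x)) (at x)"
  using Ck_has_derivative smooth_on_Ck by blast

lemma smooth_on_dir_deriv: "smooth_on S f \<Longrightarrow> smooth_on S (dir_deriv v f)"
  unfolding smooth_on_def using Ck_on.simps(2) by blast

lemma Ck_on_add:
  fixes f g :: "'a::euclidean_space \<Rightarrow> real"
  shows "open S \<Longrightarrow> Ck_on k S f \<Longrightarrow> Ck_on k S g \<Longrightarrow> Ck_on k S (\<lambda>x. f x + g x)"
  using cvg_add[of S k "\<lambda>n. f" "\<lambda>n. g"] by (simp add: cvg_const_iff)

lemma Ck_on_mult:
  fixes f g :: "'a::euclidean_space \<Rightarrow> real"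
  shows "open S \<Longrightarrow> Ck_on k S f \<Longrightarrow> Ck_on k S g \<Longrightarrow> Ck_on k S (\<lambda>x. f x * g x)"
  using cvg_mult[of S k "\<lambda>n. f" "\<lambda>n. g"] by (simp add: cvg_const_iff)

lemma Ck_on_sum:
  fixes f :: "'i \<Rightarrow> 'a::euclidean_space \<Rightarrow> real"
  shows "open S \<Longrightarrow> (\<And>i. i \<in> I \<Longrightarrow> Ck_on k S (f i)) \<Longrightarrow> Ck_on k S (\<lambda>x. \<Sum>i\<in>I. f i x)"
  using cvg_sum[of S I k "\<lambda>i n. f i"] by (simp add: cvg_const_iff)

lemma Ck_on_prod:
  fixes f :: "'i \<Rightarrow> 'a::euclidean_space \<Rightarrow> real"
  assumes "open S" "\<And>i. i \<in> I \<Longrightarrow> Ck_on k S (f i)"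
  shows "Ck_on k S (\<lambda>x. \<Prod>i\<in>I. f i x)"
  using assms(2) by (induction I rule: infinite_finite_induct) (auto intro!: Ck_on_mult assms(1))

lemma Ck_on_minus:
  fixes f :: "'a::euclidean_space \<Rightarrow> real"
  shows "open S \<Longrightarrow> Ck_on k S f \<Longrightarrow> Ck_on k S (\<lambda>x. - f x)"
  using Ck_on_mult[of S k "\<lambda>x. -1" f] by simp

lemma Ck_on_diff:
  fixes f g :: "'a::euclidean_space \<Rightarrow> real"
  shows "open S \<Longrightarrow> Ck_on k S f \<Longrightarrow> Ck_on k S g \<Longrightarrow> Ck_on k S (\<lambda>x. f x - g x)"
  using Ck_on_add[of S k f "\<lambda>x. - g x"] Ck_on_minus[of S k g] by simp

lemma Ck_on_compose_real:
  fixes G :: "'b::euclidean_space \<Rightarrow> real" and f :: "'a::euclidean_space \<Rightarrow> 'b"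
  assumes "open S" "open T" "Ck_on k T G" "\<And>b. b \<in> Basis \<Longrightarrow> Ck_on k S (\<lambda>x. f x \<bullet> b)" "f ` S \<subseteq> T"
  shows "Ck_on k S (\<lambda>x. G (f x))"
proof -
  have "cvg k S (\<lambda>n x. G (f x))"
  proof (rule cvg_compose[OF assms(1-3)])
    show "cvg k S (\<lambda>n x. f x \<bullet> b)" if "b \<in> Basis" for b
      using assms(4)[OF that] by (simp add: cvg_const_iff)
    have "continuous_on S f"
      by (subst continuous_on_componentwise) (use assms(4) Ck_on_imp_continuous in blast)
    then show "\<exists>C. compact C \<and> C \<subseteq> T \<and> (\<forall>n::nat. \<forall>x\<in>K. f x \<in> C)" if "compact K" "K \<subseteq> S" for K
      using that assms(5) by (intro exI[of _ "f ` K"]) (auto intro: compact_continuous_image continuous_on_subset)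
  qed
  then show ?thesis by (simp add: cvg_const_iff)
qed

lemma Ck_on_vec_iff:
  fixes f :: "'a::euclidean_space \<Rightarrow> real ^ 'n"
  assumes "open S"
  shows "Ck_on k S f \<longleftrightarrow> (\<forall>i. Ck_on k S (\<lambda>x. f x $ i))"
proof (induction k arbitrary: f)
  case 0
  show ?case
    using continuous_on_component[of S f] continuous_on_vec_lambda[of S "\<lambda>i x. f x $ i"] by auto
next
  case (Suc k)
  show ?case
  proof
    assume f: "Ck_on (Suc k) S f"
    have D: "((\<lambda>x. f x $ i) has_derivative (\<lambda>v. dir_deriv v f x $ i)) (at x)" if "x \<in> S" for x i
      using bounded_linear.has_derivative[OF bounded_linear_vec_nth Ck_has_derivative[OF f that]] .
    show "\<forall>i. Ck_on (Suc k) S (\<lambda>x. f x $ i)"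
    proof
      fix i show "Ck_on (Suc k) S (\<lambda>x. f x $ i)"
        by (rule Ck_on_SucI[OF assms D]) (use f Suc.IH in auto)
    qed
  next
    assume f: "\<forall>i. Ck_on (Suc k) S (\<lambda>x. f x $ i)"
    have D: "(f has_derivative (\<lambda>v. \<chi> i. dir_deriv v (\<lambda>x. f x $ i) x)) (at x)" if "x \<in> S" for x
      by (subst has_derivative_componentwise_within)
        (use f that in \<open>auto simp: Basis_vec_def inner_axis intro!: differentiable_has_derivative\<close>)
    show "Ck_on (Suc k) S f"
      by (rule Ck_on_SucI[OF assms D]) (use f Suc.IH in auto)
  qed
qed

lemma smooth_on_vec_iff:
  fixes f :: "'a::euclidean_space \<Rightarrow> real ^ 'n"
  shows "open S \<Longrightarrow> smooth_on S f \<longleftrightarrow> (\<forall>i. smooth_on S (\<lambda>x. f x $ i))"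
  unfolding smooth_on_def using Ck_on_vec_iff by metis

lemma Basis_vec_inner: "b \<in> Basis \<Longrightarrow> \<exists>i. \<forall>y::real^'n. y \<bullet> b = y $ i"
  by (auto simp: Basis_vec_def inner_axis)

lemma Ck_on_compose:
  fixes G :: "real^'n \<Rightarrow> real" and f :: "'a::euclidean_space \<Rightarrow> real^'n"
  assumes "open S" "open T" "Ck_on k T G" "Ck_on k S f" "f ` S \<subseteq> T"
  shows "Ck_on k S (\<lambda>x. G (f x))"
proof (rule Ck_on_compose_real[OF assms(1-3) _ assms(5)])
  fix b :: "real^'n" assume "b \<in> Basis"
  then obtain i where "\<forall>y::real^'n. y \<bullet> b = y $ i" using Basis_vec_inner by blast
  then show "Ck_on k S (\<lambda>x. f x \<bullet> b)" using assms(4) Ck_on_vec_iff[OF assms(1)] by auto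
qed

lemma smooth_on_compose:
  fixes G :: "real^'n \<Rightarrow> real" and f :: "'a::euclidean_space \<Rightarrow> real^'n"
  shows "open S \<Longrightarrow> open T \<Longrightarrow> smooth_on T G \<Longrightarrow> smooth_on S f \<Longrightarrow> f ` S \<subseteq> T \<Longrightarrow>
    smooth_on S (\<lambda>x. G (f x))"
  unfolding smooth_on_def by (blast intro: Ck_on_compose)

lemma smooth_on_compose_vec:
  fixes G :: "real^'n \<Rightarrow> real^'m" and f :: "'a::euclidean_space \<Rightarrow> real^'n"
  shows "open S \<Longrightarrow> open T \<Longrightarrow> smooth_on T G \<Longrightarrow> smooth_on S f \<Longrightarrow> f ` S \<subseteq> T \<Longrightarrow>
    smooth_on S (\<lambda>x. G (f x))"
  by (simp add: smooth_on_vec_iff[of S "\<lambda>x. G (f x)"] smooth_on_vec_iff[of T G])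
    (auto intro: smooth_on_compose)

lemma smooth_on_nth [simp]: "smooth_on S (\<lambda>x::real^'n. x $ i)"
  unfolding smooth_on_def using Ck_on_bounded_linear[OF bounded_linear_vec_nth] by blast

lemma smooth_on_const [simp]: "smooth_on S (\<lambda>x. c)"
  unfolding smooth_on_def by simp

lemma smooth_on_add:
  fixes f g :: "'a::euclidean_space \<Rightarrow> real"
  shows "open S \<Longrightarrow> smooth_on S f \<Longrightarrow> smooth_on S g \<Longrightarrow> smooth_on S (\<lambda>x. f x + g x)"
  unfolding smooth_on_def using Ck_on_add by blast

lemma smooth_on_diff:
  fixes f g :: "'a::euclidean_space \<Rightarrow> real"
  shows "open S \<Longrightarrow> smooth_on S f \<Longrightarrow> smooth_on S g \<Longrightarrow> smooth_on S (\<lambda>x. f x - g x)"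
  unfolding smooth_on_def using Ck_on_diff by blast

lemma smooth_on_mult:
  fixes f g :: "'a::euclidean_space \<Rightarrow> real"
  shows "open S \<Longrightarrow> smooth_on S f \<Longrightarrow> smooth_on S g \<Longrightarrow> smooth_on S (\<lambda>x. f x * g x)"
  unfolding smooth_on_def using Ck_on_mult by blast

lemma smooth_on_sum:
  fixes f :: "'i \<Rightarrow> 'a::euclidean_space \<Rightarrow> real"
  shows "open S \<Longrightarrow> (\<And>i. i \<in> I \<Longrightarrow> smooth_on S (f i)) \<Longrightarrow> smooth_on S (\<lambda>x. \<Sum>i\<in>I. f i x)"
  unfolding smooth_on_def using Ck_on_sum by metis

lemma smooth_on_radial_int:
  fixes f :: "'a::euclidean_space \<Rightarrow> real"
  shows "open S \<Longrightarrow> star0 S \<Longrightarrow> smooth_on S f \<Longrightarrow> smooth_on S (radial_int m f)"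
  unfolding smooth_on_def using cvg_radial_int[of S _ "\<lambda>n. f" m] by (auto simp: cvg_const_iff)

lemma Ck_on_inverse: "Ck_on k (- {0::real}) inverse"
proof (induction k)
  case 0
  then show ?case by (simp add: continuous_on_inverse)
next
  case (Suc k)
  show ?case
  proof (rule Ck_on_SucI)
    show "(inverse has_derivative (\<lambda>v. - (inverse x * v * inverse x))) (at x)" if "x \<in> - {0}" for x :: real
      using has_derivative_inverse'[of x] that by simp
    show "Ck_on k (- {0}) (\<lambda>x. - (inverse x * v * inverse x))" for v :: real
      by (intro Ck_on_minus Ck_on_mult Suc.IH Ck_on_const) auto
  qed auto
qed

lemma Ck_on_divide:
  fixes f g :: "'a::euclidean_space \<Rightarrow> real"
  assumes "open S" "Ck_on k S f" "Ck_on k S g" "\<And>x. x \<in> S \<Longrightarrow> g x \<noteq> 0"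
  shows "Ck_on k S (\<lambda>x. f x / g x)"
  unfolding divide_inverse
  by (intro Ck_on_mult assms(1,2) Ck_on_compose_real[OF assms(1) _ Ck_on_inverse])
    (use assms in auto)

lemma Ck_on_det:
  fixes M :: "'a::euclidean_space \<Rightarrow> real^'n^'n"
  assumes "open S" "\<And>i j. Ck_on k S (\<lambda>x. M x $ i $ j)"
  shows "Ck_on k S (\<lambda>x. det (M x))"
  unfolding det_def using assms by (intro Ck_on_sum Ck_on_mult Ck_on_prod Ck_on_const) auto

text \<open>Cramer's rule: the entries of the inverse are quotients of determinants formed from the
  entries of \<open>M\<close>.\<close>

lemma smooth_matrix_inv:
  fixes M :: "'a::euclidean_space \<Rightarrow> real^'n^'n"
  assumes S: "open S" and M: "\<And>i j. smooth_on S (\<lambda>x. M x $ i $ j)"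
    and inv: "\<And>x. x \<in> S \<Longrightarrow> invertible (M x)"
  obtains N :: "'a \<Rightarrow> real^'n^'n" where "\<And>i j. smooth_on S (\<lambda>x. N x $ i $ j)"
    "\<And>x. x \<in> S \<Longrightarrow> M x ** N x = mat 1" "\<And>x. x \<in> S \<Longrightarrow> N x ** M x = mat 1"
proof
  define N where "N x = (\<chi> i j. det (\<chi> i' j'. if j' = i then axis j 1 $ i' else M x $ i' $ j') / det (M x))"
    for x
  show "smooth_on S (\<lambda>x. N x $ i $ j)" for i j
  proof -
    have "Ck_on k S (\<lambda>x. if j' = i then axis j 1 $ i' else M x $ i' $ j')" for k i' j'
      using M by (cases "j' = i") (auto simp: smooth_on_def)
    then show ?thesis
      unfolding smooth_on_def N_def
      using inv M by (auto intro!: Ck_on_divide Ck_on_det S simp: invertible_det_nz smooth_on_def)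
  qed
  have *: "M x *v column j (N x) = axis j 1" if "x \<in> S" for x j
    using cramer[of "M x" "column j (N x)" "axis j 1"] inv[OF that]
    by (simp add: invertible_det_nz column_def N_def vec_eq_iff)
  show MN: "M x ** N x = mat 1" if "x \<in> S" for x
    using *[OF that] by (auto simp: vec_eq_iff matrix_matrix_mult_def matrix_vector_mult_def column_def mat_def axis_def)
  show "N x ** M x = mat 1" if "x \<in> S" for x
    using MN[OF that] matrix_left_right_inverse by blast
qed

text \<open>Locally uniform convergence of the first derivatives makes their limit \<open>g'\<close>
  the derivative of \<open>g\<close>. The derivatives again form a convergent sequence, of order one
  less, so induction gives the regularity of \<open>g'\<close>.\<close>

lemma cvg_limit:
  fixes f :: "nat \<Rightarrow> 'a::euclidean_space \<Rightarrow> real"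
  assumes S: "open S" and "cvg k S f" "\<And>x. x \<in> S \<Longrightarrow> (\<lambda>n. f n x) \<longlonglongrightarrow> g x"
  shows "Ck_on k S g"
  using assms(2,3)
proof (induction k arbitrary: f g)
  case 0
  show ?case unfolding Ck_on.simps
  proof (rule continuous_at_imp_continuous_on, rule ballI)
    fix x assume "x \<in> S"
    then obtain e where e: "e > 0" "cball x e \<subseteq> S" using S open_contains_cball by blast
    then have "uniformly_convergent_on (cball x e) f" using 0 by (simp add: cvg0_def)
    then obtain l where l: "uniform_limit (cball x e) f l sequentially"
      by (auto simp: uniformly_convergent_on_def)
    have "l y = g y" if "y \<in> cball x e" for y
      using tendsto_uniform_limitI[OF l that] 0(2)[of y] e that LIMSEQ_unique by blast
    moreover have "continuous_on (cball x e) l"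
      by (rule uniform_limit_theorem[OF always_eventually l]) (use 0 e in \<open>auto simp: cvg0_def intro: continuous_on_subset\<close>)
    ultimately have "continuous_on (cball x e) g" using continuous_on_eq[of "cball x e" l g] by blast
    then show "isCont g x" using e
      by (meson ball_subset_cball centre_in_ball continuous_on_eq_continuous_at continuous_on_subset open_ball)
  qed
next
  case (Suc k)
  define g' where "g' x v = lim (\<lambda>n. dir_deriv v (f n) x)" for x v
  have conv: "(\<lambda>n. dir_deriv v (f n) x) \<longlonglongrightarrow> g' x v" if "x \<in> S" for x v
  proof -
    have "uniformly_convergent_on {x} (\<lambda>n. dir_deriv v (f n))"
      using Suc.prems(1) that cvg_imp_cvg0[of k S "\<lambda>n. dir_deriv v (f n)"] by (simp add: cvg0_def)
    then have "convergent (\<lambda>n. dir_deriv v (f n) x)"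
      by (rule uniformly_convergent_imp_convergent) simp
    then show ?thesis unfolding g'_def by (simp add: convergent_LIMSEQ_iff)
  qed
  have D: "(g has_derivative g' x) (at x)" if x: "x \<in> S" for x
  proof -
    obtain e where e: "e > 0" "cball x e \<subseteq> S" using S x open_contains_cball by blast
    have lin: "linear (\<lambda>v. dir_deriv v (f n) y)" if "y \<in> S" for n y
      using cvg_has_derivative[OF Suc.prems(1) that] has_derivative_linear by blast
    have lin': "linear (g' y)" if "y \<in> S" for y
    proof (rule linearI)
      fix a b :: 'a
      have "(\<lambda>n. dir_deriv (a + b) (f n) y) = (\<lambda>n. dir_deriv a (f n) y + dir_deriv b (f n) y)"
        using linear_add[OF lin[OF that]] by auto
      then show "g' y (a + b) = g' y a + g' y b"
        using LIMSEQ_unique[OF conv[OF that, of "a + b"]] tendsto_add[OF conv[OF that, of a] conv[OF that, of b]]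
        by simp
    next
      fix c and a :: 'a
      have "(\<lambda>n. dir_deriv (c *\<^sub>R a) (f n) y) = (\<lambda>n. c * dir_deriv a (f n) y)"
        using linear_cmul[OF lin[OF that]] by auto
      then show "g' y (c *\<^sub>R a) = c *\<^sub>R g' y a"
        using LIMSEQ_unique[OF conv[OF that, of "c *\<^sub>R a"]] tendsto_mult[OF tendsto_const[of c] conv[OF that, of a]]
        by simp
    qed
    have unif: "uniform_limit (cball x e) (\<lambda>n. dir_deriv b (f n)) (\<lambda>y. g' y b) sequentially" for b
    proof -
      have "uniformly_convergent_on (cball x e) (\<lambda>n. dir_deriv b (f n))"
        using Suc.prems(1) e cvg_imp_cvg0[of k S "\<lambda>n. dir_deriv b (f n)"] by (auto simp: cvg0_def)
      then obtain l where l: "uniform_limit (cball x e) (\<lambda>n. dir_deriv b (f n)) l sequentially"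
        by (auto simp: uniformly_convergent_on_def)
      have "l y = g' y b" if "y \<in> cball x e" for y
        using tendsto_uniform_limitI[OF l that] conv[of y b] e that LIMSEQ_unique by blast
      then show ?thesis using l by (simp add: uniform_limit_iff)
    qed
    have "\<exists>h. \<forall>y\<in>cball x e. (\<lambda>n. f n y) \<longlonglongrightarrow> h y \<and> (h has_derivative g' y) (at y within cball x e)"
    proof (rule has_derivative_sequence)
      show "(f n has_derivative (\<lambda>v. dir_deriv v (f n) y)) (at y within cball x e)" if "y \<in> cball x e" for n y
        using cvg_has_derivative[OF Suc.prems(1)] e that has_derivative_at_withinI by blast
      show "(\<lambda>n. f n x) \<longlonglongrightarrow> g x" using Suc.prems x by auto
      \<comment> \<open>Convergence as linear maps follows from convergence on the finitely many
        basis vectors, each of which gets an equal share of \<open>r\<close>.\<close>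
      fix r :: real assume r: "r > 0"
      have "\<forall>\<^sub>F n in sequentially. \<forall>b\<in>Basis. \<forall>y\<in>cball x e. dist (dir_deriv b (f n) y) (g' y b) < r / DIM('a)"
      proof (rule eventually_ball_finite[OF finite_Basis], rule ballI)
        show "\<forall>\<^sub>F n in sequentially. \<forall>y\<in>cball x e. dist (dir_deriv b (f n) y) (g' y b) < r / DIM('a)" for b
          by (rule uniform_limitD[OF unif]) (use r in simp)
      qed
      then show "\<forall>\<^sub>F n in sequentially. \<forall>y\<in>cball x e. \<forall>h. norm (dir_deriv h (f n) y - g' y h) \<le> r * norm h"
      proof eventually_elim
        case (elim n)
        show ?case
        proof (intro ballI allI)
          fix y h assume y: "y \<in> cball x e"
          then have "y \<in> S" using e by auto
          have lin2: "linear (\<lambda>h. dir_deriv h (f n) y - g' y h)"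
            by (intro linear_compose_sub lin lin' \<open>y \<in> S\<close>)
          have "dir_deriv h (f n) y - g' y h = (\<Sum>b\<in>Basis. (h \<bullet> b) *\<^sub>R (dir_deriv b (f n) y - g' y b))"
            using linear_sum[OF lin2, of "\<lambda>b. (h \<bullet> b) *\<^sub>R b" Basis] linear_cmul[OF lin2]
            by (simp add: euclidean_representation)
          also have "norm \<dots> \<le> (\<Sum>b\<in>(Basis::'a set). norm h * (r / DIM('a)))"
          proof (rule order_trans[OF norm_sum sum_mono])
            fix b :: 'a assume b: "b \<in> Basis"
            have "\<bar>h \<bullet> b\<bar> * \<bar>dir_deriv b (f n) y - g' y b\<bar> \<le> norm h * (r / DIM('a))"
              using elim y b Basis_le_norm[OF b, of h] by (intro mult_mono) (auto simp: dist_real_def less_imp_le)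
            then show "norm ((h \<bullet> b) *\<^sub>R (dir_deriv b (f n) y - g' y b)) \<le> norm h * (r / DIM('a))"
              by (simp add: abs_mult)
          qed
          also have "\<dots> = r * norm h" by simp
          finally show "norm (dir_deriv h (f n) y - g' y h) \<le> r * norm h" .
        qed
      qed
    qed (use e in auto)
    then obtain h where h: "\<And>y. y \<in> cball x e \<Longrightarrow> (\<lambda>n. f n y) \<longlonglongrightarrow> h y"
      "\<And>y. y \<in> cball x e \<Longrightarrow> (h has_derivative g' y) (at y within cball x e)" by blast
    have "(h has_derivative g' x) (at x within ball x e)"
      using h(2)[of x] e has_derivative_subset[OF _ ball_subset_cball] by auto
    then have "(h has_derivative g' x) (at x)" using e by (simp add: at_within_open[of x "ball x e"])
    moreover have "h y = g y" if "y \<in> ball x e" for y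
    proof (rule LIMSEQ_unique[OF h(1) Suc.prems(2)])
      show "y \<in> cball x e" using that by simp
      then show "y \<in> S" using e by blast
    qed
    ultimately show ?thesis
      using has_derivative_cong_open[of "ball x e" x h g] e by auto
  qed
  show ?case
  proof (rule Ck_on_SucI[OF S D])
    fix v show "Ck_on k S (\<lambda>x. g' x v)"
      by (rule Suc.IH[of "\<lambda>n. dir_deriv v (f n)"]) (use Suc.prems conv in auto)
  qed
qed


section \<open>Picard iteration with smooth dependence on parameters\<close>


lemma dir_deriv_add:
  "f differentiable (at x) \<Longrightarrow> g differentiable (at x) \<Longrightarrow>
    dir_deriv v (\<lambda>y. f y + g y) x = dir_deriv v f x + dir_deriv v g x"
  by (rule has_derivative_dir_deriv) (intro has_derivative_add differentiable_has_derivative)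

lemma dir_deriv_diff:
  "f differentiable (at x) \<Longrightarrow> g differentiable (at x) \<Longrightarrow>
    dir_deriv v (\<lambda>y. f y - g y) x = dir_deriv v f x - dir_deriv v g x"
  by (rule has_derivative_dir_deriv) (intro has_derivative_diff differentiable_has_derivative)

lemma dir_deriv_mult:
  fixes f g :: "'a::real_normed_vector \<Rightarrow> real"
  shows "f differentiable (at x) \<Longrightarrow> g differentiable (at x) \<Longrightarrow>
    dir_deriv v (\<lambda>y. f y * g y) x = f x * dir_deriv v g x + dir_deriv v f x * g x"
  by (rule has_derivative_dir_deriv) (intro has_derivative_mult differentiable_has_derivative)

lemma dir_deriv_sum:
  "(\<And>i. i \<in> I \<Longrightarrow> f i differentiable (at x)) \<Longrightarrow>
    dir_deriv v (\<lambda>y. \<Sum>i\<in>I. f i y) x = (\<Sum>i\<in>I. dir_deriv v (f i) x)"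
  by (rule has_derivative_dir_deriv) (intro has_derivative_sum differentiable_has_derivative)

lemma dir_deriv_nth [simp]: "dir_deriv v (\<lambda>y. y $ i) x = v $ i"
  by (rule has_derivative_dir_deriv) (rule bounded_linear_imp_has_derivative[OF bounded_linear_vec_nth])

lemma dir_deriv_const [simp]: "dir_deriv v (\<lambda>y. c) x = 0"
  by (rule has_derivative_dir_deriv) (rule has_derivative_const)

lemma differentiable_nth [simp]: "(\<lambda>y. y $ i) differentiable (at x)"
  using bounded_linear_imp_differentiable[OF bounded_linear_vec_nth] .

lemma dir_deriv_component:
  fixes f :: "'a::real_normed_vector \<Rightarrow> real^'n"
  assumes "f differentiable (at x)"
  shows "dir_deriv v (\<lambda>y. f y $ i) x = dir_deriv v f x $ i"
  by (rule has_derivative_dir_deriv)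
    (rule bounded_linear.has_derivative[OF bounded_linear_vec_nth differentiable_has_derivative[OF assms]])

lemma dir_deriv_expand:
  fixes f :: "real^'n \<Rightarrow> 'b::real_normed_vector"
  assumes "f differentiable (at x)"
  shows "dir_deriv v f x = (\<Sum>l\<in>UNIV. v $ l *\<^sub>R dir_deriv (axis l 1) f x)"
proof -
  have lin: "linear (\<lambda>v. dir_deriv v f x)"
    using differentiable_has_derivative[OF assms] has_derivative_linear by blast
  have "v = (\<Sum>l\<in>UNIV. v $ l *\<^sub>R axis l 1)"
    by (simp add: basis_expansion flip: scalar_mult_eq_scaleR)
  then have "dir_deriv v f x = dir_deriv (\<Sum>l\<in>UNIV. v $ l *\<^sub>R axis l 1) f x" by simp
  then show ?thesis by (simp only: linear_sum[OF lin] linear_cmul[OF lin])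
qed

lemma dir_deriv_compose:
  fixes G :: "real^'n \<Rightarrow> real" and f :: "'a::real_normed_vector \<Rightarrow> real^'n"
  assumes "f differentiable (at x)" "G differentiable (at (f x))"
  shows "dir_deriv v (\<lambda>y. G (f y)) x = (\<Sum>l\<in>UNIV. dir_deriv (axis l 1) G (f x) * dir_deriv v (\<lambda>y. f y $ l) x)"
proof -
  have "dir_deriv v (\<lambda>y. G (f y)) x = dir_deriv (dir_deriv v f x) G (f x)"
    by (rule has_derivative_dir_deriv[OF has_derivative_compose[OF
          differentiable_has_derivative[OF assms(1)] differentiable_has_derivative[OF assms(2)]]])
  also have "\<dots> = (\<Sum>l\<in>UNIV. dir_deriv v f x $ l *\<^sub>R dir_deriv (axis l 1) G (f x))"
    by (rule dir_deriv_expand[OF assms(2)])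
  finally show ?thesis by (simp add: dir_deriv_component[OF assms(1)] mult.commute)
qed

lemma Ck_on_differentiable: "Ck_on (Suc k) S f \<Longrightarrow> x \<in> S \<Longrightarrow> f differentiable (at x)"
  by simp

lemma smooth_on_differentiable: "smooth_on S f \<Longrightarrow> x \<in> S \<Longrightarrow> f differentiable (at x)"
  using Ck_on_differentiable smooth_on_Ck by blast

text \<open>The bounds of the partial derivatives are kept apart because in
  \<open>dil_vanish_bound\<close> they carry different powers of \<open>t\<close>.\<close>

lemma mean_value_partials:
  fixes f :: "real^'n \<Rightarrow> real"
  assumes "convex C" "\<And>u. u \<in> C \<Longrightarrow> f differentiable (at u)" "y \<in> C" "z \<in> C"
    "\<And>u l. u \<in> C \<Longrightarrow> \<bar>dir_deriv (axis l 1) f u\<bar> \<le> B l"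
  shows "\<bar>f y - f z\<bar> \<le> (\<Sum>l\<in>UNIV. B l * \<bar>y $ l - z $ l\<bar>)"
proof -
  have C: "z + t *\<^sub>R (y - z) \<in> C" if "0 \<le> t" "t \<le> 1" for t
    using convexD_alt[OF assms(1,4,3) that] by (simp add: algebra_simps)
  have "\<exists>t\<in>{0<..<1}. f (z + 1 *\<^sub>R (y - z)) - f (z + 0 *\<^sub>R (y - z)) = dir_deriv ((1 - 0) *\<^sub>R (y - z)) f (z + t *\<^sub>R (y - z))"
  proof (rule mvt_simple)
    fix t :: real assume "0 \<le> t" "t \<le> 1"
    then have D: "(f has_derivative (\<lambda>v. dir_deriv v f (z + t *\<^sub>R (y - z)))) (at (z + t *\<^sub>R (y - z)))"
      using assms(2) C differentiable_has_derivative by auto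
    have "((\<lambda>t. z + t *\<^sub>R (y - z)) has_derivative (\<lambda>h. h *\<^sub>R (y - z))) (at t within {0..1})"
      by (auto intro!: derivative_eq_intros)
    from has_derivative_compose[OF this D]
    show "((\<lambda>t. f (z + t *\<^sub>R (y - z))) has_derivative (\<lambda>h. dir_deriv (h *\<^sub>R (y - z)) f (z + t *\<^sub>R (y - z)))) (at t within {0..1})" .
  qed simp
  then obtain t where t: "0 < t" "t < 1" "f y - f z = dir_deriv (y - z) f (z + t *\<^sub>R (y - z))" by auto
  have u: "z + t *\<^sub>R (y - z) \<in> C" using C t by auto
  have "f y - f z = (\<Sum>l\<in>UNIV. (y - z) $ l *\<^sub>R dir_deriv (axis l 1) f (z + t *\<^sub>R (y - z)))"
    unfolding t(3) by (rule dir_deriv_expand[OF assms(2)[OF u]])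
  then have "\<bar>f y - f z\<bar> \<le> (\<Sum>l\<in>UNIV. \<bar>(y - z) $ l * dir_deriv (axis l 1) f (z + t *\<^sub>R (y - z))\<bar>)"
    unfolding real_scaleR_def by (simp only: sum_abs)
  also have "\<dots> \<le> (\<Sum>l\<in>UNIV. B l * \<bar>y $ l - z $ l\<bar>)"
    using assms(5)[OF u] by (intro sum_mono) (simp add: abs_mult mult.commute[of "B _"] mult_left_mono)
  finally show ?thesis .
qed

text \<open>The number \<open>e / (1 - q)\<close> is the fixed point of the map taking
  \<open>D\<close> to \<open>e + q * D\<close>.\<close>

lemma geometric_contraction_step:
  fixes q e :: real
  assumes "q < 1"
  shows "e + q * (q ^ j * b + e / (1 - q)) = q ^ Suc j * b + e / (1 - q)"
  using assms by (simp add: field_simps)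

text \<open>A contraction with factor \<open>q\<close> whose coefficients may still vary: the error
  \<open>e\<close> stands for their not yet having converged. Iterating \<open>j\<close> times
  beyond the threshold \<open>N\<close> leaves at most \<open>q ^ j\<close> times an a priori bound,
  plus the fixed point \<open>e / (1 - q)\<close>.\<close>

lemma picard_uniformly_Cauchy:
  fixes h :: "nat \<Rightarrow> 'i \<Rightarrow> 'a \<Rightarrow> real"
  assumes q: "0 \<le> q" "q < 1" and bound: "\<And>n k x. x \<in> K \<Longrightarrow> \<bar>h n k x\<bar> \<le> B"
    and step: "\<And>e. e > 0 \<Longrightarrow> \<exists>N. \<forall>m\<ge>N. \<forall>n\<ge>N. \<forall>D\<ge>0. (\<forall>k. \<forall>x\<in>K. \<bar>h m k x - h n k x\<bar> \<le> D) \<longrightarrow>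
      (\<forall>k. \<forall>x\<in>K. \<bar>h (Suc m) k x - h (Suc n) k x\<bar> \<le> e + q * D)"
  shows "uniformly_Cauchy_on K (\<lambda>n. h n k)"
  unfolding uniformly_Cauchy_on_def
proof (intro allI impI)
  fix \<epsilon> :: real assume \<epsilon>: "\<epsilon> > 0"
  \<comment> \<open>Chosen to make the fixed point \<open>e / (1 - q)\<close> equal to \<epsilon>/4;
    the geometric term will take another \<epsilon>/2.\<close>
  define e where "e = (\<epsilon> / 4) * (1 - q)"
  \<comment> \<open>A bound for the difference of two iterates. The maximum keeps it nonnegative
    even if \<open>K\<close> is empty.\<close>
  define B' where "B' = 2 * max B 0"
  have "q \<noteq> 1" using q by simp
  then have "e / (1 - q) = \<epsilon> / 4" unfolding e_def by (intro nonzero_mult_div_cancel_right) simp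
  moreover have "e > 0" using \<epsilon> q by (simp add: e_def)
  ultimately have e: "e > 0" "e / (1 - q) = \<epsilon> / 4" by simp_all
  have B': "B' \<ge> 0" by (simp add: B'_def)
  define E where "E = e / (1 - q)"
  have E: "E = \<epsilon> / 4" "E \<ge> 0" using e \<epsilon> q by (simp_all only: E_def)
  have E_step: "q ^ Suc j * B' + E = e + q * (q ^ j * B' + E)" for j
    unfolding E_def by (rule geometric_contraction_step[OF q(2), symmetric])
  obtain N where N: "\<And>m n D k x. m \<ge> N \<Longrightarrow> n \<ge> N \<Longrightarrow> D \<ge> 0 \<Longrightarrow> (\<And>k x. x \<in> K \<Longrightarrow> \<bar>h m k x - h n k x\<bar> \<le> D) \<Longrightarrow>
      x \<in> K \<Longrightarrow> \<bar>h (Suc m) k x - h (Suc n) k x\<bar> \<le> e + q * D"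
    using step[OF e(1)] by metis
  have claim: "\<bar>h m k x - h n k x\<bar> \<le> q ^ j * B' + E"
    if "m \<ge> N + j" "n \<ge> N + j" "x \<in> K" for j m n k x
    using that
  proof (induction j arbitrary: m n k x)
    case 0
    have "\<bar>h m k x - h n k x\<bar> \<le> B'" using bound[OF 0(3), of m k] bound[OF 0(3), of n k] by (auto simp: B'_def)
    then show ?case using E(2) by simp
  next
    case (Suc j)
    obtain m' n' where mn: "m = Suc m'" "n = Suc n'" "m' \<ge> N + j" "n' \<ge> N + j"
      using Suc.prems by (cases m; cases n) auto
    show ?case unfolding mn(1,2) E_step
    proof (rule N[OF _ _ _ Suc.IH[OF mn(3,4)] Suc.prems(3)])
      show "0 \<le> q ^ j * B' + E" using q B' E by simp
    qed (use mn in auto)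
  qed
  have "(\<lambda>j. q ^ j * B') \<longlonglongrightarrow> 0 * B'" using q by (intro tendsto_mult LIMSEQ_power_zero tendsto_const) auto
  then have "\<forall>\<^sub>F j in sequentially. q ^ j * B' < \<epsilon> / 2" using \<epsilon> by (intro order_tendstoD) auto
  then obtain j where j: "q ^ j * B' < \<epsilon> / 2" by (auto simp: eventually_sequentially)
  show "\<exists>M. \<forall>x\<in>K. \<forall>m\<ge>M. \<forall>n\<ge>M. dist (h m k x) (h n k x) < \<epsilon>"
  proof (intro exI ballI allI impI)
    fix x m n assume "x \<in> K" "m \<ge> N + j" "n \<ge> N + j"
    then have "\<bar>h m k x - h n k x\<bar> \<le> q ^ j * B' + \<epsilon> / 4" using claim[of j m n x k] E by simp
    then show "dist (h m k x) (h n k x) < \<epsilon>" using j \<epsilon> by (simp add: dist_real_def)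
  qed
qed

text \<open>Beyond some index all functions differ by less than 1 from a fixed one, and the finitely
  many earlier ones are bounded by compactness.\<close>

lemma cvg0_bounded:
  assumes "cvg0 S f" "compact K" "K \<subseteq> S"
  shows "\<exists>B. \<forall>n. \<forall>x\<in>K. \<bar>f n x\<bar> \<le> B"
proof -
  have "uniformly_Cauchy_on K f" using assms by (simp add: cvg0_def uniformly_convergent_eq_Cauchy)
  then obtain N where N: "\<And>x n. x \<in> K \<Longrightarrow> n \<ge> N \<Longrightarrow> dist (f n x) (f N x) < 1"
    unfolding uniformly_Cauchy_on_def by (metis order_refl zero_less_one)
  have "\<exists>B. \<forall>x\<in>K. \<bar>f n x\<bar> \<le> B" for n
  proof -
    have "bounded (f n ` K)"
      using assms by (auto simp: cvg0_def intro!: compact_imp_bounded compact_continuous_image intro: continuous_on_subset)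
    then show ?thesis by (auto simp: bounded_iff)
  qed
  then obtain B where B: "\<And>n x. x \<in> K \<Longrightarrow> \<bar>f n x\<bar> \<le> B n" by metis
  have "\<bar>f n x\<bar> \<le> (\<Sum>i\<le>N. \<bar>B i\<bar>) + 1" if x: "x \<in> K" for n x
  proof -
    have le: "\<bar>f i x\<bar> \<le> (\<Sum>i\<le>N. \<bar>B i\<bar>)" if "i \<le> N" for i
      using B[OF x, of i] member_le_sum[of i "{..N}" "\<lambda>i. \<bar>B i\<bar>"] that by auto
    show ?thesis
    proof (cases "n \<le> N")
      case True then show ?thesis using le[of n] by simp
    next
      case False
      then show ?thesis using N[OF x, of n] le[of N] by (auto simp: dist_real_def)
    qed
  qed
  then show ?thesis by blast
qed

lemma cvg0_bounded_family:
  fixes f :: "'i::finite \<Rightarrow> nat \<Rightarrow> 'a::euclidean_space \<Rightarrow> real"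
  assumes "\<And>i. cvg0 S (f i)" "compact K" "K \<subseteq> S"
  obtains B where "B \<ge> 0" "\<And>i n x. x \<in> K \<Longrightarrow> \<bar>f i n x\<bar> \<le> B"
proof -
  obtain B where B: "\<And>i n x. x \<in> K \<Longrightarrow> \<bar>f i n x\<bar> \<le> B i"
    using cvg0_bounded[OF assms(1) assms(2,3)] by metis
  have "\<bar>f i n x\<bar> \<le> (\<Sum>i\<in>UNIV. \<bar>B i\<bar>)" if "x \<in> K" for i n x
    using B[OF that, of i n] member_le_sum[of i UNIV "\<lambda>i. \<bar>B i\<bar>"] by auto
  then show ?thesis by (intro that[of "\<Sum>i\<in>UNIV. \<bar>B i\<bar>"]) (auto simp: sum_nonneg)
qed

lemma cvg0_Cauchy_family:
  fixes f :: "'i::finite \<Rightarrow> nat \<Rightarrow> 'a::euclidean_space \<Rightarrow> real"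
  assumes "\<And>i. cvg0 S (f i)" "compact K" "K \<subseteq> S" "e > 0"
  obtains N where "\<And>i m n x. m \<ge> N \<Longrightarrow> n \<ge> N \<Longrightarrow> x \<in> K \<Longrightarrow> \<bar>f i m x - f i n x\<bar> \<le> e"
proof -
  have "uniformly_Cauchy_on K (f i)" for i
    using assms by (simp add: cvg0_def uniformly_convergent_eq_Cauchy)
  then have "\<exists>N. \<forall>x\<in>K. \<forall>m\<ge>N. \<forall>n\<ge>N. \<bar>f i m x - f i n x\<bar> \<le> e" for i
    using \<open>e > 0\<close> unfolding uniformly_Cauchy_on_def dist_real_def by (meson less_imp_le)
  then obtain N where N: "\<And>i x m n. x \<in> K \<Longrightarrow> m \<ge> N i \<Longrightarrow> n \<ge> N i \<Longrightarrow> \<bar>f i m x - f i n x\<bar> \<le> e"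
    by metis
  have "N i \<le> Max (range N)" for i by simp
  then show ?thesis using N by (intro that[of "Max (range N)"]) (meson order_trans)
qed

text \<open>This is the recursion satisfied by the derivatives of Picard iterates; its coefficients
  converge along with the iteration. The contraction factor counts \<open>CARD('n)\<close> values of
  \<open>i\<close>, each with \<open>\<bar>x $ i\<bar> \<le> \<rho>\<close>, and as many values of
  \<open>l\<close>, each with a coefficient at most \<open>A\<close>.\<close>

lemma linear_picard_cvg0:
  fixes a :: "nat \<Rightarrow> 'n::finite \<Rightarrow> 'n \<Rightarrow> 'n \<Rightarrow> real^'n \<Rightarrow> real"
    and b \<eta> :: "nat \<Rightarrow> 'n \<Rightarrow> real^'n \<Rightarrow> real"
    and \<rho> :: real
  defines "S \<equiv> ball 0 \<rho>"
  assumes a: "\<And>i k l. cvg0 S (\<lambda>n. a n i k l)" and b: "\<And>k. cvg0 S (\<lambda>n. b n k)"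
    and A: "\<And>n i k l x. x \<in> S \<Longrightarrow> \<bar>a n i k l x\<bar> \<le> A" "A \<ge> 0" "\<rho> > 0" "\<rho> * A * (CARD('n))\<^sup>2 < 1"
    and \<eta>: "\<And>n k. continuous_on S (\<eta> n k)"
    and eq: "\<And>n k x. x \<in> S \<Longrightarrow> \<eta> (Suc n) k x = b n k x +
      (\<Sum>i\<in>UNIV. x $ i * radial_int m (\<lambda>y. \<Sum>l\<in>UNIV. a n i k l y * \<eta> n l y) x)"
  shows "cvg0 S (\<lambda>n. \<eta> n k)"
  unfolding cvg0_def
proof (intro conjI allI impI)
  show "continuous_on S (\<eta> n k)" for n by fact
next
  fix K0 assume K0: "compact K0" "K0 \<subseteq> S"
  obtain K where K: "compact K" "K0 \<subseteq> K" "K \<subseteq> S" "star0 K"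
    using compact_star_hull[OF K0] by (auto simp: S_def)
  define N where "N = real CARD('n)"
  define q where "q = \<rho> * A * N\<^sup>2"
  have q: "0 \<le> q" "q < 1" using A by (auto simp: q_def N_def)
  have N: "N > 0" by (simp add: N_def)
  have xi: "\<bar>x $ i\<bar> \<le> \<rho>" if "x \<in> K" for x i
    using component_le_norm_cart[of x i] that K by (fastforce simp: S_def)
  have aK: "\<bar>a n i k l x\<bar> \<le> A" if "x \<in> K" for n i k l x using that A K by blast
  have cont: "continuous_on K (\<lambda>y. \<Sum>l\<in>UNIV. a n i k l y * \<eta> n l y)" for n i k
  proof (intro continuous_on_sum continuous_on_mult)
    fix l
    show "continuous_on K (a n i k l)" "continuous_on K (\<eta> n l)"
      using a[of i k l] \<eta>[of n l] K(3) by (auto simp: cvg0_def intro: continuous_on_subset)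
  qed
  have sumI: "\<bar>\<Sum>i\<in>UNIV. x $ i * radial_int m (g i) x\<bar> \<le> N * (\<rho> * E)"
    if "x \<in> K" "\<And>i. continuous_on K (g i)" "\<And>i y. y \<in> K \<Longrightarrow> \<bar>g i y\<bar> \<le> E" for x g E
  proof -
    have "\<bar>\<Sum>i\<in>UNIV. x $ i * radial_int m (g i) x\<bar> \<le> (\<Sum>i\<in>(UNIV::'n set). \<rho> * E)"
      by (rule order_trans[OF sum_abs sum_mono])
        (use that A xi radial_int_bound[OF K(4) that(2) that(1) that(3)] in \<open>auto simp: abs_mult intro!: mult_mono\<close>)
    then show ?thesis by (simp add: N_def)
  qed
  obtain Bb where Bb: "Bb \<ge> 0" "\<And>k n x. x \<in> K \<Longrightarrow> \<bar>b n k x\<bar> \<le> Bb"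
    using cvg0_bounded_family[of S "\<lambda>k n. b n k", OF b K(1,3)] by metis
  have "cvg0 S (\<lambda>n. \<eta> 0 k)" for k using \<eta> by (simp add: cvg0_def uniformly_convergent_on_const)
  from cvg0_bounded_family[of S "\<lambda>k n. \<eta> 0 k", OF this K(1,3)]
  obtain C0 where C0: "C0 \<ge> 0" "\<And>k x. x \<in> K \<Longrightarrow> \<bar>\<eta> 0 k x\<bar> \<le> C0" by metis
  \<comment> \<open>A bound at least \<open>Bb / (1 - q)\<close> is reproduced by the recursion;
    \<open>C0\<close> covers the start.\<close>
  define C where "C = max C0 (Bb / (1 - q))"
  have C: "C \<ge> 0" "Bb + q * C \<le> C"
  proof -
    show "C \<ge> 0" using C0 by (auto simp: C_def)
    have "Bb / (1 - q) \<le> C" by (simp add: C_def)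
    then show "Bb + q * C \<le> C" using q by (simp add: field_simps)
  qed
  have bound: "\<bar>\<eta> n k x\<bar> \<le> C" if "x \<in> K" for n k x
    using that
  proof (induction n arbitrary: k x)
    case 0 then show ?case using C0(2)[of x k] by (simp add: C_def)
  next
    case (Suc n)
    have "\<bar>\<Sum>l\<in>UNIV. a n i k l y * \<eta> n l y\<bar> \<le> N * (A * C)" if "y \<in> K" for i y
    proof -
      have "\<bar>\<Sum>l\<in>UNIV. a n i k l y * \<eta> n l y\<bar> \<le> (\<Sum>l\<in>(UNIV::'n set). A * C)"
        by (rule order_trans[OF sum_abs sum_mono])
          (use Suc.IH that aK A C in \<open>auto simp: abs_mult intro!: mult_mono\<close>)
      then show ?thesis by (simp add: N_def)
    qed
    then have "\<bar>\<Sum>i\<in>UNIV. x $ i * radial_int m (\<lambda>y. \<Sum>l\<in>UNIV. a n i k l y * \<eta> n l y) x\<bar> \<le> N * (\<rho> * (N * (A * C)))"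
      by (rule sumI[OF Suc.prems cont])
    then have "\<bar>\<eta> (Suc n) k x\<bar> \<le> Bb + N * (\<rho> * (N * (A * C)))"
      using eq[of x n k] Suc.prems K Bb(2)[OF Suc.prems, of n k] by (auto intro: order_trans[OF abs_triangle_ineq add_mono])
    also have "\<dots> = Bb + q * C" by (simp add: q_def power2_eq_square)
    finally show ?case using C by linarith
  qed
  have "uniformly_Cauchy_on K (\<lambda>n. \<eta> n k)"
  proof (rule picard_uniformly_Cauchy[OF q bound])
    fix e :: real assume e: "e > 0"
    \<comment> \<open>With this \<open>d\<close> the error caused by \<open>b\<close>, which is
      \<open>d\<close>, and the one caused by \<open>a\<close>, which is
      \<open>N * (\<rho> * (N * (d * C)))\<close>, add up to \<open>e\<close>.\<close>
    define d where "d = e / (1 + N * (\<rho> * (N * C)))"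
    have pos: "1 + N * (\<rho> * (N * C)) > 0" using N A C by (auto intro!: add_pos_nonneg mult_nonneg_nonneg)
    have "d * (1 + N * (\<rho> * (N * C))) = e" using pos by (simp add: d_def)
    then have "d + N * (\<rho> * (N * (d * C))) = e" by (simp add: algebra_simps)
    moreover have "d > 0" using pos e by (simp add: d_def)
    ultimately have d: "d > 0" "d + N * (\<rho> * (N * (d * C))) = e" by simp_all
    obtain N1 where N1: "\<And>k m n x. m \<ge> N1 \<Longrightarrow> n \<ge> N1 \<Longrightarrow> x \<in> K \<Longrightarrow> \<bar>b m k x - b n k x\<bar> \<le> d"
      using cvg0_Cauchy_family[of S "\<lambda>k n. b n k", OF b K(1,3) d(1)] by metis
    have "cvg0 S (\<lambda>n. a n (fst p) (fst (snd p)) (snd (snd p)))" for p by (rule a)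
    from cvg0_Cauchy_family[of S "\<lambda>p n. a n (fst p) (fst (snd p)) (snd (snd p))", OF this K(1,3) d(1)]
    obtain N2 where N2: "\<And>p m n x. m \<ge> N2 \<Longrightarrow> n \<ge> N2 \<Longrightarrow> x \<in> K \<Longrightarrow>
       \<bar>a m (fst p) (fst (snd p)) (snd (snd p)) x - a n (fst p) (fst (snd p)) (snd (snd p)) x\<bar> \<le> d" by metis
    show "\<exists>N. \<forall>m\<ge>N. \<forall>n\<ge>N. \<forall>D\<ge>0. (\<forall>k. \<forall>x\<in>K. \<bar>\<eta> m k x - \<eta> n k x\<bar> \<le> D) \<longrightarrow>
      (\<forall>k. \<forall>x\<in>K. \<bar>\<eta> (Suc m) k x - \<eta> (Suc n) k x\<bar> \<le> e + q * D)"
    proof (intro exI[of _ "max N1 N2"] allI impI ballI)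
      fix p n D k x assume p: "max N1 N2 \<le> p" and n: "max N1 N2 \<le> n" and D: "D \<ge> 0"
        and H: "\<forall>k. \<forall>x\<in>K. \<bar>\<eta> p k x - \<eta> n k x\<bar> \<le> D" and x: "x \<in> K"
      define g where "g i y = (\<Sum>l\<in>UNIV. a p i k l y * \<eta> p l y) - (\<Sum>l\<in>UNIV. a n i k l y * \<eta> n l y)" for i y
      have "\<bar>g i y\<bar> \<le> N * (A * D + d * C)" if y: "y \<in> K" for i y
      proof -
        have "\<bar>a p i k l y * \<eta> p l y - a n i k l y * \<eta> n l y\<bar> \<le> A * D + d * C" for l
        proof -
          have "a p i k l y * \<eta> p l y - a n i k l y * \<eta> n l y =
             a p i k l y * (\<eta> p l y - \<eta> n l y) + (a p i k l y - a n i k l y) * \<eta> n l y"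
            by (simp add: algebra_simps)
          also have "\<bar>\<dots>\<bar> \<le> \<bar>a p i k l y\<bar> * \<bar>\<eta> p l y - \<eta> n l y\<bar> + \<bar>a p i k l y - a n i k l y\<bar> * \<bar>\<eta> n l y\<bar>"
            using abs_triangle_ineq abs_mult by metis
          also have "\<dots> \<le> A * D + d * C"
            using H y aK[OF y, of p i k l] A bound[OF y, of n l] N2[of p n y "(i, k, l)"] p n d
            by (intro add_mono mult_mono) auto
          finally show ?thesis .
        qed
        then have "\<bar>g i y\<bar> \<le> (\<Sum>l\<in>(UNIV::'n set). A * D + d * C)"
          unfolding g_def sum_subtractf[symmetric] by (intro order_trans[OF sum_abs sum_mono])
        then show ?thesis by (simp add: N_def)
      qed
      moreover have "continuous_on K (g i)" for i unfolding g_def by (intro continuous_intros cont)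
      ultimately have I: "\<bar>\<Sum>i\<in>UNIV. x $ i * radial_int m (g i) x\<bar> \<le> N * (\<rho> * (N * (A * D + d * C)))"
        by (intro sumI[OF x])
      have "radial_int m (g i) x = radial_int m (\<lambda>y. \<Sum>l\<in>UNIV. a p i k l y * \<eta> p l y) x -
          radial_int m (\<lambda>y. \<Sum>l\<in>UNIV. a n i k l y * \<eta> n l y) x" for i
        unfolding g_def[abs_def] by (rule radial_int_diff[OF K(4) cont cont x])
      moreover have "x \<in> S" using x K by blast
      ultimately have "\<eta> (Suc p) k x - \<eta> (Suc n) k x = (b p k x - b n k x) + (\<Sum>i\<in>UNIV. x $ i * radial_int m (g i) x)"
        using eq[of x p k] eq[of x n k] by (simp add: right_diff_distrib sum_subtractf)
      then have "\<bar>\<eta> (Suc p) k x - \<eta> (Suc n) k x\<bar> \<le> d + N * (\<rho> * (N * (A * D + d * C)))"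
        using I N1[of p n x k] p n x by auto
      also have "\<dots> = e + q * D" unfolding d(2)[symmetric] q_def by (simp add: algebra_simps power2_eq_square)
      finally show "\<bar>\<eta> (Suc p) k x - \<eta> (Suc n) k x\<bar> \<le> e + q * D" .
    qed
  qed
  then show "uniformly_convergent_on K0 (\<lambda>n. \<eta> n k)"
    using uniformly_convergent_on_subset[OF _ K(2), of "\<lambda>n. \<eta> n k"] uniformly_convergent_eq_Cauchy by blast
qed

text \<open>Differentiating the recursion in direction \<open>v\<close> gives one of the same form
  for \<open>dir_deriv v (\<eta> n k)\<close>: the coefficients \<open>a\<close> are the same, the
  exponent becomes \<open>Suc m\<close>, and the terms in which the derivative meets
  \<open>a\<close> or \<open>x $ i\<close> join \<open>b\<close>. Hence the contraction factor stays
  the same at every order and no smaller ball is needed.\<close>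

lemma linear_picard_cvg:
  fixes a :: "nat \<Rightarrow> 'n::finite \<Rightarrow> 'n \<Rightarrow> 'n \<Rightarrow> real^'n \<Rightarrow> real"
    and b \<eta> :: "nat \<Rightarrow> 'n \<Rightarrow> real^'n \<Rightarrow> real"
    and \<rho> :: real
  defines "S \<equiv> ball 0 \<rho>"
  assumes "\<And>i k l. cvg j S (\<lambda>n. a n i k l)" and "\<And>k. cvg j S (\<lambda>n. b n k)"
    and A: "\<And>n i k l x. x \<in> S \<Longrightarrow> \<bar>a n i k l x\<bar> \<le> A" "A \<ge> 0" "\<rho> > 0" "\<rho> * A * (CARD('n))\<^sup>2 < 1"
    and "\<And>n k. Ck_on j S (\<eta> n k)"
    and "\<And>n k x. x \<in> S \<Longrightarrow> \<eta> (Suc n) k x = b n k x +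
      (\<Sum>i\<in>UNIV. x $ i * radial_int m (\<lambda>y. \<Sum>l\<in>UNIV. a n i k l y * \<eta> n l y) x)"
  shows "cvg j S (\<lambda>n. \<eta> n k)"
  using assms(2,3,8,9)
proof (induction j arbitrary: m b \<eta> k)
  case 0
  then show ?case using linear_picard_cvg0[of \<rho> a b A \<eta> m k] A by (simp add: S_def)
next
  case (Suc j)
  have S: "open S" "star0 S" by (auto simp: S_def)
  have IH: "cvg j S (\<lambda>n. \<eta> n k)" for k
    by (rule Suc.IH[of b \<eta> m]) (use Suc.prems in \<open>auto intro: cvg_SucD Ck_on_SucD simp del: cvg.simps Ck_on.simps\<close>)
  show ?case unfolding cvg.simps
  proof (intro conjI allI ballI)
    show "cvg0 S (\<lambda>n. \<eta> n k)" using cvg_imp_cvg0[OF IH] .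
    show "\<eta> n k differentiable at x" if "x \<in> S" for n x using Suc.prems(3) that by auto
    fix v :: "real^'n"
    define g where "g n i k y = (\<Sum>l\<in>UNIV. a n i k l y * \<eta> n l y)" for n i k y
    define b' where "b' n k x = dir_deriv v (b n k) x + (\<Sum>i\<in>UNIV. v $ i * radial_int m (g n i k) x)
       + (\<Sum>i\<in>UNIV. x $ i * radial_int (Suc m) (\<lambda>y. \<Sum>l\<in>UNIV. dir_deriv v (a n i k l) y * \<eta> n l y) x)" for n k x
    have aj: "cvg j S (\<lambda>n. a n i k l)" for i k l by (rule cvg_SucD[OF Suc.prems(1)])
    have cg: "cvg j S (\<lambda>n. g n i k)" for i k
      unfolding g_def by (intro cvg_sum cvg_mult S aj IH)
    have Ckg: "Ck_on 1 S (g n i k)" for n i k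
      unfolding g_def
      by (intro Ck_on_sum Ck_on_mult S Ck_on_le[OF Suc.prems(3)] Ck_on_le[OF cvg_imp_Ck[OF Suc.prems(1)]]) auto
    have nth: "cvg j S (\<lambda>n x. x $ i)" for i
      using Ck_on_bounded_linear[OF bounded_linear_vec_nth] by (simp add: cvg_const_iff)
    have diffs: "b n k differentiable (at x)" "a n i k l differentiable (at x)" "\<eta> n l differentiable (at x)"
      if "x \<in> S" for n i k l x
      using Suc.prems(1,2,3) that by auto
    show "cvg j S (\<lambda>n. dir_deriv v (\<eta> n k))"
    proof (rule Suc.IH[of b' "\<lambda>n k. dir_deriv v (\<eta> n k)" "Suc m"])
      show "cvg j S (\<lambda>n. a n i k l)" for i k l by (rule aj)
      show "cvg j S (\<lambda>n. b' n k)" for k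
      proof -
        have "cvg j S (\<lambda>n. dir_deriv v (b n k))" "cvg j S (\<lambda>n. dir_deriv v (a n i k l))" for i l
          using Suc.prems(1)[of i k l] Suc.prems(2)[of k] by simp_all
        then show ?thesis
          unfolding b'_def by (intro cvg_add cvg_sum cvg_mult cvg_radial_int cg nth S cvg_const IH)
      qed
      show "Ck_on j S (dir_deriv v (\<eta> n k))" for n k using Suc.prems(3) by auto
      fix n k x assume x: "x \<in> S"
      define F where "F y = b n k y + (\<Sum>i\<in>UNIV. y $ i * radial_int m (g n i k) y)" for y
      have dI: "radial_int m (g n i k) differentiable (at x)" for i
        unfolding differentiable_def by (rule exI, rule radial_int_has_derivative[OF S Ckg x])
      have split: "radial_int (Suc m) (dir_deriv v (g n i k)) x =
         radial_int (Suc m) (\<lambda>y. \<Sum>l\<in>UNIV. dir_deriv v (a n i k l) y * \<eta> n l y) x +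
         radial_int (Suc m) (\<lambda>y. \<Sum>l\<in>UNIV. a n i k l y * dir_deriv v (\<eta> n l) y) x" for i
      proof -
        have "radial_int (Suc m) (dir_deriv v (g n i k)) x = radial_int (Suc m) (\<lambda>y.
           (\<Sum>l\<in>UNIV. dir_deriv v (a n i k l) y * \<eta> n l y) + (\<Sum>l\<in>UNIV. a n i k l y * dir_deriv v (\<eta> n l) y)) x"
          by (rule radial_int_cong[OF S(2) x])
            (use diffs in \<open>simp add: g_def[abs_def] dir_deriv_sum dir_deriv_mult sum.distrib\<close>)
        also have "\<dots> = radial_int (Suc m) (\<lambda>y. \<Sum>l\<in>UNIV. dir_deriv v (a n i k l) y * \<eta> n l y) x +
         radial_int (Suc m) (\<lambda>y. \<Sum>l\<in>UNIV. a n i k l y * dir_deriv v (\<eta> n l) y) x"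
        proof (rule radial_int_add[OF S(2) _ _ x])
          have c: "continuous_on S (\<eta> n l)" "continuous_on S (dir_deriv v (\<eta> n l))" for l
            using Suc.prems(3)[of n l] Ck_on_imp_continuous[of "Suc j" S "\<eta> n l"]
              Ck_on_imp_continuous[of j S "dir_deriv v (\<eta> n l)"] by simp_all
          have c': "continuous_on S (a n i k l)" "continuous_on S (dir_deriv v (a n i k l))" for l
            using cvg_imp_Ck[OF Suc.prems(1)[of i k l], of n] Ck_on_imp_continuous[of "Suc j" S "a n i k l"]
              Ck_on_imp_continuous[of j S "dir_deriv v (a n i k l)"] by simp_all
          show "continuous_on S (\<lambda>y. \<Sum>l\<in>UNIV. dir_deriv v (a n i k l) y * \<eta> n l y)"
            "continuous_on S (\<lambda>y. \<Sum>l\<in>UNIV. a n i k l y * dir_deriv v (\<eta> n l) y)"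
            by (intro continuous_intros c c')+
        qed
        finally show ?thesis .
      qed
      have "dir_deriv v (\<eta> (Suc n) k) x = dir_deriv v F x"
        using frechet_derivative_cong_open[OF S(1) x, of "\<eta> (Suc n) k" F] Suc.prems(4) by (simp add: F_def g_def[abs_def])
      also have "\<dots> = dir_deriv v (b n k) x + (\<Sum>i\<in>UNIV. x $ i * dir_deriv v (radial_int m (g n i k)) x + v $ i * radial_int m (g n i k) x)"
        unfolding F_def using dI diffs[OF x] by (simp add: dir_deriv_add dir_deriv_sum dir_deriv_mult)
      also have "\<dots> = dir_deriv v (b n k) x + (\<Sum>i\<in>UNIV. v $ i * radial_int m (g n i k) x)
         + (\<Sum>i\<in>UNIV. x $ i * radial_int (Suc m) (dir_deriv v (g n i k)) x)"
        by (simp add: sum.distrib dir_deriv_radial_int[OF S Ckg x])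
      also have "\<dots> = b' n k x + (\<Sum>i\<in>UNIV. x $ i *
          radial_int (Suc m) (\<lambda>y. \<Sum>l\<in>UNIV. a n i k l y * dir_deriv v (\<eta> n l) y) x)"
        by (simp add: split b'_def distrib_left sum.distrib)
      finally show "dir_deriv v (\<eta> (Suc n) k) x = b' n k x + (\<Sum>i\<in>UNIV. x $ i *
          radial_int (Suc m) (\<lambda>y. \<Sum>l\<in>UNIV. a n i k l y * dir_deriv v (\<eta> n l) y) x)" .
    qed
  qed
qed

lemma radial_int_limit:
  assumes "star0 S" "cvg0 S f" "x \<in> S" "\<And>y. y \<in> S \<Longrightarrow> (\<lambda>n. f n y) \<longlonglongrightarrow> g y"
  shows "(\<lambda>n. radial_int m (f n) x) \<longlonglongrightarrow> radial_int m g x"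
proof -
  obtain K where K: "compact K" "{x} \<subseteq> K" "K \<subseteq> S" "star0 K"
    using compact_star_hull[OF _ _ assms(1), of "{x}"] assms(3) by auto
  obtain l where l: "uniform_limit K f l sequentially"
    using assms(2) K by (auto simp: cvg0_def uniformly_convergent_on_def)
  have eq: "l y = g y" if "y \<in> K" for y
    by (rule LIMSEQ_unique[OF tendsto_uniform_limitI[OF l that] assms(4)]) (use that K in blast)
  have cont: "continuous_on K (f n)" for n
    using assms(2) K by (auto simp: cvg0_def intro: continuous_on_subset)
  have "continuous_on K l" by (rule uniform_limit_theorem[OF always_eventually l]) (use cont in auto)
  then have contg: "continuous_on K g" using continuous_on_eq[of K l g] eq by blast
  have x: "x \<in> K" using K by simp
  show ?thesis
  proof (rule LIMSEQ_I)
    fix r :: real assume "r > 0"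
    then have "\<forall>\<^sub>F n in sequentially. \<forall>y\<in>K. dist (f n y) (l y) < r / 2" using uniform_limitD[OF l] half_gt_zero by blast
    then obtain N where N: "\<And>n y. n \<ge> N \<Longrightarrow> y \<in> K \<Longrightarrow> dist (f n y) (l y) < r / 2"
      by (auto simp: eventually_sequentially)
    have "norm (radial_int m (f n) x - radial_int m g x) < r" if "n \<ge> N" for n
    proof -
      have "\<bar>radial_int m (\<lambda>y. f n y - g y) x\<bar> \<le> r / 2"
        by (rule radial_int_bound[OF K(4) continuous_on_diff[OF cont contg] x])
          (use N[OF that] eq in \<open>auto simp: dist_real_def less_imp_le\<close>)
      then show ?thesis using \<open>r > 0\<close> by (simp add: radial_int_diff[OF K(4) cont contg x])
    qed
    then show "\<exists>no. \<forall>n\<ge>no. norm (radial_int m (f n) x - radial_int m g x) < r" by blast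
  qed
qed

lemma compact_bound_family:
  fixes f :: "'i::finite \<Rightarrow> 'a::euclidean_space \<Rightarrow> real"
  assumes "compact K" "\<And>i. continuous_on K (f i)"
  obtains B where "B > 0" "\<And>i x. x \<in> K \<Longrightarrow> \<bar>f i x\<bar> \<le> B"
proof -
  have "cvg0 K (\<lambda>n. f i)" for i using assms by (simp add: cvg0_def uniformly_convergent_on_const)
  then obtain B where B: "B \<ge> 0" "\<And>i n x. x \<in> K \<Longrightarrow> \<bar>(\<lambda>i (n::nat). f i) i n x\<bar> \<le> B"
    using cvg0_bounded_family[of K "\<lambda>i n. f i", OF _ assms(1)] by blast
  have "\<bar>f i x\<bar> \<le> B + 1" if "x \<in> K" for i x using B(2)[OF that, of i] by simp
  then show ?thesis using B by (intro that[of "B + 1"]) auto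
qed

text \<open>Picard iteration for \<open>\<phi> x = \<integral>\<^sub>0\<^sup>1 V (\<phi> (s x)) x ds\<close>, whose solution is the time-one map of the
  vector fields \<open>\<Sum>\<^sub>i x\<^sub>i V\<^sub>i\<close>. The derivatives of the iterates satisfy linear recursions of the same
  kind, so they converge as well.\<close>

lemma smooth_time_one_map:
  fixes V :: "'n::finite \<Rightarrow> 'n \<Rightarrow> real^'n \<Rightarrow> real"
  assumes "open \<Omega>" "0 \<in> \<Omega>" and V: "\<And>i k. smooth_on \<Omega> (V i k)"
  obtains \<rho> \<phi> where "\<rho> > 0" "smooth_on (ball 0 \<rho>) (\<phi> :: real^'n \<Rightarrow> real^'n)" "\<phi> ` ball 0 \<rho> \<subseteq> \<Omega>"
    "\<And>x k. x \<in> ball 0 \<rho> \<Longrightarrow> \<phi> x $ k = (\<Sum>i\<in>UNIV. x $ i * radial_int 0 (\<lambda>y. V i k (\<phi> y)) x)"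
proof -
  obtain R where R: "R > 0" "cball 0 R \<subseteq> \<Omega>" using assms open_contains_cball by blast
  define N where "N = real CARD('n)"
  have N: "N > 0" by (simp add: N_def)
  have contV: "continuous_on (cball 0 R) (V i k)" "continuous_on (cball 0 R) (dir_deriv v (V i k))" for i k v
    using smooth_on_continuous[OF V] smooth_on_continuous[OF smooth_on_dir_deriv[OF V]] R
    by (blast intro: continuous_on_subset)+
  obtain M where M: "M > 0" "\<And>p y. y \<in> cball 0 R \<Longrightarrow> \<bar>V (fst p) (snd p) y\<bar> \<le> M"
    using compact_bound_family[of "cball 0 R" "\<lambda>p. V (fst p) (snd p)", OF compact_cball contV(1)] by blast
  obtain A where A: "A > 0" "\<And>p y. y \<in> cball 0 R \<Longrightarrow> \<bar>dir_deriv (axis (snd (snd p)) 1) (V (fst p) (fst (snd p))) y\<bar> \<le> A"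
    using compact_bound_family[of "cball 0 R" "\<lambda>p. dir_deriv (axis (snd (snd p)) 1) (V (fst p) (fst (snd p)))", OF compact_cball contV(2)] by blast
  have M': "\<bar>V i k y\<bar> \<le> M" if "y \<in> cball 0 R" for i k y using M(2)[OF that, of "(i, k)"] by simp
  have A': "\<bar>dir_deriv (axis l 1) (V i k) y\<bar> \<le> A" if "y \<in> cball 0 R" for i k l y
    using A(2)[OF that, of "(i, k, l)"] by simp
  \<comment> \<open>The first bound keeps the iterates in \<open>cball 0 R\<close>: the norm is at
    most the sum of \<open>N\<close> coordinates, each at most \<open>N * (\<rho> * M)\<close>. The
    second makes the contraction factor at most 1/2.\<close>
  define \<rho> where "\<rho> = min (R / (N * (N * M))) (1 / (2 * (A * N\<^sup>2)))"
  have \<rho>: "\<rho> > 0" using R M A N by (simp add: \<rho>_def)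
  have \<rho>R: "N * (N * (\<rho> * M)) \<le> R"
  proof -
    have "\<rho> \<le> R / (N * (N * M))" by (simp add: \<rho>_def)
    then show ?thesis using N M by (simp add: field_simps)
  qed
  have \<rho>q: "\<rho> * A * N\<^sup>2 < 1"
  proof -
    have "\<rho> \<le> 1 / (2 * (A * N\<^sup>2))" by (simp add: \<rho>_def)
    then have "\<rho> * (A * N\<^sup>2) \<le> 1 / 2" using N A by (simp add: field_simps)
    then show ?thesis by (simp add: mult.assoc)
  qed
  define S :: "(real^'n) set" where "S = ball 0 \<rho>"
  have S: "open S" "star0 S" by (auto simp: S_def)
  have xi: "\<bar>x $ i\<bar> \<le> \<rho>" if "x \<in> S" for x i
    using component_le_norm_cart[of x i] that by (simp add: S_def)
  define P where "P = rec_nat (\<lambda>x::real^'n. 0 :: real^'n)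
     (\<lambda>n p x. \<chi> k. \<Sum>i\<in>UNIV. x $ i * radial_int 0 (\<lambda>y. V i k (p y)) x)"
  have P0: "P 0 = (\<lambda>x. 0)" by (simp add: P_def)
  have PS: "P (Suc n) x $ k = (\<Sum>i\<in>UNIV. x $ i * radial_int 0 (\<lambda>y. V i k (P n y)) x)" for n x k
    by (simp add: P_def)
  have sumI: "\<bar>\<Sum>i\<in>UNIV. x $ i * radial_int 0 (g i) x\<bar> \<le> N * (\<rho> * E)"
    if "x \<in> S" "\<And>i. continuous_on S (g i)" "\<And>i y. y \<in> S \<Longrightarrow> \<bar>g i y\<bar> \<le> E" for x and g :: "'n \<Rightarrow> real^'n \<Rightarrow> real" and E
  proof -
    have "\<bar>\<Sum>i\<in>UNIV. x $ i * radial_int 0 (g i) x\<bar> \<le> (\<Sum>i\<in>(UNIV::'n set). \<rho> * E)"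
      by (rule order_trans[OF sum_abs sum_mono])
        (use that \<rho> xi radial_int_bound[OF S(2) that(2) that(1) that(3)] in \<open>auto simp: abs_mult intro!: mult_mono\<close>)
    then show ?thesis by (simp add: N_def)
  qed
  have P: "P n ` S \<subseteq> cball 0 R \<and> smooth_on S (P n)" for n
  proof (induction n)
    case 0 then show ?case using R by (auto simp: P0)
  next
    case (Suc n)
    have sm: "smooth_on S (\<lambda>y. V i k (P n y))" for i k
      by (rule smooth_on_compose[OF S(1) \<open>open \<Omega>\<close> V]) (use Suc R in auto)
    have "smooth_on S (\<lambda>x. P (Suc n) x $ k)" for k
      unfolding PS by (intro smooth_on_sum smooth_on_mult smooth_on_radial_int S sm smooth_on_nth)
    then have "smooth_on S (P (Suc n))" using smooth_on_vec_iff[OF S(1)] by blast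
    moreover have "P (Suc n) x \<in> cball 0 R" if x: "x \<in> S" for x
    proof -
      have "\<bar>P (Suc n) x $ k\<bar> \<le> N * (\<rho> * M)" for k
        unfolding PS using Suc by (intro sumI x smooth_on_continuous[OF sm] M') auto
      then have "norm (P (Suc n) x) \<le> (\<Sum>k\<in>(UNIV::'n set). N * (\<rho> * M))"
        by (intro order_trans[OF norm_le_l1_cart sum_mono])
      then show ?thesis using \<rho>R by (simp add: N_def)
    qed
    ultimately show ?case by blast
  qed
  have PR: "P n x \<in> cball 0 R" if "x \<in> S" for n x using P that by blast
  have sP: "smooth_on S (P n)" for n using P by blast
  have sPk: "smooth_on S (\<lambda>x. P n x $ k)" for n k using sP smooth_on_vec_iff[OF S(1)] by blast
  have sVP: "smooth_on S (\<lambda>y. V i k (P n y))" for i k n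
    by (rule smooth_on_compose[OF S(1) \<open>open \<Omega>\<close> V sP]) (use P R in auto)
  have "uniformly_Cauchy_on S (\<lambda>n x. P n x $ k)" for k
  proof (rule picard_uniformly_Cauchy[where q = "\<rho> * A * N\<^sup>2" and B = R and h = "\<lambda>n k x. P n x $ k"])
    show "0 \<le> \<rho> * A * N\<^sup>2" using \<rho> A by simp
    show "\<bar>P n x $ k\<bar> \<le> R" if "x \<in> S" for n k x
      using component_le_norm_cart[of "P n x" k] PR[OF that, of n] by simp
    show "\<exists>M. \<forall>m\<ge>M. \<forall>n\<ge>M. \<forall>D\<ge>0. (\<forall>k. \<forall>x\<in>S. \<bar>P m x $ k - P n x $ k\<bar> \<le> D) \<longrightarrow>
         (\<forall>k. \<forall>x\<in>S. \<bar>P (Suc m) x $ k - P (Suc n) x $ k\<bar> \<le> e + \<rho> * A * N\<^sup>2 * D)" if "e > 0" for e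
    proof (intro exI[of _ 0] allI impI ballI)
      fix m n D k x assume D: "D \<ge> 0" and H: "\<forall>k. \<forall>x\<in>S. \<bar>P m x $ k - P n x $ k\<bar> \<le> D" and x: "x \<in> S"
      have "\<bar>V i k (P m y) - V i k (P n y)\<bar> \<le> N * (A * D)" if y: "y \<in> S" for i y
      proof -
        have "\<bar>V i k (P m y) - V i k (P n y)\<bar> \<le> (\<Sum>l\<in>UNIV. A * \<bar>P m y $ l - P n y $ l\<bar>)"
          by (rule mean_value_partials[OF convex_cball smooth_on_differentiable[OF V] PR[OF y] PR[OF y] A'])
            (use R in auto)
        also have "\<dots> \<le> (\<Sum>l\<in>(UNIV::'n set). A * D)"
          by (intro sum_mono mult_left_mono) (use H y A in auto)
        finally show ?thesis by (simp add: N_def)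
      qed
      then have "\<bar>\<Sum>i\<in>UNIV. x $ i * radial_int 0 (\<lambda>y. V i k (P m y) - V i k (P n y)) x\<bar> \<le> N * (\<rho> * (N * (A * D)))"
        by (intro sumI x continuous_on_diff smooth_on_continuous[OF sVP])
      also have "\<dots> = \<rho> * A * N\<^sup>2 * D" by (simp add: power2_eq_square)
      finally show "\<bar>P (Suc m) x $ k - P (Suc n) x $ k\<bar> \<le> e + \<rho> * A * N\<^sup>2 * D"
        using that by (simp add: PS radial_int_diff[OF S(2) smooth_on_continuous[OF sVP] smooth_on_continuous[OF sVP] x]
            right_diff_distrib sum_subtractf)
    qed
  qed (use \<rho>q in auto)
  then have UC: "uniformly_convergent_on S (\<lambda>n x. P n x $ k)" for k
    by (simp add: uniformly_convergent_eq_Cauchy)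
  have P_cvg0: "cvg0 S (\<lambda>n x. P n x $ k)" for k
    unfolding cvg0_def using uniformly_convergent_on_subset[OF UC] smooth_on_continuous[OF sPk] by blast
  have inner_cvg: "cvg j S (\<lambda>n x. P n x \<bullet> b)" if "\<And>k. cvg j S (\<lambda>n x. P n x $ k)" "b \<in> Basis" for j b
  proof -
    obtain i where "\<forall>y::real^'n. y \<bullet> b = y $ i" using Basis_vec_inner[OF \<open>b \<in> Basis\<close>] by blast
    then show ?thesis using that(1)[of i] by simp
  qed
  have G_cvg: "cvg j S (\<lambda>n x. G (P n x))" if "\<And>k. cvg j S (\<lambda>n x. P n x $ k)" "smooth_on \<Omega> G" for j G
  proof (rule cvg_compose[OF S(1) \<open>open \<Omega>\<close> smooth_on_Ck[OF that(2)] inner_cvg[OF that(1)]])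
    show "\<exists>C. compact C \<and> C \<subseteq> \<Omega> \<and> (\<forall>n. \<forall>x\<in>K. P n x \<in> C)" if "K \<subseteq> S" for K
      using PR R that by (intro exI[of _ "cball 0 R"]) (auto simp del: mem_cball)
  qed
  have P_cvg: "cvg j S (\<lambda>n x. P n x $ k)" for j k
  proof (induction j arbitrary: k)
    case 0 then show ?case using P_cvg0 by simp
  next
    case (Suc j)
    show ?case unfolding cvg.simps
    proof (intro conjI allI ballI P_cvg0)
      show "(\<lambda>x. P n x $ k) differentiable at x" if "x \<in> S" for n x
        by (rule smooth_on_differentiable[OF sPk that])
      fix v :: "real^'n"
      \<comment> \<open>\<open>a\<close> is the Jacobian of \<open>V\<close> along the iterate, and
        \<open>b\<close> comes from differentiating the factor \<open>x $ i\<close>. One derivative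
        having been taken, the recursion has the exponent 1.\<close>
      define a where "a n i k l y = dir_deriv (axis l 1) (V i k) (P n y)" for n i k l y
      define b where "b n k x = (\<Sum>i\<in>UNIV. v $ i * radial_int 0 (\<lambda>y. V i k (P n y)) x)" for n k x
      show "cvg j S (\<lambda>n. dir_deriv v (\<lambda>x. P n x $ k))"
      proof (rule linear_picard_cvg[where \<rho> = \<rho> and a = a and b = b and A = A and m = 1
            and \<eta> = "\<lambda>n k. dir_deriv v (\<lambda>x. P n x $ k)", folded S_def])
        show "cvg j S (\<lambda>n. a n i k l)" for i k l
          unfolding a_def by (rule G_cvg[OF Suc.IH smooth_on_dir_deriv[OF V]])
        show "cvg j S (\<lambda>n. b n k)" for k
          unfolding b_def by (intro cvg_sum cvg_mult cvg_const cvg_radial_int S G_cvg[OF Suc.IH V])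
        show "\<bar>a n i k l x\<bar> \<le> A" if "x \<in> S" for n i k l x
          unfolding a_def by (rule A'[OF PR[OF that]])
        show "Ck_on j S (dir_deriv v (\<lambda>x. P n x $ k))" for n k
          by (rule smooth_on_Ck[OF smooth_on_dir_deriv[OF sPk]])
        fix n k x assume x: "x \<in> S"
        define g where "g i y = V i k (P n y)" for i y
        have Ckg: "Ck_on 1 S (g i)" for i unfolding g_def by (rule smooth_on_Ck[OF sVP])
        have dI: "radial_int 0 (g i) differentiable (at x)" for i
          unfolding differentiable_def by (rule exI, rule radial_int_has_derivative[OF S Ckg x])
        have inner: "radial_int 1 (dir_deriv v (g i)) x =
            radial_int 1 (\<lambda>y. \<Sum>l\<in>UNIV. a n i k l y * dir_deriv v (\<lambda>x. P n x $ l) y) x" for i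
        proof (rule radial_int_cong[OF S(2) x])
          fix y assume y: "y \<in> S"
          show "dir_deriv v (g i) y = (\<Sum>l\<in>UNIV. a n i k l y * dir_deriv v (\<lambda>x. P n x $ l) y)"
            unfolding g_def a_def
            by (rule dir_deriv_compose[OF smooth_on_differentiable[OF sP y] smooth_on_differentiable[OF V]])
              (use PR[OF y] R in auto)
        qed
        have "(\<lambda>y. P (Suc n) y $ k) = (\<lambda>y. \<Sum>i\<in>UNIV. y $ i * radial_int 0 (g i) y)"
          by (simp add: PS g_def[abs_def])
        then have "dir_deriv v (\<lambda>y. P (Suc n) y $ k) x =
            (\<Sum>i\<in>UNIV. x $ i * dir_deriv v (radial_int 0 (g i)) x + v $ i * radial_int 0 (g i) x)"
          using dI by (simp add: dir_deriv_sum dir_deriv_mult)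
        also have "\<dots> = b n k x + (\<Sum>i\<in>UNIV. x $ i * radial_int 1 (dir_deriv v (g i)) x)"
          by (simp add: sum.distrib dir_deriv_radial_int[OF S Ckg x] b_def) (simp add: g_def[abs_def])
        also have "\<dots> = b n k x + (\<Sum>i\<in>UNIV. x $ i *
            radial_int 1 (\<lambda>y. \<Sum>l\<in>UNIV. a n i k l y * dir_deriv v (\<lambda>x. P n x $ l) y) x)"
          by (simp only: inner)
        finally show "dir_deriv v (\<lambda>x. P (Suc n) x $ k) x = b n k x + (\<Sum>i\<in>UNIV. x $ i *
            radial_int 1 (\<lambda>y. \<Sum>l\<in>UNIV. a n i k l y * dir_deriv v (\<lambda>x. P n x $ l) y) x)" .
      qed (use A \<rho> \<rho>q in \<open>auto simp: N_def\<close>)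
    qed
  qed
  define \<phi> where "\<phi> x = (\<chi> k. lim (\<lambda>n. P n x $ k))" for x
  have lim: "(\<lambda>n. P n x $ k) \<longlonglongrightarrow> \<phi> x $ k" if "x \<in> S" for x k
    using uniformly_convergent_imp_convergent[OF UC that, of k] by (simp add: \<phi>_def convergent_LIMSEQ_iff)
  have limv: "(\<lambda>n. P n x) \<longlonglongrightarrow> \<phi> x" if "x \<in> S" for x
    using lim[OF that] by (rule vec_tendstoI)
  have \<phi>R: "\<phi> x \<in> cball 0 R" if "x \<in> S" for x
    using closed_sequentially[OF closed_cball _ limv[OF that]] PR[OF that] by blast
  have smooth: "smooth_on S \<phi>"
  proof -
    have "smooth_on S (\<lambda>x. \<phi> x $ k)" for k
      unfolding smooth_on_def by (intro allI cvg_limit[OF S(1) P_cvg lim])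
    then show ?thesis using smooth_on_vec_iff[OF S(1)] by blast
  qed
  have eq: "\<phi> x $ k = (\<Sum>i\<in>UNIV. x $ i * radial_int 0 (\<lambda>y. V i k (\<phi> y)) x)" if x: "x \<in> S" for x k
  proof (rule LIMSEQ_unique)
    show "(\<lambda>n. P (Suc n) x $ k) \<longlonglongrightarrow> \<phi> x $ k" by (rule LIMSEQ_Suc[OF lim[OF x]])
    have "(\<lambda>n. V i k (P n y)) \<longlonglongrightarrow> V i k (\<phi> y)" if y: "y \<in> S" for i y
      by (rule continuous_on_tendsto_compose[OF contV(1) limv[OF y] \<phi>R[OF y]]) (use PR[OF y] in auto)
    then show "(\<lambda>n. P (Suc n) x $ k) \<longlonglongrightarrow> (\<Sum>i\<in>UNIV. x $ i * radial_int 0 (\<lambda>y. V i k (\<phi> y)) x)"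
      unfolding PS
      by (intro tendsto_sum tendsto_mult tendsto_const radial_int_limit[OF S(2) cvg_imp_cvg0[OF G_cvg[OF P_cvg V]] x])
  qed
  show ?thesis
    by (rule that[of \<rho> \<phi>]) (use \<rho> smooth eq \<phi>R R in \<open>auto simp: S_def simp del: mem_cball\<close>)
qed


section \<open>Weighted vanishing orders and dilations\<close>


abbreviation wsum :: "('n \<Rightarrow> nat) \<Rightarrow> 'n list \<Rightarrow> nat" where
  "wsum w ds \<equiv> sum_list (map w ds)"

lemma smooth_on_partials: "smooth_on S f \<Longrightarrow> smooth_on S (partials ds f)"
proof (induction ds)
  case (Cons d ds)
  then show ?case using smooth_on_dir_deriv[of S "partials ds f" "axis d 1"] by simp
qed simp

lemma partials_cong:
  assumes "open S" "\<And>y. y \<in> S \<Longrightarrow> f y = g y" "x \<in> S"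
  shows "partials ds f x = partials ds g x"
  using assms(3)
proof (induction ds arbitrary: x)
  case (Cons d ds)
  then show ?case
    using frechet_derivative_cong_open[OF assms(1), of x "partials ds f" "partials ds g"] by simp
qed (simp add: assms)

lemma partials_append: "partials (ds @ es) f = partials ds (partials es f)"
  by (induction ds) auto

lemma partials_add:
  fixes f g :: "real^'n \<Rightarrow> real"
  assumes "open S" "smooth_on S f" "smooth_on S g" "x \<in> S"
  shows "partials ds (\<lambda>y. f y + g y) x = partials ds f x + partials ds g x"
  using assms(4)
proof (induction ds arbitrary: x)
  case (Cons d ds)
  have "partials (d # ds) (\<lambda>y. f y + g y) x = dir_deriv (axis d 1) (\<lambda>y. partials ds f y + partials ds g y) x"
    using frechet_derivative_cong_open[OF assms(1) Cons.prems, of "partials ds (\<lambda>y. f y + g y)"] Cons.IH by simp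
  then show ?case
    using dir_deriv_add[OF smooth_on_differentiable[OF smooth_on_partials[OF assms(2)] Cons.prems]
        smooth_on_differentiable[OF smooth_on_partials[OF assms(3)] Cons.prems]] by simp
qed simp

lemma partials_diff:
  fixes f g :: "real^'n \<Rightarrow> real"
  assumes "open S" "smooth_on S f" "smooth_on S g" "x \<in> S"
  shows "partials ds (\<lambda>y. f y - g y) x = partials ds f x - partials ds g x"
  using assms(4)
proof (induction ds arbitrary: x)
  case (Cons d ds)
  have "partials (d # ds) (\<lambda>y. f y - g y) x = dir_deriv (axis d 1) (\<lambda>y. partials ds f y - partials ds g y) x"
    using frechet_derivative_cong_open[OF assms(1) Cons.prems, of "partials ds (\<lambda>y. f y - g y)"] Cons.IH by simp
  then show ?case
    using dir_deriv_diff[OF smooth_on_differentiable[OF smooth_on_partials[OF assms(2)] Cons.prems]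
        smooth_on_differentiable[OF smooth_on_partials[OF assms(3)] Cons.prems]] by simp
qed simp

lemma partials_zero_fun [simp]: "partials ds (\<lambda>y. 0::'b::real_normed_vector) = (\<lambda>y. 0)"
  by (induction ds) auto

lemma partials_sum:
  fixes f :: "'i \<Rightarrow> real^'n \<Rightarrow> real"
  assumes "open S" "\<And>i. i \<in> I \<Longrightarrow> smooth_on S (f i)" "x \<in> S"
  shows "partials ds (\<lambda>y. \<Sum>i\<in>I. f i y) x = (\<Sum>i\<in>I. partials ds (f i) x)"
  using assms(2)
proof (induction I rule: infinite_finite_induct)
  case (insert i I)
  then show ?case
    using partials_add[OF assms(1) _ smooth_on_sum[OF assms(1)] assms(3), of "f i" I f] by simp
qed auto

lemma partials_cmult:
  fixes f :: "real^'n \<Rightarrow> real"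
  assumes "open S" "smooth_on S f" "x \<in> S"
  shows "partials ds (\<lambda>y. c * f y) x = c * partials ds f x"
  using assms(3)
proof (induction ds arbitrary: x)
  case (Cons d ds)
  have "partials (d # ds) (\<lambda>y. c * f y) x = dir_deriv (axis d 1) (\<lambda>y. c * partials ds f y) x"
    using frechet_derivative_cong_open[OF assms(1) Cons.prems, of "partials ds (\<lambda>y. c * f y)"] Cons.IH by simp
  then show ?case
    using dir_deriv_mult[of "\<lambda>y. c" x "partials ds f"]
      smooth_on_differentiable[OF smooth_on_partials[OF assms(2)] Cons.prems] by simp
qed simp

lemma partials_component:
  fixes f :: "real^'n \<Rightarrow> real^'m"
  assumes "open S" "smooth_on S f" "x \<in> S"
  shows "partials ds f x $ k = partials ds (\<lambda>y. f y $ k) x"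
  using assms(3)
proof (induction ds arbitrary: x)
  case (Cons d ds)
  have "partials (d # ds) f x $ k = dir_deriv (axis d 1) (partials ds f) x $ k"
    by (simp only: partials.simps)
  also have "\<dots> = dir_deriv (axis d 1) (\<lambda>y. partials ds f y $ k) x"
    by (rule dir_deriv_component[symmetric])
      (rule smooth_on_differentiable[OF smooth_on_partials[OF assms(2)] Cons.prems])
  also have "\<dots> = partials (d # ds) (\<lambda>y. f y $ k) x"
    unfolding partials.simps
    by (subst frechet_derivative_cong_open[OF assms(1) Cons.prems Cons.IH]) simp_all
  finally show ?case .
qed simp

text \<open>Only the vanishing consequence of the Leibniz rule is needed, so the multi-indices of the
  two factors are only remembered through their length and weight.\<close>

lemma partials_mult_zero:
  fixes f g :: "real^'n \<Rightarrow> real"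
  assumes "open S" "x \<in> S" "smooth_on S f" "smooth_on S g"
    and "\<And>p q. length p + length q = length ds \<Longrightarrow> wsum w p + wsum w q = wsum w ds \<Longrightarrow>
      partials p f x = 0 \<or> partials q g x = 0"
  shows "partials ds (\<lambda>y. f y * g y) x = 0"
  using assms(3-)
\<comment> \<open>The last entry of a list is the derivative taken first. Peeling lists from the end
  lets the product rule act on the product itself.\<close>
proof (induction ds arbitrary: f g rule: rev_induct)
  case Nil
  from Nil(3)[of "[]" "[]"] show ?case by auto
next
  case (snoc k ds)
  let ?f = "dir_deriv (axis k 1) f" and ?g = "dir_deriv (axis k 1) g"
  have sm: "smooth_on S ?f" "smooth_on S ?g" using snoc.prems smooth_on_dir_deriv by blast+
  have "partials (ds @ [k]) (\<lambda>y. f y * g y) x = partials ds (\<lambda>y. f y * ?g y + ?f y * g y) x"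
    unfolding partials_append
    by (rule partials_cong[OF assms(1) _ assms(2)])
      (simp add: dir_deriv_mult[OF snoc.prems(1,2)[THEN smooth_on_differentiable]])
  also have "\<dots> = partials ds (\<lambda>y. f y * ?g y) x + partials ds (\<lambda>y. ?f y * g y) x"
    by (intro partials_add[OF assms(1)] smooth_on_mult assms sm snoc.prems)
  also have "partials ds (\<lambda>y. f y * ?g y) x = 0"
  proof (rule snoc.IH[OF snoc.prems(1) sm(2)])
    fix p q :: "'n list" assume "length p + length q = length ds" "wsum w p + wsum w q = wsum w ds"
    then show "partials p f x = 0 \<or> partials q ?g x = 0"
      using snoc.prems(3)[of p "q @ [k]"] by (simp add: partials_append)
  qed
  also have "partials ds (\<lambda>y. ?f y * g y) x = 0"
  proof (rule snoc.IH[OF sm(1) snoc.prems(2)])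
    fix p q :: "'n list" assume "length p + length q = length ds" "wsum w p + wsum w q = wsum w ds"
    then show "partials p ?f x = 0 \<or> partials q g x = 0"
      using snoc.prems(3)[of "p @ [k]" q] by (simp add: partials_append)
  qed
  finally show ?case by simp
qed

lemma partials_radial_int:
  fixes f :: "real^'n \<Rightarrow> real"
  assumes "open S" "star0 S" "smooth_on S f" "x \<in> S"
  shows "partials ds (radial_int m f) x = radial_int (m + length ds) (partials ds f) x"
  using assms(4)
proof (induction ds arbitrary: x)
  case (Cons d ds)
  have "partials (d # ds) (radial_int m f) x = dir_deriv (axis d 1) (radial_int (m + length ds) (partials ds f)) x"
    using frechet_derivative_cong_open[OF assms(1) Cons.prems, of "partials ds (radial_int m f)"] Cons.IH by simp
  then show ?case
    using dir_deriv_radial_int[OF assms(1,2) smooth_on_Ck[OF smooth_on_partials[OF assms(3)]] Cons.prems] by simp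
qed simp

lemma radial_int_at_0: "f 0 = 0 \<Longrightarrow> radial_int m f 0 = 0"
  by (simp add: radial_int_def)

text \<open>The integrated form of \<open>(1 + E) C = A + A C - C\<^sup>2\<close> with \<open>E\<close> the Euler field. Taking partial
  derivatives at 0 expresses the Taylor coefficients of \<open>C\<close> through those of \<open>A\<close> and
  through Taylor coefficients of \<open>C\<close> of lower order.\<close>

definition riccati :: "(real^'n) set \<Rightarrow> ('n \<Rightarrow> 'n \<Rightarrow> real^'n \<Rightarrow> real) \<Rightarrow> ('n \<Rightarrow> 'n \<Rightarrow> real^'n \<Rightarrow> real) \<Rightarrow> bool" where
  "riccati S A C \<longleftrightarrow> (\<forall>j k. smooth_on S (A j k) \<and> smooth_on S (C j k) \<and> A j k 0 = 0 \<and> C j k 0 = 0 \<and>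
     (\<forall>x\<in>S. C j k x = radial_int 0 (\<lambda>y. A j k y + (\<Sum>l\<in>UNIV. A j l y * C l k y) - (\<Sum>l\<in>UNIV. C j l y * C l k y)) x))"

text \<open>At 0 a radial integral is a multiple of the value of its integrand, and the same holds
  for every derivative.\<close>

lemma partials_riccati_zero:
  fixes A C :: "'n::finite \<Rightarrow> 'n \<Rightarrow> real^'n \<Rightarrow> real"
  assumes S: "open S" "star0 S" "0 \<in> S" and R: "smooth_on S R" "\<And>x. x \<in> S \<Longrightarrow> f x = radial_int 0 R x"
    and z: "partials ds R 0 = 0"
  shows "partials ds f 0 = 0"
proof -
  have "partials ds f 0 = partials ds (radial_int 0 R) 0" using partials_cong[OF S(1) R(2) S(3)] .
  also have "\<dots> = 0" using partials_radial_int[OF S(1,2) R(1) S(3)] radial_int_at_0[where f = "partials ds R", OF z] by simp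
  finally show ?thesis .
qed

text \<open>Induction on the number of derivatives. A nonzero product of derivatives of
  \<open>A j l\<close> and \<open>C l k\<close> would need \<open>wsum w p + w j \<ge> w l\<close>
  and \<open>wsum w q + w l \<ge> w k\<close>, and these add up to a contradiction. The vanishing of
  \<open>A\<close> and \<open>C\<close> at 0 rules out the empty lists that would leave all
  derivatives on one factor \<open>C\<close>, beyond the reach of the induction hypothesis.\<close>

lemma riccati_vanish:
  assumes S: "open S" "star0 S" "0 \<in> S" and ric: "riccati S A C"
    and A: "\<And>ds j k. wsum w ds + w j < w k \<Longrightarrow> partials ds (A j k) 0 = 0"
  shows "wsum w ds + w j < w k \<Longrightarrow> partials ds (C j k) 0 = 0"
proof (induction "length ds" arbitrary: ds j k rule: less_induct)
  case less
  have sm: "smooth_on S (A j k)" "smooth_on S (C j k)" "A j k 0 = 0" "C j k 0 = 0" for j k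
    using ric by (auto simp: riccati_def)
  have AC: "partials ds (\<lambda>y. A j l y * C l k y) 0 = 0" for l
  proof (rule partials_mult_zero[OF S(1,3) sm(1,2)])
    fix p q assume pq: "length p + length q = length ds" "wsum w p + wsum w q = wsum w ds"
    show "partials p (A j l) 0 = 0 \<or> partials q (C l k) 0 = 0"
    proof (cases "p = []")
      case True then show ?thesis using sm by simp
    next
      case False
      then have "length q < length ds" using pq by (cases p) auto
      then show ?thesis using less.hyps[of q l k] A[of p j l] pq less.prems by linarith
    qed
  qed
  have CC: "partials ds (\<lambda>y. C j l y * C l k y) 0 = 0" for l
  proof (rule partials_mult_zero[OF S(1,3) sm(2,2)])
    fix p q assume pq: "length p + length q = length ds" "wsum w p + wsum w q = wsum w ds"
    show "partials p (C j l) 0 = 0 \<or> partials q (C l k) 0 = 0"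
    proof (cases "p = [] \<or> q = []")
      case True then show ?thesis using sm by auto
    next
      case False
      then have "length q < length ds" "length p < length ds" using pq by (cases p; cases q; auto)+
      then show ?thesis using less.hyps[of q l k] less.hyps[of p j l] pq less.prems by linarith
    qed
  qed
  show ?case
  proof (rule partials_riccati_zero[OF S])
    show "C j k x = radial_int 0 (\<lambda>y. A j k y + (\<Sum>l\<in>UNIV. A j l y * C l k y) - (\<Sum>l\<in>UNIV. C j l y * C l k y)) x"
      if "x \<in> S" for x using ric that by (auto simp: riccati_def)
    show "smooth_on S (\<lambda>y. A j k y + (\<Sum>l\<in>UNIV. A j l y * C l k y) - (\<Sum>l\<in>UNIV. C j l y * C l k y))"
      by (intro smooth_on_diff smooth_on_add smooth_on_sum smooth_on_mult sm S)
    show "partials ds (\<lambda>y. A j k y + (\<Sum>l\<in>UNIV. A j l y * C l k y) - (\<Sum>l\<in>UNIV. C j l y * C l k y)) 0 = 0"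
      by (subst partials_diff[OF S(1) _ _ S(3)] partials_add[OF S(1) _ _ S(3)] partials_sum[OF S(1) _ S(3)],
          (intro smooth_on_diff smooth_on_add smooth_on_sum smooth_on_mult sm S)+)+
        (simp add: AC CC A[OF less.prems])
  qed
qed

text \<open>The difference of the two equations is arranged into products with one difference as a
  factor, as in AC - A'C' = (A - A')C + A'(C - C'). The strict weight bound for the other factor and
  the non-strict one for the difference add up to the non-strict bound for the product.\<close>

lemma riccati_diff_vanish:
  assumes S: "open S" "star0 S" "0 \<in> S" and ric: "riccati S A C" "riccati S A' C'"
    and A: "\<And>ds j k. wsum w ds + w j < w k \<Longrightarrow> partials ds (A j k) 0 = 0"
    and A': "\<And>ds j k. wsum w ds + w j < w k \<Longrightarrow> partials ds (A' j k) 0 = 0"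
    and D: "\<And>ds j k. wsum w ds + w j \<le> w k \<Longrightarrow> partials ds (\<lambda>x. A j k x - A' j k x) 0 = 0"
  shows "wsum w ds + w j \<le> w k \<Longrightarrow> partials ds (\<lambda>x. C j k x - C' j k x) 0 = 0"
proof (induction "length ds" arbitrary: ds j k rule: less_induct)
  case less
  have sm: "smooth_on S (A j k)" "smooth_on S (C j k)" "A j k 0 = 0" "C j k 0 = 0"
    "smooth_on S (A' j k)" "smooth_on S (C' j k)" "A' j k 0 = 0" "C' j k 0 = 0" for j k
    using ric by (auto simp: riccati_def)
  have smD: "smooth_on S (\<lambda>y. A j k y - A' j k y)" "smooth_on S (\<lambda>y. C j k y - C' j k y)" for j k
    by (intro smooth_on_diff sm S)+
  have C: "\<And>ds j k. wsum w ds + w j < w k \<Longrightarrow> partials ds (C j k) 0 = 0"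
    using riccati_vanish[OF S ric(1) A] by blast
  have C': "\<And>ds j k. wsum w ds + w j < w k \<Longrightarrow> partials ds (C' j k) 0 = 0"
    using riccati_vanish[OF S ric(2) A'] by blast
  have 1: "partials ds (\<lambda>y. (A j l y - A' j l y) * C l k y) 0 = 0" for l
  proof (rule partials_mult_zero[OF S(1,3) smD(1) sm(2)])
    fix p q assume pq: "length p + length q = length ds" "wsum w p + wsum w q = wsum w ds"
    show "partials p (\<lambda>y. A j l y - A' j l y) 0 = 0 \<or> partials q (C l k) 0 = 0"
      using C[of q l k] D[of p j l] pq less.prems by linarith
  qed
  have 2: "partials ds (\<lambda>y. A' j l y * (C l k y - C' l k y)) 0 = 0" for l
  proof (rule partials_mult_zero[OF S(1,3) sm(5) smD(2)])
    fix p q assume pq: "length p + length q = length ds" "wsum w p + wsum w q = wsum w ds"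
    show "partials p (A' j l) 0 = 0 \<or> partials q (\<lambda>y. C l k y - C' l k y) 0 = 0"
    proof (cases "p = []")
      case True then show ?thesis using sm by simp
    next
      case False
      then have "length q < length ds" using pq by (cases p) auto
      then show ?thesis using less.hyps[of q l k] A'[of p j l] pq less.prems by linarith
    qed
  qed
  have 3: "partials ds (\<lambda>y. (C j l y - C' j l y) * C l k y) 0 = 0" for l
  proof (rule partials_mult_zero[OF S(1,3) smD(2) sm(2)])
    fix p q assume pq: "length p + length q = length ds" "wsum w p + wsum w q = wsum w ds"
    show "partials p (\<lambda>y. C j l y - C' j l y) 0 = 0 \<or> partials q (C l k) 0 = 0"
    proof (cases "q = []")
      case True then show ?thesis using sm by simp
    next
      case False
      then have "length p < length ds" using pq by (cases q) auto
      then show ?thesis using less.hyps[of p j l] C[of q l k] pq less.prems by linarith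
    qed
  qed
  have 4: "partials ds (\<lambda>y. C' j l y * (C l k y - C' l k y)) 0 = 0" for l
  proof (rule partials_mult_zero[OF S(1,3) sm(6) smD(2)])
    fix p q assume pq: "length p + length q = length ds" "wsum w p + wsum w q = wsum w ds"
    show "partials p (C' j l) 0 = 0 \<or> partials q (\<lambda>y. C l k y - C' l k y) 0 = 0"
    proof (cases "p = []")
      case True then show ?thesis using sm by simp
    next
      case False
      then have "length q < length ds" using pq by (cases p) auto
      then show ?thesis using less.hyps[of q l k] C'[of p j l] pq less.prems by linarith
    qed
  qed
  define R where "R y = (A j k y - A' j k y) + (\<Sum>l\<in>UNIV. (A j l y - A' j l y) * C l k y) +
      (\<Sum>l\<in>UNIV. A' j l y * (C l k y - C' l k y)) - (\<Sum>l\<in>UNIV. (C j l y - C' j l y) * C l k y) -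
      (\<Sum>l\<in>UNIV. C' j l y * (C l k y - C' l k y))" for y
  show ?case
  proof (rule partials_riccati_zero[OF S])
    show smR: "smooth_on S R" unfolding R_def
      by (intro smooth_on_diff smooth_on_add smooth_on_sum smooth_on_mult sm S)
    define R1 where "R1 y = A j k y + (\<Sum>l\<in>UNIV. A j l y * C l k y) - (\<Sum>l\<in>UNIV. C j l y * C l k y)" for y
    define R2 where "R2 y = A' j k y + (\<Sum>l\<in>UNIV. A' j l y * C' l k y) - (\<Sum>l\<in>UNIV. C' j l y * C' l k y)" for y
    have smR12: "smooth_on S R1" "smooth_on S R2" unfolding R1_def R2_def
      by (intro smooth_on_diff smooth_on_add smooth_on_sum smooth_on_mult sm S)+
    have R: "R = (\<lambda>y. R1 y - R2 y)"
      by (rule ext) (simp add: R_def R1_def R2_def algebra_simps sum_subtractf sum.distrib)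
    show "C j k x - C' j k x = radial_int 0 R x" if "x \<in> S" for x
    proof -
      have "C j k x = radial_int 0 R1 x" "C' j k x = radial_int 0 R2 x"
        using ric that by (auto simp: riccati_def R1_def[abs_def] R2_def[abs_def])
      then show ?thesis unfolding R
        using radial_int_diff[OF S(2) smR12[THEN smooth_on_continuous] that] by simp
    qed
    show "partials ds R 0 = 0" unfolding R_def
      by (subst partials_diff[OF S(1) _ _ S(3)] partials_add[OF S(1) _ _ S(3)] partials_sum[OF S(1) _ S(3)],
          (intro smooth_on_diff smooth_on_add smooth_on_sum smooth_on_mult sm S)+)+
        (simp add: 1 2 3 4 D[OF less.prems] flip: partials_diff[OF S(1) sm(1) sm(5) S(3)])
  qed
qed

section \<open>Dilations and rescaled limits\<close>

lemma dil_bounded_linear: "bounded_linear (dil w t)"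
  unfolding linear_conv_bounded_linear[symmetric]
  by (rule linearI) (simp_all add: dil_def vec_eq_iff algebra_simps)

lemma dil_nth [simp]: "dil w t x $ k = t ^ w k * x $ k"
  by (simp add: dil_def)

lemma norm_dil_le:
  fixes x :: "real^'n"
  assumes "\<bar>t\<bar> \<le> 1" "\<And>l. w l \<ge> 1"
  shows "norm (dil w t x) \<le> \<bar>t\<bar> * norm x"
proof -
  have "norm (dil w t x) \<le> norm (t *\<^sub>R x)"
  proof (rule norm_le_componentwise_cart)
    fix i
    have "\<bar>t\<bar> ^ w i \<le> \<bar>t\<bar> ^ 1" using assms by (intro power_decreasing) auto
    then show "norm (dil w t x $ i) \<le> norm ((t *\<^sub>R x) $ i)"
      by (auto simp: abs_mult power_abs intro!: mult_right_mono)
  qed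
  then show ?thesis by simp
qed

lemma dil_into_ball:
  fixes w :: "'n::finite \<Rightarrow> nat"
  assumes "\<rho> > 0" "R \<ge> 0" "\<And>l. w l \<ge> 1"
  shows "\<exists>\<tau>. 0 < \<tau> \<and> \<tau> \<le> 1 \<and> (\<forall>t. \<forall>x\<in>cball (0::real^'n) R. \<bar>t\<bar> \<le> \<tau> \<longrightarrow> dil w t x \<in> cball 0 (\<rho> / 2))"
proof (intro exI conjI allI ballI impI)
  \<comment> \<open>\<open>R + 1\<close> in place of \<open>R\<close> avoids division by
    zero.\<close>
  define \<tau> where "\<tau> = min 1 (\<rho> / (2 * (R + 1)))"
  show "0 < \<tau>" "\<tau> \<le> 1" using assms by (auto simp: \<tau>_def)
  fix t and x :: "real^'n" assume t: "\<bar>t\<bar> \<le> \<tau>" and x: "x \<in> cball 0 R"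
  have "norm (dil w t x) \<le> \<bar>t\<bar> * norm x"
    by (rule norm_dil_le) (use t assms \<open>\<tau> \<le> 1\<close> in auto)
  also have "\<dots> \<le> \<rho> / (2 * (R + 1)) * (R + 1)"
    using t x assms by (intro mult_mono) (auto simp: \<tau>_def)
  also have "\<dots> = \<rho> / 2" using assms(2) by (simp add: field_simps)
  finally show "dil w t x \<in> cball 0 (\<rho> / 2)" by simp
qed

text \<open>A weighted Taylor estimate. The derivative in direction \<open>l\<close> vanishes to
  weighted order \<open>M - w l\<close>, and the mean value theorem on the dilated ball, which is
  convex and contains 0, multiplies it by the coordinate \<open>t ^ w l * x $ l\<close>. The
  induction is strong because \<open>M\<close> drops by \<open>w l\<close>.\<close>

lemma dil_vanish_bound:
  fixes u :: "real^'n \<Rightarrow> real"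
  assumes \<rho>: "\<rho> > 0" and w: "\<And>l. w l \<ge> 1" and R: "R \<ge> 0" and \<tau>: "0 < \<tau>" "\<tau> \<le> 1"
    and dil: "\<And>t x. \<bar>t\<bar> \<le> \<tau> \<Longrightarrow> x \<in> cball 0 R \<Longrightarrow> dil w t x \<in> cball 0 (\<rho> / 2)"
    and u: "smooth_on (ball 0 \<rho>) u" "\<And>ds. wsum w ds < M \<Longrightarrow> partials ds u 0 = 0"
  shows "\<exists>B\<ge>0. \<forall>t x. \<bar>t\<bar> \<le> \<tau> \<longrightarrow> x \<in> cball 0 R \<longrightarrow> \<bar>u (dil w t x)\<bar> \<le> B * \<bar>t\<bar> ^ M"
  using u
proof (induction M arbitrary: u rule: less_induct)
  case (less M)
  have sub: "cball 0 (\<rho> / 2) \<subseteq> ball (0::real^'n) \<rho>" using \<rho> by auto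
  show ?case
  proof (cases "M = 0")
    case True
    have "continuous_on (cball 0 (\<rho> / 2)) u"
      using smooth_on_continuous[OF less.prems(1)] sub continuous_on_subset by blast
    then have "bounded (u ` cball 0 (\<rho> / 2))"
      using compact_continuous_image compact_imp_bounded compact_cball by blast
    then obtain B where "B > 0" "\<And>x. x \<in> cball 0 (\<rho> / 2) \<Longrightarrow> \<bar>u x\<bar> \<le> B"
      unfolding bounded_pos by auto
    then show ?thesis using True dil by (intro exI[of _ B]) auto
  next
    case False
    have "\<exists>B\<ge>0. \<forall>t x. \<bar>t\<bar> \<le> \<tau> \<longrightarrow> x \<in> cball 0 R \<longrightarrow> \<bar>dir_deriv (axis l 1) u (dil w t x)\<bar> \<le> B * \<bar>t\<bar> ^ (M - w l)" for l
    proof (rule less.IH)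
      show "M - w l < M" using False w[of l] by simp
      show "smooth_on (ball 0 \<rho>) (dir_deriv (axis l 1) u)" by (rule smooth_on_dir_deriv[OF less.prems(1)])
      show "partials ds (dir_deriv (axis l 1) u) 0 = 0" if "wsum w ds < M - w l" for ds
        using less.prems(2)[of "ds @ [l]"] that by (simp add: partials_append)
    qed
    then obtain B where B: "\<And>l. B l \<ge> 0"
      "\<And>l t x. \<bar>t\<bar> \<le> \<tau> \<Longrightarrow> x \<in> cball 0 R \<Longrightarrow> \<bar>dir_deriv (axis l 1) u (dil w t x)\<bar> \<le> B l * \<bar>t\<bar> ^ (M - w l)"
      by metis
    have u0: "u 0 = 0" using less.prems(2)[of "[]"] False by simp
    show ?thesis
    proof (intro exI[of _ "\<Sum>l\<in>UNIV. B l * R"] conjI allI impI)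
      show "0 \<le> (\<Sum>l\<in>UNIV. B l * R)" using B(1) R by (simp add: sum_nonneg)
      fix t and x :: "real^'n" assume t: "\<bar>t\<bar> \<le> \<tau>" and x: "x \<in> cball 0 R"
      have "\<bar>u (dil w t x) - u 0\<bar> \<le> (\<Sum>l\<in>UNIV. (B l * \<bar>t\<bar> ^ (M - w l)) * \<bar>dil w t x $ l - 0 $ l\<bar>)"
      proof (rule mean_value_partials)
        show "convex (dil w t ` cball 0 R)"
          by (intro convex_linear_image bounded_linear.linear dil_bounded_linear convex_cball)
        show "u differentiable at y" if "y \<in> dil w t ` cball 0 R" for y
          using that dil[OF t] sub by (intro smooth_on_differentiable[OF less.prems(1)]) blast
        show "\<bar>dir_deriv (axis l 1) u y\<bar> \<le> B l * \<bar>t\<bar> ^ (M - w l)" if "y \<in> dil w t ` cball 0 R" for y l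
          using that B(2)[OF t] by blast
        show "dil w t x \<in> dil w t ` cball 0 R" using x by blast
        have "dil w t 0 = 0" by (simp add: vec_eq_iff)
        then show "0 \<in> dil w t ` cball 0 R" using R by (metis centre_in_cball imageI)
      qed
      also have "\<dots> \<le> (\<Sum>l\<in>UNIV. B l * R * \<bar>t\<bar> ^ M)"
      proof (rule sum_mono)
        fix l
        \<comment> \<open>Only an inequality, since \<open>M - w l\<close> is cut off at 0 when
          \<open>w l > M\<close>; then \<open>\<bar>t\<bar> \<le> 1\<close> is what helps.\<close>
        have "\<bar>t\<bar> ^ (M - w l) * \<bar>t\<bar> ^ w l \<le> \<bar>t\<bar> ^ M"
          unfolding power_add[symmetric] using t \<tau> by (intro power_decreasing) auto
        moreover have "\<bar>x $ l\<bar> \<le> R" using component_le_norm_cart[of x l] x by simp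
        ultimately have "B l * ((\<bar>t\<bar> ^ (M - w l) * \<bar>t\<bar> ^ w l) * \<bar>x $ l\<bar>) \<le> B l * (\<bar>t\<bar> ^ M * R)"
          using B(1) R by (intro mult_left_mono mult_mono) auto
        then show "(B l * \<bar>t\<bar> ^ (M - w l)) * \<bar>dil w t x $ l - 0 $ l\<bar> \<le> B l * R * \<bar>t\<bar> ^ M"
          by (simp add: abs_mult power_abs mult_ac)
      qed
      finally show "\<bar>u (dil w t x)\<bar> \<le> (\<Sum>l\<in>UNIV. B l * R) * \<bar>t\<bar> ^ M"
        by (simp add: u0 sum_distrib_right)
    qed
  qed
qed

text \<open>The weighted order of \<open>u\<close> exceeds \<open>b - a\<close>, so that rescaling
  by \<open>t ^ a / t ^ b\<close> leaves a factor \<open>t\<close>. A derivative lowers the order by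
  its weight, but the chain rule returns the same power of \<open>t\<close>.\<close>

lemma uniform_limit_dil_remainder:
  fixes u :: "real^'n \<Rightarrow> real"
  assumes \<rho>: "\<rho> > 0" and w: "\<And>l. w l \<ge> 1" and u: "smooth_on (ball 0 \<rho>) u"
    and van: "\<And>ds. wsum w ds + a \<le> b \<Longrightarrow> partials ds u 0 = 0"
  shows "uniform_limit (cball 0 R) (\<lambda>t x. t ^ a * inverse (t ^ b) * t ^ wsum w ds * partials ds u (dil w t x)) (\<lambda>x. 0) (at 0)"
proof (cases "R \<ge> 0")
  case False then show ?thesis by (simp add: cball_empty)
next
  case R: True
  obtain \<tau> where \<tau>: "0 < \<tau>" "\<tau> \<le> 1" "\<And>t x. \<bar>t\<bar> \<le> \<tau> \<Longrightarrow> x \<in> cball 0 R \<Longrightarrow> dil w t x \<in> cball 0 (\<rho> / 2)"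
    using dil_into_ball[of \<rho> R w, OF \<rho> R w] by blast
  \<comment> \<open>The order left to \<open>partials ds u\<close>. Even when the difference is cut
    off at 0, \<open>a + wsum w ds + M \<ge> b + 1\<close>.\<close>
  define M where "M = b + 1 - (a + wsum w ds)"
  have "\<exists>B\<ge>0. \<forall>t x. \<bar>t\<bar> \<le> \<tau> \<longrightarrow> x \<in> cball 0 R \<longrightarrow> \<bar>partials ds u (dil w t x)\<bar> \<le> B * \<bar>t\<bar> ^ M"
  proof (rule dil_vanish_bound[OF \<rho> w R \<tau> smooth_on_partials[OF u]])
    show "partials es (partials ds u) 0 = 0" if "wsum w es < M" for es
      using van[of "es @ ds"] that by (simp add: partials_append M_def)
  qed
  then obtain B where B: "B \<ge> 0" "\<And>t x. \<bar>t\<bar> \<le> \<tau> \<Longrightarrow> x \<in> cball 0 R \<Longrightarrow> \<bar>partials ds u (dil w t x)\<bar> \<le> B * \<bar>t\<bar> ^ M"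
    by blast
  have bound: "\<bar>t ^ a * inverse (t ^ b) * t ^ wsum w ds * partials ds u (dil w t x)\<bar> \<le> B * \<bar>t\<bar>"
    if t: "t \<noteq> 0" "\<bar>t\<bar> \<le> \<tau>" and x: "x \<in> cball 0 R" for t x
  proof -
    have "\<bar>t ^ a * inverse (t ^ b) * t ^ wsum w ds * partials ds u (dil w t x)\<bar>
      \<le> \<bar>t\<bar> ^ a * inverse (\<bar>t\<bar> ^ b) * \<bar>t\<bar> ^ wsum w ds * (B * \<bar>t\<bar> ^ M)"
      using B(2)[OF t(2) x] by (auto simp: abs_mult power_abs intro!: mult_left_mono)
    also have "\<dots> = B * (\<bar>t\<bar> ^ (a + wsum w ds + M) * inverse (\<bar>t\<bar> ^ b))"
      by (simp add: power_add mult_ac)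
    also have "\<dots> \<le> B * (\<bar>t\<bar> ^ (b + 1) * inverse (\<bar>t\<bar> ^ b))"
      using B(1) t \<tau> by (intro mult_left_mono mult_right_mono power_decreasing) (auto simp: M_def)
    also have "\<dots> = B * \<bar>t\<bar>" using t(1) by simp
    finally show ?thesis .
  qed
  show ?thesis
  proof (rule uniform_limitI)
    fix e :: real assume e: "e > 0"
    define d where "d = min \<tau> (e / (B + 1))"
    have d: "d > 0" using \<tau> e B by (simp add: d_def)
    show "\<forall>\<^sub>F t in at 0. \<forall>x\<in>cball 0 R. dist (t ^ a * inverse (t ^ b) * t ^ wsum w ds * partials ds u (dil w t x)) 0 < e"
      unfolding eventually_at
    proof (intro exI[of _ d] conjI ballI impI d)
      fix t :: real and x :: "real^'n" assume t: "t \<noteq> 0 \<and> dist t 0 < d" and x: "x \<in> cball 0 R"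
      have "B * \<bar>t\<bar> \<le> B * d" using t B by (intro mult_left_mono) auto
      also have "\<dots> \<le> B * (e / (B + 1))" using B by (intro mult_left_mono) (auto simp: d_def)
      also have "\<dots> < e" using B e by (simp add: field_simps)
      finally show "dist (t ^ a * inverse (t ^ b) * t ^ wsum w ds * partials ds u (dil w t x)) 0 < e"
        using bound[of t x] t x by (simp add: d_def)
    qed
  qed
qed

lemma partials_dil:
  fixes f :: "real^'n \<Rightarrow> real"
  assumes "open S" "smooth_on S f" "open T" "dil w t ` T \<subseteq> S" "x \<in> T"
  shows "partials ds (\<lambda>y. f (dil w t y)) x = t ^ wsum w ds * partials ds f (dil w t x)"
  using assms(5)
proof (induction ds arbitrary: x)
  case (Cons d ds)
  have D: "partials ds f differentiable at (dil w t x)"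
    using Cons.prems assms(4) by (intro smooth_on_differentiable[OF smooth_on_partials[OF assms(2)]]) blast
  have D2: "((\<lambda>y. t ^ wsum w ds * partials ds f (dil w t y)) has_derivative
      (\<lambda>v. t ^ wsum w ds * dir_deriv (dil w t v) (partials ds f) (dil w t x))) (at x)"
    by (rule has_derivative_mult_right[OF has_derivative_compose[OF
        bounded_linear_imp_has_derivative[OF dil_bounded_linear] differentiable_has_derivative[OF D]]])
  have "dil w t (axis d 1) = t ^ w d *\<^sub>R axis d 1"
    by (simp add: vec_eq_iff axis_def)
  then have ax: "dir_deriv (dil w t (axis d 1)) (partials ds f) (dil w t x) = t ^ w d * dir_deriv (axis d 1) (partials ds f) (dil w t x)"
    using linear_cmul[OF has_derivative_linear[OF differentiable_has_derivative[OF D]], of "t ^ w d" "axis d 1"] by simp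
  have "partials (d # ds) (\<lambda>y. f (dil w t y)) x = dir_deriv (axis d 1) (\<lambda>y. t ^ wsum w ds * partials ds f (dil w t y)) x"
    unfolding partials.simps
    by (subst frechet_derivative_cong_open[OF assms(3) Cons.prems Cons.IH]) simp_all
  also have "\<dots> = t ^ wsum w ds * (t ^ w d * dir_deriv (axis d 1) (partials ds f) (dil w t x))"
    unfolding ax[symmetric] by (rule has_derivative_dir_deriv[OF D2])
  finally show ?case by (simp add: power_add mult_ac)
qed simp

lemma uniform_limit_vec:
  fixes f :: "'a \<Rightarrow> 'x \<Rightarrow> real^'n"
  assumes "\<And>k. uniform_limit K (\<lambda>t x. f t x $ k) (\<lambda>x. l x $ k) F"
  shows "uniform_limit K f l F"
proof (rule uniform_limitI)
  fix e :: real assume e: "e > 0"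
  have "\<forall>\<^sub>F t in F. \<forall>k. \<forall>x\<in>K. dist (f t x $ k) (l x $ k) < e / CARD('n)"
    by (rule eventually_all_finite) (rule uniform_limitD[OF assms], use e in simp)
  then show "\<forall>\<^sub>F t in F. \<forall>x\<in>K. dist (f t x) (l x) < e"
  proof eventually_elim
    case (elim t)
    show ?case
    proof
      fix x assume "x \<in> K"
      have "norm (f t x - l x) \<le> (\<Sum>k\<in>UNIV. \<bar>(f t x - l x) $ k\<bar>)" by (rule norm_le_l1_cart)
      also have "\<dots> < (\<Sum>k\<in>(UNIV::'n set). e / CARD('n))"
        by (rule sum_strict_mono) (use elim \<open>x \<in> K\<close> in \<open>auto simp: dist_real_def\<close>)
      finally show "dist (f t x) (l x) < e" by (simp add: dist_norm)
    qed
  qed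
qed

text \<open>By homogeneity \<open>Z\<close> is fixed under the rescaling, so only
  \<open>B - Z\<close> has to disappear in the limit. As \<open>B\<close> is controlled near 0
  alone, \<open>t\<close> is first made so small that a ball containing \<open>K\<close> is dilated
  into \<open>ball 0 \<rho>\<close>.\<close>

lemma uniform_limit_dil_pullback:
  fixes B Z :: "real^'n \<Rightarrow> real^'n"
  assumes \<rho>: "\<rho> > 0" and w: "\<And>l. w l \<ge> 1" and B: "smooth_on (ball 0 \<rho>) B" and Z: "smooth_on UNIV Z"
    and hom: "\<And>t x k. t ^ a * Z (dil w t x) $ k = t ^ w k * Z x $ k"
    and van: "\<And>ds k. wsum w ds + a \<le> w k \<Longrightarrow> partials ds (\<lambda>x. B x $ k - Z x $ k) 0 = 0"
    and K: "compact K"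
  shows "uniform_limit K (\<lambda>t. partials ds (\<lambda>x. t ^ a *\<^sub>R dil_pullback w t B x)) (partials ds Z) (at 0)"
proof -
  obtain R where R: "R > 0" "K \<subseteq> ball 0 R"
    using compact_imp_bounded[OF K] by (metis bounded_subset_ballD)
  define u where "u k x = B x $ k - Z x $ k" for k x
  have Zk: "smooth_on UNIV (\<lambda>x. Z x $ k)" for k using Z smooth_on_vec_iff[of UNIV Z] by simp
  have Bk: "smooth_on (ball 0 \<rho>) (\<lambda>x. B x $ k)" for k using B smooth_on_vec_iff[of "ball 0 \<rho>" B] by simp
  have u: "smooth_on (ball 0 \<rho>) (u k)" for k
    unfolding u_def by (intro smooth_on_diff Bk smooth_on_subset[OF Zk]) auto
  obtain \<tau> where \<tau>: "0 < \<tau>" "\<tau> \<le> 1" "\<And>t x. \<bar>t\<bar> \<le> \<tau> \<Longrightarrow> x \<in> cball 0 R \<Longrightarrow> dil w t x \<in> cball 0 (\<rho> / 2)"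
    using dil_into_ball[of \<rho> R w, OF \<rho> less_imp_le[OF R(1)] w] by blast
  have dilball: "dil w t ` ball 0 R \<subseteq> ball 0 \<rho>" if "\<bar>t\<bar> \<le> \<tau>" for t
  proof -
    have "dil w t y \<in> ball 0 \<rho>" if "y \<in> ball 0 R" for y
      using \<tau>(3)[OF \<open>\<bar>t\<bar> \<le> \<tau>\<close>, of y] that \<rho> by simp
    then show ?thesis by blast
  qed
  have key: "partials ds (\<lambda>x. t ^ a *\<^sub>R dil_pullback w t B x) x $ k =
      partials ds Z x $ k + t ^ a * inverse (t ^ w k) * t ^ wsum w ds * partials ds (u k) (dil w t x)"
    if t: "t \<noteq> 0" "\<bar>t\<bar> \<le> \<tau>" and x: "x \<in> ball 0 R" for t x k
  proof -
    define c where "c k = t ^ a * inverse (t ^ w k)" for k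
    have P: "(t ^ a *\<^sub>R dil_pullback w t B y) $ k = Z y $ k + c k * u k (dil w t y)" for y k
    proof -
      have "c k * Z (dil w t y) $ k = inverse (t ^ w k) * (t ^ w k * Z y $ k)"
        unfolding hom[symmetric] c_def by simp
      also have "\<dots> = Z y $ k" using t by simp
      finally show ?thesis by (simp add: dil_pullback_def u_def c_def algebra_simps)
    qed
    have su: "smooth_on (ball 0 R) (\<lambda>y. u k (dil w t y))" for k
    proof (rule smooth_on_compose[OF open_ball open_ball u _ dilball[OF t(2)]])
      show "smooth_on (ball 0 R) (dil w t)"
        unfolding smooth_on_def using Ck_on_bounded_linear[OF dil_bounded_linear] by blast
    qed
    have scu: "smooth_on (ball 0 R) (\<lambda>y. c k * u k (dil w t y))" for k
      by (intro smooth_on_mult su) auto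
    have "smooth_on (ball 0 R) (\<lambda>y. t ^ a *\<^sub>R dil_pullback w t B y)"
      unfolding smooth_on_vec_iff[OF open_ball] P
      by (intro allI smooth_on_add scu smooth_on_subset[OF Zk]) auto
    then have "partials ds (\<lambda>x. t ^ a *\<^sub>R dil_pullback w t B x) x $ k =
        partials ds (\<lambda>y. Z y $ k + c k * u k (dil w t y)) x"
      by (simp only: partials_component[OF open_ball _ x] P)
    also have "\<dots> = partials ds (\<lambda>y. Z y $ k) x + c k * partials ds (\<lambda>y. u k (dil w t y)) x"
      using partials_add[OF open_ball smooth_on_subset[OF Zk] scu x] partials_cmult[OF open_ball su x] by simp
    also have "\<dots> = partials ds Z x $ k + c k * (t ^ wsum w ds * partials ds (u k) (dil w t x))"
      using partials_component[OF open_UNIV Z] partials_dil[OF open_ball u open_ball dilball[OF t(2)] x] by simp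
    finally show ?thesis by (simp add: c_def)
  qed
  show ?thesis
  proof (rule uniform_limit_vec)
    fix k
    have "uniform_limit (cball 0 R) (\<lambda>t x. t ^ a * inverse (t ^ w k) * t ^ wsum w ds * partials ds (u k) (dil w t x)) (\<lambda>x. 0) (at 0)"
      by (rule uniform_limit_dil_remainder[OF \<rho> w u]) (use van in \<open>auto simp: u_def[abs_def]\<close>)
    then have lim0: "uniform_limit (cball 0 R) (\<lambda>t x. partials ds Z x $ k + t ^ a * inverse (t ^ w k) * t ^ wsum w ds * partials ds (u k) (dil w t x))
        (\<lambda>x. partials ds Z x $ k + 0) (at 0)"
      by (rule uniform_limit_add[OF uniform_limit_const])
    have "K \<subseteq> cball 0 R" using R(2) ball_subset_cball by blast
    from uniform_limit_on_subset[OF lim0 this] have lim: "uniform_limit K (\<lambda>t x. partials ds Z x $ k + t ^ a * inverse (t ^ w k) * t ^ wsum w ds * partials ds (u k) (dil w t x))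
        (\<lambda>x. partials ds Z x $ k) (at 0)"
      by simp
    have "\<forall>\<^sub>F t in at 0. t \<noteq> 0 \<and> \<bar>t\<bar> \<le> \<tau>"
      unfolding eventually_at using \<tau> by (intro exI[of _ \<tau>]) auto
    then have "\<forall>\<^sub>F t in at 0. \<forall>x\<in>K. partials ds Z x $ k + t ^ a * inverse (t ^ w k) * t ^ wsum w ds * partials ds (u k) (dil w t x)
        = partials ds (\<lambda>x. t ^ a *\<^sub>R dil_pullback w t B x) x $ k"
      by eventually_elim (use key R in auto)
    from uniform_limit_cong[OF this] lim
    show "uniform_limit K (\<lambda>t x. partials ds (\<lambda>x. t ^ a *\<^sub>R dil_pullback w t B x) x $ k) (\<lambda>x. partials ds Z x $ k) (at 0)"
      by simp
  qed
qed


section \<open>The linear part of the Dynkin product\<close>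


definition positive_lists :: "nat \<Rightarrow> nat list set" where
  "positive_lists n = {qs. (\<forall>q\<in>set qs. q > 0) \<and> sum_list qs = n}"

definition compositions :: "nat \<Rightarrow> nat \<Rightarrow> nat list set" where
  "compositions i n = {qs. length qs = i \<and> (\<forall>q\<in>set qs. q > 0) \<and> sum_list qs = n}"

lemma length_le_sum_list: "(\<forall>q\<in>set qs. q > 0) \<Longrightarrow> length qs \<le> sum_list (qs :: nat list)"
  by (induction qs) auto

lemma positive_lists_eq: "positive_lists n = (\<Union>i\<in>{0..n}. compositions i n)"
  using length_le_sum_list by (auto simp: positive_lists_def compositions_def)

lemma compositions_Suc: "compositions (Suc i) n = (\<Union>q\<in>{1..n}. (#) q ` compositions i (n - q))"
proof (rule set_eqI)
  fix qs
  show "qs \<in> compositions (Suc i) n \<longleftrightarrow> qs \<in> (\<Union>q\<in>{1..n}. (#) q ` compositions i (n - q))"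
    by (cases qs) (auto simp: compositions_def image_iff)
qed

lemma finite_compositions [simp]: "finite (compositions i n)"
proof (induction i arbitrary: n)
  case 0
  have "compositions 0 n \<subseteq> {[]}" by (auto simp: compositions_def)
  then show ?case by (rule finite_subset) simp
next
  case (Suc i) then show ?case by (simp add: compositions_Suc)
qed

lemma finite_positive_lists [simp]: "finite (positive_lists n)"
  by (simp add: positive_lists_eq)

text \<open>The power of the sum of z^q / q! over q > 0 is multiplied out: one summand for each
  choice of exponents.\<close>

lemma fps_exp_minus_one_power_nth:
  "fps_nth ((fps_exp (1::real) - 1) ^ i) n = (\<Sum>qs\<in>compositions i n. (\<Prod>q\<leftarrow>qs. 1 / fact q))"
proof (induction i arbitrary: n)
  case 0
  have "compositions 0 n = (if n = 0 then {[]} else {})" by (auto simp: compositions_def)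
  then show ?case by (simp add: fps_one_nth)
next
  case (Suc i)
  let ?u = "fps_exp (1::real) - 1"
  have "fps_nth (?u ^ Suc i) n = (\<Sum>q=0..n. fps_nth ?u q * fps_nth (?u ^ i) (n - q))"
    by (simp add: fps_mult_nth)
  also have "\<dots> = (\<Sum>q\<in>{1..n}. fps_nth ?u q * fps_nth (?u ^ i) (n - q))"
    by (rule sum.mono_neutral_right) (auto simp: Suc_le_eq)
  also have "\<dots> = (\<Sum>q\<in>{1..n}. \<Sum>qs\<in>(#) q ` compositions i (n - q). (\<Prod>q\<leftarrow>qs. 1 / fact q))"
    by (rule sum.cong) (auto simp: Suc sum.reindex sum_distrib_left)
  also have "\<dots> = (\<Sum>qs\<in>compositions (Suc i) n. (\<Prod>q\<leftarrow>qs. 1 / fact q))"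
    unfolding compositions_Suc by (rule sum.UNION_disjoint[symmetric]) auto
  finally show ?case .
qed

lemma fps_compose_exp_minus_one_nth:
  "fps_nth (Abs_fps a oo (fps_exp (1::real) - 1)) n =
    (\<Sum>qs\<in>positive_lists n. a (length qs) * (\<Prod>q\<leftarrow>qs. 1 / fact q))"
proof -
  have "fps_nth (Abs_fps a oo (fps_exp (1::real) - 1)) n =
      (\<Sum>i=0..n. \<Sum>qs\<in>compositions i n. a (length qs) * (\<Prod>q\<leftarrow>qs. 1 / fact q))"
    unfolding fps_compose_nth fps_exp_minus_one_power_nth
    by (rule sum.cong) (auto simp: sum_distrib_left compositions_def intro!: sum.cong)
  also have "\<dots> = (\<Sum>qs\<in>positive_lists n. a (length qs) * (\<Prod>q\<leftarrow>qs. 1 / fact q))"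
    unfolding positive_lists_eq
    by (rule sum.UNION_disjoint[symmetric], simp, simp, auto simp: compositions_def)
  finally show ?thesis .
qed

text \<open>In the variable u this is ln(1 + u) / u for \<open>m = 1\<close> and (1 - ln(1 + u) / u)
  / u for \<open>m = 2\<close>. In Dynkin's formula \<open>i + m\<close> is the number of pairs of a
  contributing word: \<open>i\<close> pairs made of x alone, followed by one or two further
  pairs.\<close>

definition ln_quot_fps :: "nat \<Rightarrow> real fps" where
  "ln_quot_fps m = Abs_fps (\<lambda>i. (-1) ^ i / real (i + m))"

text \<open>The power series of \<open>z / (1 - e\<^sup>-\<^sup>z)\<close>, i.e. of the differential of left translation
  in exponential coordinates.\<close>

definition left_trans_fps :: "real fps" where
  "left_trans_fps = (ln_quot_fps 1 oo (fps_exp 1 - 1)) * fps_exp 1"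

lemma ln_quot_fps_1: "(fps_exp 1 - 1) * (ln_quot_fps 1 oo (fps_exp 1 - 1)) = (fps_X :: real fps)"
proof -
  let ?u = "fps_exp 1 - 1 :: real fps"
  have "fps_X * ln_quot_fps 1 = fps_ln (1::real)"
    by (rule fps_ext) (simp add: ln_quot_fps_def fps_ln_def split: nat.split)
  then have "(fps_X * ln_quot_fps 1) oo ?u = fps_X"
    using fps_inv[of ?u] by (simp add: fps_ln_fps_exp_inv)
  then show ?thesis by (simp add: fps_compose_mult_distrib)
qed

lemma ln_quot_fps_2: "(fps_exp 1 - 1) * (ln_quot_fps 2 oo (fps_exp 1 - 1)) = 1 - (ln_quot_fps 1 oo (fps_exp 1 - 1))"
proof -
  let ?u = "fps_exp 1 - 1 :: real fps"
  have "fps_X * ln_quot_fps 2 = 1 - ln_quot_fps 1"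
  proof (rule fps_ext)
    show "fps_nth (fps_X * ln_quot_fps 2) n = fps_nth (1 - ln_quot_fps 1) n" for n
      by (cases n) (simp_all add: ln_quot_fps_def)
  qed
  then have "(fps_X * ln_quot_fps 2) oo ?u = (1 - ln_quot_fps 1) oo ?u" by simp
  then show ?thesis by (simp add: fps_compose_mult_distrib fps_compose_sub_distrib)
qed

lemma fps_exp_minus_one_nz: "fps_exp 1 - 1 \<noteq> (0 :: real fps)"
proof
  assume "fps_exp 1 - 1 = (0 :: real fps)"
  then have "fps_nth (fps_exp 1 - 1 :: real fps) 1 = 0" by simp
  then show False by (simp add: fps_one_nth)
qed

lemma left_trans_fps_deriv:
  "fps_exp 1 * left_trans_fps + (fps_exp 1 - 1) * fps_deriv left_trans_fps = fps_exp 1 + fps_X * fps_exp (1::real)"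
proof -
  have "(fps_exp 1 - 1) * left_trans_fps = fps_X * fps_exp 1"
    using ln_quot_fps_1 by (simp add: left_trans_fps_def mult.assoc[symmetric])
  then have "fps_deriv ((fps_exp 1 - 1) * left_trans_fps) = fps_deriv (fps_X * fps_exp (1::real))" by simp
  then show ?thesis by (simp add: algebra_simps)
qed

lemma left_trans_fps_riccati:
  "fps_X * fps_deriv left_trans_fps = left_trans_fps - left_trans_fps * left_trans_fps + fps_X * left_trans_fps"
proof -
  let ?u = "fps_exp 1 - 1 :: real fps"
  define e d f where "e = fps_exp (1::real)" and "d = fps_deriv left_trans_fps" and "f = left_trans_fps"
  have 1: "(e - 1) * f = fps_X * e"
    using ln_quot_fps_1 by (simp add: left_trans_fps_def mult.assoc[symmetric] e_def f_def)
  have 2: "e * f + (e - 1) * d = e + fps_X * e" using left_trans_fps_deriv by (simp add: e_def d_def f_def)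
  \<comment> \<open>Multiplication by e^z - 1 brings the relations \<open>1\<close> and
    \<open>2\<close> into play; the factor cancels because formal power series have no zero
    divisors.\<close>
  have "(e - 1) * (fps_X * d) = (e - 1) * (f - f * f + fps_X * f)" using 1 2 by algebra
  then show ?thesis using fps_exp_minus_one_nz by (simp add: e_def d_def f_def)
qed

text \<open>The left side collects the contributions of the words x^N y and x^(N-1) y x without
  their common denominator N + 1, the length of the word. The right side is the derivative of z f,
  whose coefficients are N + 1 times those of f. So restoring the denominator gives f.\<close>

lemma left_trans_fps_dynkin:
  "left_trans_fps + fps_X * ((ln_quot_fps 2 oo (fps_exp 1 - 1)) * fps_exp 1) = left_trans_fps + fps_X * fps_deriv left_trans_fps"
proof -
  define e d f l m where "e = fps_exp (1::real)" and "d = fps_deriv left_trans_fps" and "f = left_trans_fps"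
    and "l = ln_quot_fps 1 oo (fps_exp 1 - 1)" and "m = ln_quot_fps 2 oo (fps_exp 1 - 1)"
  have 1: "(e - 1) * l = fps_X" using ln_quot_fps_1 by (simp add: e_def l_def)
  have 2: "e * f + (e - 1) * d = e + fps_X * e" using left_trans_fps_deriv by (simp add: e_def d_def f_def)
  have 3: "(e - 1) * m = 1 - l" using ln_quot_fps_2 by (simp add: e_def m_def l_def)
  have 4: "f = l * e" by (simp add: f_def left_trans_fps_def l_def e_def)
  have "(e - 1) * (fps_X * (m * e)) = fps_X * e * ((e - 1) * m)" by (simp add: algebra_simps)
  also have "\<dots> = fps_X * (e + ((e - 1) * l) * e - e * f)" unfolding 3 4 by (simp add: algebra_simps)
  also have "\<dots> = fps_X * ((e - 1) * d)" unfolding 1 2[symmetric] by simp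
  finally have "(e - 1) * (f + fps_X * (m * e)) = (e - 1) * (f + fps_X * d)" by (simp add: algebra_simps)
  then show ?thesis using fps_exp_minus_one_nz by (simp add: e_def d_def f_def m_def)
qed

abbreviation left_trans_coeff :: "nat \<Rightarrow> real" where
  "left_trans_coeff N \<equiv> fps_nth left_trans_fps N"

lemma left_trans_coeff_0: "left_trans_coeff 0 = 1"
  by (simp add: left_trans_fps_def ln_quot_fps_def)

lemma left_trans_coeff_rec:
  "real N * left_trans_coeff N = left_trans_coeff N - (\<Sum>i=0..N. left_trans_coeff i * left_trans_coeff (N - i))
    + (if N = 0 then 0 else left_trans_coeff (N - 1))"
proof -
  have "fps_nth (fps_X * fps_deriv left_trans_fps) N = real N * left_trans_coeff N"
    by (cases N) simp_all
  then show ?thesis unfolding left_trans_fps_riccati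
    by (simp add: fps_mult_nth[of left_trans_fps left_trans_fps])
qed

lemma left_trans_coeff_dynkin:
  "real (N + 1) * left_trans_coeff N =
     (\<Sum>p=0..N. \<Sum>qs\<in>positive_lists (N - p). (-1) ^ length qs / real (length qs + 1) * (\<Prod>q\<leftarrow>qs. 1 / fact q) / fact p)
   + (if N = 0 then 0 else (\<Sum>p=0..N-1. \<Sum>qs\<in>positive_lists (N - 1 - p).
       (-1) ^ length qs / real (length qs + 2) * (\<Prod>q\<leftarrow>qs. 1 / fact q) / fact p))"
proof -
  have *: "fps_nth ((ln_quot_fps m oo (fps_exp 1 - 1)) * fps_exp 1) N =
      (\<Sum>p=0..N. \<Sum>qs\<in>positive_lists (N - p). (-1) ^ length qs / real (length qs + m) * (\<Prod>q\<leftarrow>qs. 1 / fact q) / fact p)"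
    for m N
    unfolding mult.commute[of "_ oo _"]
    by (auto simp: fps_mult_nth ln_quot_fps_def fps_compose_exp_minus_one_nth sum_distrib_left intro!: sum.cong)
  have "real (N + 1) * left_trans_coeff N = fps_nth (left_trans_fps + fps_X * fps_deriv left_trans_fps) N"
    by (cases N) (simp_all add: algebra_simps)
  also have "\<dots> = fps_nth left_trans_fps N + (if N = 0 then 0 else fps_nth ((ln_quot_fps 2 oo (fps_exp 1 - 1)) * fps_exp 1) (N - 1))"
    unfolding left_trans_fps_dynkin[symmetric] by simp
  finally show ?thesis unfolding left_trans_fps_def * .
qed

text \<open>The derivative at \<open>y = 0\<close> in direction \<open>v\<close> of the nested bracket of a word in \<open>x\<close> (coded by
  \<open>False\<close>) and \<open>y\<close> (coded by \<open>True\<close>). Since \<open>[x, x] = 0\<close>, only the words \<open>x\<^sup>N y\<close> and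
  \<open>x\<^sup>N y x\<close> contribute.\<close>

fun word_lin :: "('v::real_vector \<Rightarrow> 'v \<Rightarrow> 'v) \<Rightarrow> 'v \<Rightarrow> bool list \<Rightarrow> 'v \<Rightarrow> 'v" where
  "word_lin br x [] v = 0"
| "word_lin br x [b] v = (if b then v else 0)"
| "word_lin br x (b # c # bs) v =
     (if b then br v (if c # bs = [False] then x else 0) else br x (word_lin br x (c # bs) v))"

lemma nested_bracket_at_0:
  assumes "\<And>u. br u 0 = 0" "\<And>u. br 0 u = 0" "br x x = 0"
  shows "nested_bracket br (map (\<lambda>b. if b then 0 else x) bs) = (if bs = [False] then x else 0)"
proof (induction bs rule: induct_list012)
  case (3 b c bs)
  then show ?case using assms by (cases b) simp_all
qed simp_all

lemma nested_bracket_has_derivative: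
  fixes br :: "'v::real_normed_vector \<Rightarrow> 'v \<Rightarrow> 'v"
  assumes br: "bounded_bilinear br" and x: "br x x = 0"
  shows "((\<lambda>y. nested_bracket br (map (\<lambda>b. if b then y else x) bs)) has_derivative word_lin br x bs) (at 0)"
proof (induction bs rule: induct_list012)
  case 1 then show ?case by (simp add: word_lin.simps(1)[abs_def])
next
  case (2 b) then show ?case by (cases b) (simp_all add: word_lin.simps(2)[abs_def])
next
  case (3 b c bs)
  interpret bounded_bilinear br by fact
  let ?N = "\<lambda>y. nested_bracket br (map (\<lambda>b. if b then y else x) (c # bs))"
  have N0: "?N 0 = (if c # bs = [False] then x else 0)"
    using nested_bracket_at_0[of br x "c # bs"] zero_left zero_right x by blast
  show ?case
  proof (cases b)
    case True
    have "((\<lambda>y. br y (?N y)) has_derivative (\<lambda>h. br 0 (word_lin br x (c # bs) h) + br h (?N 0))) (at 0)"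
      using FDERIV[OF has_derivative_ident 3(2)] by simp
    then show ?thesis using True N0 by (simp add: zero_left word_lin.simps(3)[abs_def])
  next
    case False
    have "((\<lambda>y. br x (?N y)) has_derivative (\<lambda>h. br x (word_lin br x (c # bs) h))) (at 0)"
      using bounded_linear.has_derivative[OF bounded_linear_right 3(2)] .
    then show ?thesis using False by (simp add: word_lin.simps(3)[abs_def])
  qed
qed

text \<open>Both kinds of words give the same iterate of the bracket with x, the second kind with a
  minus sign because [y, x] = - [x, y]. The truncated subtractions are harmless: a word that is too
  short differs from the pattern in length.\<close>

definition word_sign :: "bool list \<Rightarrow> real" where
  "word_sign bs = (if bs = replicate (length bs - 1) False @ [True] then 1
     else if bs = replicate (length bs - 2) False @ [True, False] then -1 else 0)"

lemma word_lin_eq: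
  fixes br :: "'v::real_normed_vector \<Rightarrow> 'v \<Rightarrow> 'v"
  assumes br: "bounded_bilinear br" and alt: "\<And>u. br u x = - br x u"
  shows "word_lin br x bs v = word_sign bs *\<^sub>R (br x ^^ (length bs - 1)) v"
proof (induction bs rule: induct_list012)
  case 1 then show ?case by (simp add: word_sign_def)
next
  case (2 b) then show ?case by (simp add: word_sign_def)
next
  case (3 b c bs)
  interpret bounded_bilinear br by fact
  show ?case
  proof (cases b)
    case True
    then have "word_sign (b # c # bs) = (if c # bs = [False] then -1 else 0)"
      by (cases bs) (auto simp: word_sign_def)
    then show ?thesis using True by (auto simp: zero_right alt)
  next
    case False
    have "word_sign (b # c # bs) = word_sign (c # bs)"
      using False by (cases bs) (auto simp: word_sign_def)
    then show ?thesis using False 3(2) by (simp add: scaleR_right)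
  qed
qed

section \<open>The contributing words and their decompositions into pairs\<close>

definition dynkin_word :: "(nat \<times> nat) list \<Rightarrow> bool list" where
  "dynkin_word ps = concat (map (\<lambda>(p, q). replicate p False @ replicate q True) ps)"

lemma dynkin_word_simps [simp]:
  "dynkin_word [] = []"
  "dynkin_word ((p, q) # ps) = replicate p False @ replicate q True @ dynkin_word ps"
  "dynkin_word (ps @ qs) = dynkin_word ps @ dynkin_word qs"
  by (simp_all add: dynkin_word_def)

lemma map_dynkin_word:
  "map (\<lambda>b. if b then y else x) (dynkin_word ps) = concat (map (\<lambda>(p, q). replicate p x @ replicate q y) ps)"
  by (induction ps) auto

lemma length_dynkin_word: "length (dynkin_word ps) = (\<Sum>(p, q)\<leftarrow>ps. p + q)"
  by (induction ps) auto

lemma dynkin_word_eq_Nil: "(\<forall>(p, q)\<in>set ps. p + q > 0) \<Longrightarrow> dynkin_word ps = [] \<longleftrightarrow> ps = []"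
  by (induction ps) auto

lemma replicate_append_eq:
  "replicate p False @ us = replicate N False @ True # ws \<Longrightarrow> p \<le> N \<and> us = replicate (N - p) False @ True # ws"
proof (induction p arbitrary: N)
  case (Suc p) then show ?case by (cases N) auto
qed simp

text \<open>Within a pair every x precedes every y, and no pair is empty. So the single final y
  closes the last pair, and the earlier pairs consist of x alone.\<close>

lemma dynkin_word_eq_y:
  assumes "\<forall>(p, q)\<in>set ps. p + q > 0" "dynkin_word ps = replicate N False @ [True]"
  shows "\<exists>qs p. ps = map (\<lambda>q. (q, 0)) qs @ [(p, 1)] \<and> (\<forall>q\<in>set qs. q > 0) \<and> sum_list qs + p = N"
  using assms
proof (induction ps arbitrary: N)
  case (Cons a ps)
  obtain p q where a: "a = (p, q)" by force
  have *: "p \<le> N" "replicate q True @ dynkin_word ps = replicate (N - p) False @ [True]"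
    using replicate_append_eq[of p "replicate q True @ dynkin_word ps" N "[]"] Cons.prems by (auto simp: a)
  show ?case
  proof (cases q)
    case 0
    then obtain qs p' where "ps = map (\<lambda>q. (q, 0)) qs @ [(p', 1)]" "\<forall>q\<in>set qs. q > 0" "sum_list qs + p' = N - p"
      using Cons.IH[of "N - p"] Cons.prems * by auto
    then show ?thesis using 0 * Cons.prems a by (intro exI[of _ "p # qs"] exI[of _ p']) auto
  next
    case (Suc q')
    then have "N - p = 0" using * by (cases "N - p") auto
    then have "N = p" "q' = 0" "dynkin_word ps = []" using * Suc by auto
    then show ?thesis using Suc Cons.prems a by (intro exI[of _ "[]"] exI[of _ p]) (auto simp: dynkin_word_eq_Nil)
  qed
qed simp

text \<open>An x that follows the y has to open a new pair, which is then (1, 0) and the last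
  one.\<close>

lemma dynkin_word_eq_yx:
  assumes "\<forall>(p, q)\<in>set ps. p + q > 0" "dynkin_word ps = replicate N False @ [True, False]"
  shows "\<exists>qs p. ps = map (\<lambda>q. (q, 0)) qs @ [(p, 1), (1, 0)] \<and> (\<forall>q\<in>set qs. q > 0) \<and> sum_list qs + p = N"
  using assms
proof (induction ps arbitrary: N)
  case (Cons a ps)
  obtain p q where a: "a = (p, q)" by force
  have *: "p \<le> N" "replicate q True @ dynkin_word ps = replicate (N - p) False @ [True, False]"
    using replicate_append_eq[of p "replicate q True @ dynkin_word ps" N "[False]"] Cons.prems by (auto simp: a)
  show ?case
  proof (cases q)
    case 0
    then obtain qs p' where "ps = map (\<lambda>q. (q, 0)) qs @ [(p', 1), (1, 0)]" "\<forall>q\<in>set qs. q > 0" "sum_list qs + p' = N - p"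
      using Cons.IH[of "N - p"] Cons.prems * by auto
    then show ?thesis using 0 * Cons.prems a by (intro exI[of _ "p # qs"] exI[of _ p']) auto
  next
    case (Suc q')
    then have "N - p = 0" using * by (cases "N - p") auto
    then have N: "N = p" "replicate q' True @ dynkin_word ps = [False]" using * Suc by auto
    then have q': "q' = 0" "dynkin_word ps = [False]" by (cases q'; simp)+
    then obtain p1 q1 ps' where ps: "ps = (p1, q1) # ps'" by (cases ps) auto
    have "p1 = 1 \<and> q1 = 0 \<and> dynkin_word ps' = []"
      using q'(2) Cons.prems(1) unfolding ps by (cases p1; cases q1) (auto simp: Cons_eq_append_conv append_eq_Cons_conv)
    then show ?thesis using Suc Cons.prems a ps N q' by (intro exI[of _ "[]"] exI[of _ p]) (auto simp: dynkin_word_eq_Nil)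
  qed
qed simp


definition dynkin_words :: "nat \<Rightarrow> (nat \<times> nat) list set" where
  "dynkin_words N = {ps. (\<forall>(p, q)\<in>set ps. p + q > 0) \<and> (\<Sum>(p, q)\<leftarrow>ps. p + q) = N}"

definition dynkin_coeff :: "(nat \<times> nat) list \<Rightarrow> real" where
  "dynkin_coeff ps = (-1) ^ (length ps - 1) /
     (real (length ps) * real (\<Sum>(p, q)\<leftarrow>ps. p + q) * (\<Prod>(p, q)\<leftarrow>ps. fact p * fact q))"

lemma finite_dynkin_words [simp]: "finite (dynkin_words N)"
proof (rule finite_subset)
  have "length ps \<le> (\<Sum>(p, q)\<leftarrow>ps. p + q)" if "\<forall>(p, q)\<in>set ps. p + q > 0" for ps :: "(nat \<times> nat) list"
    using that by (induction ps) auto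
  moreover have "set ps \<subseteq> {0..(\<Sum>(p, q)\<leftarrow>ps. p + q)} \<times> {0..(\<Sum>(p, q)\<leftarrow>ps. p + q)}" for ps :: "(nat \<times> nat) list"
    by (induction ps) auto
  ultimately show "dynkin_words N \<subseteq> {ps. set ps \<subseteq> {0..N} \<times> {0..N} \<and> length ps \<le> N}"
    unfolding dynkin_words_def by blast
  show "finite {ps. set ps \<subseteq> {0..N} \<times> {0..N} \<and> length ps \<le> N}"
    by (rule finite_lists_length_le) simp
qed

lemma prod_list_inverse: "(\<Prod>q\<leftarrow>qs. 1 / fact q :: real) = 1 / (\<Prod>q\<leftarrow>qs. fact q)"
  by (induction qs) auto

lemma sum_list_map_Pair_0: "(\<Sum>(p, q)\<leftarrow>map (\<lambda>q. (q, 0)) qs. p + q) = sum_list (qs :: nat list)"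
  by (induction qs) auto

lemma prod_list_map_Pair_0: "(\<Prod>(p, q)\<leftarrow>map (\<lambda>q. (q, 0)) qs. fact p * fact q) = (\<Prod>q\<leftarrow>qs. fact q :: real)"
  by (induction qs) auto

lemma dynkin_word_map_Pair_0: "dynkin_word (map (\<lambda>q. (q, 0)) qs) = replicate (sum_list qs) False"
  by (induction qs) (auto simp: replicate_add)

lemma dynkin_words_y:
  "{ps \<in> dynkin_words (N + 1). dynkin_word ps = replicate N False @ [True]} =
     (\<lambda>(p, qs). map (\<lambda>q. (q, 0)) qs @ [(p, 1)]) ` (SIGMA p:{0..N}. positive_lists (N - p))"
  (is "?L = ?f ` ?R")
proof (intro subset_antisym subsetI)
  fix ps assume "ps \<in> ?L"
  then obtain qs p where "ps = map (\<lambda>q. (q, 0)) qs @ [(p, 1)]" "\<forall>q\<in>set qs. q > 0" "sum_list qs + p = N"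
    using dynkin_word_eq_y[of ps N] by (auto simp: dynkin_words_def)
  then show "ps \<in> ?f ` ?R"
    by (intro image_eqI[of _ _ "(p, qs)"]) (auto simp: positive_lists_def)
next
  fix ps assume "ps \<in> ?f ` ?R"
  then obtain qs p where ps: "ps = map (\<lambda>q. (q, 0)) qs @ [(p, 1)]" and "\<forall>q\<in>set qs. q > 0" "p \<le> N" "sum_list qs = N - p"
    by (auto simp: positive_lists_def)
  then show "ps \<in> ?L"
    unfolding ps dynkin_words_def
    by (auto simp: sum_list_map_Pair_0[unfolded map_map] dynkin_word_map_Pair_0 replicate_add[symmetric] comp_def split_beta)
qed

lemma dynkin_words_yx:
  "{ps \<in> dynkin_words (N + 2). dynkin_word ps = replicate N False @ [True, False]} =
     (\<lambda>(p, qs). map (\<lambda>q. (q, 0)) qs @ [(p, 1), (1, 0)]) ` (SIGMA p:{0..N}. positive_lists (N - p))"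
  (is "?L = ?f ` ?R")
proof (intro subset_antisym subsetI)
  fix ps assume "ps \<in> ?L"
  then obtain qs p where "ps = map (\<lambda>q. (q, 0)) qs @ [(p, 1), (1, 0)]" "\<forall>q\<in>set qs. q > 0" "sum_list qs + p = N"
    using dynkin_word_eq_yx[of ps N] by (auto simp: dynkin_words_def)
  then show "ps \<in> ?f ` ?R"
    by (intro image_eqI[of _ _ "(p, qs)"]) (auto simp: positive_lists_def)
next
  fix ps assume "ps \<in> ?f ` ?R"
  then obtain qs p where ps: "ps = map (\<lambda>q. (q, 0)) qs @ [(p, 1), (1, 0)]" and "\<forall>q\<in>set qs. q > 0" "p \<le> N" "sum_list qs = N - p"
    by (auto simp: positive_lists_def)
  then show "ps \<in> ?L"
    unfolding ps dynkin_words_def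
    by (auto simp: sum_list_map_Pair_0[unfolded map_map] dynkin_word_map_Pair_0 replicate_add[symmetric] comp_def split_beta)
qed

lemma sum_dynkin_y:
  "(\<Sum>ps | ps \<in> dynkin_words (N + 1) \<and> dynkin_word ps = replicate N False @ [True]. dynkin_coeff ps) =
    (\<Sum>p=0..N. \<Sum>qs\<in>positive_lists (N - p). (-1) ^ length qs / real (length qs + 1) * (\<Prod>q\<leftarrow>qs. 1 / fact q) / fact p) / real (N + 1)"
proof -
  let ?f = "\<lambda>(p, qs). map (\<lambda>q. (q, 0::nat)) qs @ [(p, 1)]"
  have inj: "inj_on ?f (SIGMA p:{0..N}. positive_lists (N - p))"
    by (auto simp: inj_on_def dest!: map_injective intro!: injI)
  have val: "dynkin_coeff (?f (p, qs)) = (-1) ^ length qs / real (length qs + 1) * (\<Prod>q\<leftarrow>qs. 1 / fact q) / fact p / real (N + 1)"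
    if "p \<in> {0..N}" "qs \<in> positive_lists (N - p)" for p qs
    using that by (simp add: dynkin_coeff_def positive_lists_def prod_list_inverse prod_list_map_Pair_0[unfolded map_map]
        sum_list_map_Pair_0[unfolded map_map] comp_def split_beta mult_ac)
  have "(\<Sum>ps | ps \<in> dynkin_words (N + 1) \<and> dynkin_word ps = replicate N False @ [True]. dynkin_coeff ps) =
     (\<Sum>z\<in>(SIGMA p:{0..N}. positive_lists (N - p)). dynkin_coeff (?f z))"
    unfolding dynkin_words_y by (subst sum.reindex[OF inj]) (simp only: comp_def)
  also have "\<dots> = (\<Sum>p=0..N. \<Sum>qs\<in>positive_lists (N - p). dynkin_coeff (?f (p, qs)))"
    by (subst sum.Sigma, simp, simp) (rule sum.cong, auto)
  also have "\<dots> = (\<Sum>p=0..N. \<Sum>qs\<in>positive_lists (N - p). (-1) ^ length qs / real (length qs + 1) * (\<Prod>q\<leftarrow>qs. 1 / fact q) / fact p / real (N + 1))"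
    by (intro sum.cong refl val)
  finally show ?thesis by (simp add: sum_divide_distrib)
qed

lemma sum_dynkin_yx:
  "(\<Sum>ps | ps \<in> dynkin_words (N + 2) \<and> dynkin_word ps = replicate N False @ [True, False]. dynkin_coeff ps) =
    - (\<Sum>p=0..N. \<Sum>qs\<in>positive_lists (N - p). (-1) ^ length qs / real (length qs + 2) * (\<Prod>q\<leftarrow>qs. 1 / fact q) / fact p) / real (N + 2)"
proof -
  let ?f = "\<lambda>(p, qs). map (\<lambda>q. (q, 0::nat)) qs @ [(p, 1), (1, 0)]"
  have inj: "inj_on ?f (SIGMA p:{0..N}. positive_lists (N - p))"
    by (auto simp: inj_on_def dest!: map_injective intro!: injI)
  have val: "dynkin_coeff (?f (p, qs)) = - ((-1) ^ length qs / real (length qs + 2) * (\<Prod>q\<leftarrow>qs. 1 / fact q) / fact p / real (N + 2))"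
    if "p \<in> {0..N}" "qs \<in> positive_lists (N - p)" for p qs
    using that by (simp add: dynkin_coeff_def positive_lists_def prod_list_inverse prod_list_map_Pair_0[unfolded map_map]
        sum_list_map_Pair_0[unfolded map_map] comp_def split_beta mult_ac)
  have "(\<Sum>ps | ps \<in> dynkin_words (N + 2) \<and> dynkin_word ps = replicate N False @ [True, False]. dynkin_coeff ps) =
     (\<Sum>z\<in>(SIGMA p:{0..N}. positive_lists (N - p)). dynkin_coeff (?f z))"
    unfolding dynkin_words_yx by (subst sum.reindex[OF inj]) (simp only: comp_def)
  also have "\<dots> = (\<Sum>p=0..N. \<Sum>qs\<in>positive_lists (N - p). dynkin_coeff (?f (p, qs)))"
    by (subst sum.Sigma, simp, simp) (rule sum.cong, auto)
  also have "\<dots> = (\<Sum>p=0..N. \<Sum>qs\<in>positive_lists (N - p). - ((-1) ^ length qs / real (length qs + 2) * (\<Prod>q\<leftarrow>qs. 1 / fact q) / fact p / real (N + 2)))"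
    by (intro sum.cong refl val)
  finally show ?thesis by (simp add: sum_divide_distrib sum_negf)
qed

lemma sum_dynkin_coeff:
  "(\<Sum>ps\<in>dynkin_words (N + 1). dynkin_coeff ps * word_sign (dynkin_word ps)) = left_trans_coeff N"
proof -
  define Q1 where "Q1 = {ps \<in> dynkin_words (N + 1). dynkin_word ps = replicate N False @ [True]}"
  \<comment> \<open>For \<open>N = 0\<close> the words have length 1 and cannot contain both
    letters; the case distinction keeps \<open>N - 1\<close> meaningful.\<close>
  define Q2 where "Q2 = (if N = 0 then {} else {ps \<in> dynkin_words (N + 1). dynkin_word ps = replicate (N - 1) False @ [True, False]})"
  have sgn: "dynkin_coeff ps * word_sign (dynkin_word ps) =
      (if ps \<in> Q1 then dynkin_coeff ps else 0) - (if ps \<in> Q2 then dynkin_coeff ps else 0)"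
    if ps: "ps \<in> dynkin_words (N + 1)" for ps
  proof -
    have len: "length (dynkin_word ps) = N + 1" using ps by (simp add: length_dynkin_word dynkin_words_def)
    have "replicate N False @ [True] \<noteq> replicate M False @ [True, False]" for M
      using append_eq_append_conv_if by (metis append_butlast_last_id last.simps last_appendR list.discI)
    moreover have "dynkin_word ps \<noteq> [True, False]" if "N = 0" using len that by auto
    ultimately show ?thesis using ps len
      by (cases "N = 0") (auto simp: word_sign_def Q1_def Q2_def)
  qed
  have "Q1 \<subseteq> dynkin_words (N + 1)" "Q2 \<subseteq> dynkin_words (N + 1)" by (auto simp: Q1_def Q2_def)
  then have "(\<Sum>ps\<in>dynkin_words (N + 1). dynkin_coeff ps * word_sign (dynkin_word ps)) = sum dynkin_coeff Q1 - sum dynkin_coeff Q2"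
    using sgn by (simp add: sum_subtractf sum.If_cases Int_absorb1)
  also have "sum dynkin_coeff Q1 = (\<Sum>p=0..N. \<Sum>qs\<in>positive_lists (N - p).
      (-1) ^ length qs / real (length qs + 1) * (\<Prod>q\<leftarrow>qs. 1 / fact q) / fact p) / real (N + 1)"
    unfolding Q1_def by (rule sum_dynkin_y)
  also have "sum dynkin_coeff Q2 = - (if N = 0 then 0 else \<Sum>p=0..N-1. \<Sum>qs\<in>positive_lists (N - 1 - p).
      (-1) ^ length qs / real (length qs + 2) * (\<Prod>q\<leftarrow>qs. 1 / fact q) / fact p) / real (N + 1)"
  proof (cases N)
    case (Suc M) then show ?thesis using sum_dynkin_yx[of M] by (simp add: Q2_def)
  qed (simp add: Q2_def)
  finally have "(\<Sum>ps\<in>dynkin_words (N + 1). dynkin_coeff ps * word_sign (dynkin_word ps)) =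
     (real (N + 1) * left_trans_coeff N) / real (N + 1)"
    unfolding left_trans_coeff_dynkin by (simp add: add_divide_distrib)
  then show ?thesis by simp
qed

text \<open>The product is differentiated word by word and regrouped by the length
  \<open>N + 1\<close> of the words. All contributing words of one length give multiples of the same
  iterated bracket, so their coefficients can be added up.\<close>

lemma left_inv_field_dynkin:
  fixes br :: "real^'n \<Rightarrow> real^'n \<Rightarrow> real^'n"
  assumes br: "bounded_bilinear br" and alt: "\<And>u v. br u v = - br v u"
  shows "left_inv_field (dynkin_product r br) v x = (\<Sum>N<r. left_trans_coeff N *\<^sub>R (br x ^^ N) v)"
proof -
  define I where "I = {ps :: (nat \<times> nat) list. ps \<noteq> [] \<and> (\<forall>(p, q)\<in>set ps. p + q > 0) \<and> (\<Sum>(p, q)\<leftarrow>ps. p + q) \<le> r}"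
  have xx: "br x x = 0" using alt[of x x] by (simp add: vec_eq_iff)
  have I: "I = (\<Union>N\<in>{..<r}. dynkin_words (N + 1))"
  proof (intro subset_antisym subsetI)
    fix ps assume ps: "ps \<in> I"
    then have "(\<Sum>(p, q)\<leftarrow>ps. p + q) \<noteq> 0" by (cases ps) (auto simp: I_def)
    then obtain N where N: "(\<Sum>(p, q)\<leftarrow>ps. p + q) = Suc N" using not0_implies_Suc by blast
    show "ps \<in> (\<Union>N\<in>{..<r}. dynkin_words (N + 1))"
      by (rule UN_I[of N]) (use ps N in \<open>auto simp: I_def dynkin_words_def\<close>)
  qed (auto simp: I_def dynkin_words_def)
  have eq: "dynkin_product r br x = (\<lambda>y. \<Sum>ps\<in>I. dynkin_coeff ps *\<^sub>R nested_bracket br (map (\<lambda>b. if b then y else x) (dynkin_word ps)))"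
    by (simp add: dynkin_product_def[abs_def] I_def dynkin_coeff_def map_dynkin_word)
  have "left_inv_field (dynkin_product r br) v x = (\<Sum>ps\<in>I. dynkin_coeff ps *\<^sub>R word_lin br x (dynkin_word ps) v)"
    unfolding left_inv_field_def eq
    by (rule has_derivative_dir_deriv)
      (intro has_derivative_sum has_derivative_scaleR_right nested_bracket_has_derivative br xx)
  also have "\<dots> = (\<Sum>N<r. \<Sum>ps\<in>dynkin_words (N + 1). dynkin_coeff ps *\<^sub>R word_lin br x (dynkin_word ps) v)"
    unfolding I by (rule sum.UNION_disjoint, simp, simp, auto simp: dynkin_words_def)
  also have "\<dots> = (\<Sum>N<r. \<Sum>ps\<in>dynkin_words (N + 1). (dynkin_coeff ps * word_sign (dynkin_word ps)) *\<^sub>R (br x ^^ N) v)"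
    by (intro sum.cong refl) (simp add: word_lin_eq[OF br alt] length_dynkin_word dynkin_words_def)
  also have "\<dots> = (\<Sum>N<r. left_trans_coeff N *\<^sub>R (br x ^^ N) v)"
    unfolding scaleR_sum_left[symmetric] sum_dynkin_coeff ..
  finally show ?thesis .
qed


section \<open>Calculus on manifolds\<close>


lemma chart_open: "is_chart c \<Longrightarrow> open (fst c)" "is_chart c \<Longrightarrow> open (snd c ` fst c)"
  by (simp_all add: is_chart_def)

lemma chart_inv_left: "is_chart c \<Longrightarrow> p \<in> fst c \<Longrightarrow> chart_inv c (snd c p) = p"
  by (simp add: is_chart_def homeomorphism_def)

lemma chart_inv_right: "x \<in> snd c ` fst c \<Longrightarrow> snd c (chart_inv c x) = x"
  by (simp add: f_inv_into_f)

lemma chart_inv_in: "x \<in> snd c ` fst c \<Longrightarrow> chart_inv c x \<in> fst c"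
  by (simp add: inv_into_into)

lemma chart_image_open:
  assumes "is_chart c" "open V" "V \<subseteq> fst c"
  shows "open (snd c ` V)"
proof -
  have h: "homeomorphism (fst c) (snd c ` fst c) (snd c) (chart_inv c)" using assms by (simp add: is_chart_def)
  have "openin (top_of_set (fst c)) V" using assms chart_open(1)[OF assms(1)] by (simp add: openin_open_eq)
  from homeomorphism_imp_open_map[OF h this] show ?thesis
    using chart_open(2)[OF assms(1)] openin_open_trans by blast
qed

lemma chart_continuous: "is_chart c \<Longrightarrow> continuous_on (fst c) (snd c)"
  "is_chart c \<Longrightarrow> continuous_on (snd c ` fst c) (chart_inv c)"
  by (simp_all add: is_chart_def homeomorphism_def)

lemma chart_preimage_open:
  assumes "is_chart c" "open W"
  shows "open {q \<in> fst c. snd c q \<in> W}"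
  using continuous_open_preimage[OF chart_continuous(1) chart_open(1) assms(2)] assms(1)
  by (simp add: vimage_def Int_def)

lemma smooth_chartD: "smooth_chart A c \<Longrightarrow> is_chart c"
  by (simp add: smooth_chart_def)

lemma smooth_manifold_chart: "smooth_manifold A \<Longrightarrow> c \<in> A \<Longrightarrow> smooth_chart A c"
  by (simp add: smooth_manifold_def smooth_chart_def)

lemma smooth_manifold_chart_at:
  assumes "smooth_manifold A"
  obtains d where "d \<in> A" "smooth_chart A d" "p \<in> fst d"
proof -
  have "p \<in> (\<Union>c\<in>A. fst c)" using assms by (simp add: smooth_manifold_def)
  then show ?thesis using that smooth_manifold_chart[OF assms] by blast
qed

text \<open>Compatibility transports smoothness through transition maps, so one chart suffices as a
  test. That chart may lie outside the atlas, as canonical coordinates do in general.\<close>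

lemma smooth_near_chart_iff:
  assumes A: "smooth_manifold A" and c: "smooth_chart A c" and p: "p \<in> fst c"
  shows "smooth_near A p f \<longleftrightarrow>
    (\<exists>W. open W \<and> snd c p \<in> W \<and> W \<subseteq> snd c ` fst c \<and> smooth_on W (\<lambda>x. f (chart_inv c x)))"
proof
  assume "smooth_near A p f"
  then obtain U where U: "open U" "p \<in> U" "smooth_fun_on A U f" by (auto simp: smooth_near_def)
  obtain d where d: "d \<in> A" "smooth_chart A d" "p \<in> fst d" using smooth_manifold_chart_at[OF A] .
  note ic = smooth_chartD[OF c] and id = smooth_chartD[OF d(2)]
  define W where "W = snd c ` (U \<inter> fst d \<inter> fst c)"
  have W: "open W" unfolding W_def
    by (rule chart_image_open[OF ic]) (use U chart_open[OF ic] chart_open[OF id] in auto)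
  have T: "open (snd d ` (U \<inter> fst d))"
    by (rule chart_image_open[OF id]) (use U chart_open[OF id] in auto)
  have "smooth_on (snd c ` (fst c \<inter> fst d)) (snd d \<circ> chart_inv c)"
    using c d(1) by (simp add: smooth_chart_def compatible_def)
  then have s1: "smooth_on W (\<lambda>x. snd d (chart_inv c x))"
    using smooth_on_subset[of "snd c ` (fst c \<inter> fst d)" "snd d \<circ> chart_inv c" W] by (auto simp: W_def comp_def)
  have s2: "smooth_on (snd d ` (U \<inter> fst d)) (\<lambda>x. f (chart_inv d x))"
    using U(3) d(1) by (auto simp: smooth_fun_on_def comp_def)
  have im: "(\<lambda>x. snd d (chart_inv c x)) ` W \<subseteq> snd d ` (U \<inter> fst d)"
    using chart_inv_left[OF ic] by (auto simp: W_def)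
  have "smooth_on W (\<lambda>x. f (chart_inv d (snd d (chart_inv c x))))"
    by (rule smooth_on_compose[OF W T s2 s1 im])
  moreover have "f (chart_inv d (snd d (chart_inv c x))) = f (chart_inv c x)" if "x \<in> W" for x
    using that chart_inv_left[OF ic] chart_inv_left[OF id] by (auto simp: W_def)
  ultimately have "smooth_on W (\<lambda>x. f (chart_inv c x))"
    using smooth_on_cong[OF W, of "\<lambda>x. f (chart_inv d (snd d (chart_inv c x)))" "\<lambda>x. f (chart_inv c x)"] by simp
  then show "\<exists>W. open W \<and> snd c p \<in> W \<and> W \<subseteq> snd c ` fst c \<and> smooth_on W (\<lambda>x. f (chart_inv c x))"
    using W U d p by (intro exI[of _ W]) (auto simp: W_def)
next
  assume "\<exists>W. open W \<and> snd c p \<in> W \<and> W \<subseteq> snd c ` fst c \<and> smooth_on W (\<lambda>x. f (chart_inv c x))"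
  then obtain W where W: "open W" "snd c p \<in> W" "W \<subseteq> snd c ` fst c" "smooth_on W (\<lambda>x. f (chart_inv c x))" by blast
  note ic = smooth_chartD[OF c]
  define U where "U = {q \<in> fst c. snd c q \<in> W}"
  have U: "open U" "p \<in> U" using chart_preimage_open[OF ic W(1)] p W(2) by (auto simp: U_def)
  have "smooth_fun_on A U f"
    unfolding smooth_fun_on_def comp_def
  proof
    fix d assume d: "d \<in> A"
    note id = smooth_chartD[OF smooth_manifold_chart[OF A d]]
    have O: "open (snd d ` (U \<inter> fst d))"
      by (rule chart_image_open[OF id]) (use U chart_open[OF id] in auto)
    have "smooth_on (snd d ` (fst c \<inter> fst d)) (snd c \<circ> chart_inv d)"
      using c d by (simp add: smooth_chart_def compatible_def)
    then have s1: "smooth_on (snd d ` (U \<inter> fst d)) (\<lambda>x. snd c (chart_inv d x))"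
      using smooth_on_subset[of "snd d ` (fst c \<inter> fst d)" "snd c \<circ> chart_inv d" "snd d ` (U \<inter> fst d)"]
      by (auto simp: U_def comp_def)
    have im: "(\<lambda>x. snd c (chart_inv d x)) ` snd d ` (U \<inter> fst d) \<subseteq> W"
      using chart_inv_left[OF id] by (auto simp: U_def)
    have "smooth_on (snd d ` (U \<inter> fst d)) (\<lambda>x. f (chart_inv c (snd c (chart_inv d x))))"
      by (rule smooth_on_compose[OF O W(1) W(4) s1 im])
    moreover have "f (chart_inv c (snd c (chart_inv d x))) = f (chart_inv d x)" if "x \<in> snd d ` (U \<inter> fst d)" for x
      using that chart_inv_left[OF ic] chart_inv_left[OF id] by (auto simp: U_def)
    ultimately show "smooth_on (snd d ` (U \<inter> fst d)) (\<lambda>x. f (chart_inv d x))"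
      using smooth_on_cong[OF O, of "\<lambda>x. f (chart_inv c (snd c (chart_inv d x)))" "\<lambda>x. f (chart_inv d x)"] by simp
  qed
  then show "smooth_near A p f" using U by (auto simp: smooth_near_def)
qed

lemma smooth_near_compose_chart:
  assumes A: "smooth_manifold A" and c: "smooth_chart A c" and p: "p \<in> fst c"
    and G: "open W" "snd c p \<in> W" "smooth_on W G"
  shows "smooth_near A p (\<lambda>q. G (snd c q))"
  unfolding smooth_near_chart_iff[OF A c p]
proof (intro exI[of _ "W \<inter> snd c ` fst c"] conjI)
  show O: "open (W \<inter> snd c ` fst c)" using G chart_open(2)[OF smooth_chartD[OF c]] by auto
  have "smooth_on (W \<inter> snd c ` fst c) G" using G smooth_on_subset by blast
  then show "smooth_on (W \<inter> snd c ` fst c) (\<lambda>x. G (snd c (chart_inv c x)))"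
    using smooth_on_cong[OF O, of "\<lambda>x. G (snd c (chart_inv c x))" G] chart_inv_right[of _ c] by auto
qed (use G p in auto)

lemma smooth_near_coord:
  assumes "smooth_manifold A" "smooth_chart A c" "p \<in> fst c"
  shows "smooth_near A p (\<lambda>q. snd c q $ k)"
  by (rule smooth_near_compose_chart[OF assms open_UNIV]) auto

lemma smooth_near_const: "smooth_manifold A \<Longrightarrow> smooth_near A p (\<lambda>q. a)"
  by (rule smooth_manifold_chart_at[of A p], assumption,
      rule smooth_near_compose_chart[where G = "\<lambda>x. a" and W = UNIV]) auto

lemma smooth_near_binop:
  assumes A: "smooth_manifold A" and f: "smooth_near A p f" and g: "smooth_near A p g"
    and op: "\<And>(W :: (real^'n) set) u v. open W \<Longrightarrow> smooth_on W u \<Longrightarrow> smooth_on W v \<Longrightarrow> smooth_on W (\<lambda>x. op (u x) (v x))"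
  shows "smooth_near (A :: ('m::{t2_space, second_countable_topology}, 'n::finite) chart set) p (\<lambda>q. op (f q) (g q))"
proof -
  obtain d where d: "d \<in> A" "smooth_chart A d" "p \<in> fst d" using smooth_manifold_chart_at[OF A] .
  obtain W V where W: "open W" "snd d p \<in> W" "W \<subseteq> snd d ` fst d" "smooth_on W (\<lambda>x. f (chart_inv d x))"
    and V: "open V" "snd d p \<in> V" "V \<subseteq> snd d ` fst d" "smooth_on V (\<lambda>x. g (chart_inv d x))"
    using f g smooth_near_chart_iff[OF A d(2,3)] by metis
  have "smooth_on (W \<inter> V) (\<lambda>x. op (f (chart_inv d x)) (g (chart_inv d x)))"
    by (rule op) (use W V in \<open>auto intro: smooth_on_subset\<close>)
  then show ?thesis
    unfolding smooth_near_chart_iff[OF A d(2,3)] using W V by (intro exI[of _ "W \<inter> V"]) auto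
qed

lemma smooth_near_add:
  "smooth_manifold A \<Longrightarrow> smooth_near A p f \<Longrightarrow> smooth_near A p g \<Longrightarrow> smooth_near A p (\<lambda>q. f q + g q)"
  by (rule smooth_near_binop) (auto intro: smooth_on_add)

lemma smooth_near_mult:
  "smooth_manifold A \<Longrightarrow> smooth_near A p f \<Longrightarrow> smooth_near A p g \<Longrightarrow> smooth_near A p (\<lambda>q. f q * g q)"
  by (rule smooth_near_binop) (auto intro: smooth_on_mult)

lemma smooth_near_sum:
  assumes "smooth_manifold A" "\<And>i. i \<in> I \<Longrightarrow> smooth_near A p (f i)"
  shows "smooth_near A p (\<lambda>q. \<Sum>i\<in>I. f i q)"
  using assms(2)
  by (induction I rule: infinite_finite_induct)
    (auto intro!: smooth_near_add smooth_near_const assms(1))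

section \<open>Tangent vectors and vector fields in charts\<close>

lemma tangent_add: "D \<in> tangent_space A p \<Longrightarrow> smooth_near A p f \<Longrightarrow> smooth_near A p g \<Longrightarrow>
    D (\<lambda>q. f q + g q) = D f + D g"
  and tangent_mult: "D \<in> tangent_space A p \<Longrightarrow> smooth_near A p f \<Longrightarrow> smooth_near A p g \<Longrightarrow>
    D (\<lambda>q. f q * g q) = f p * D g + g p * D f"
  and tangent_cong: "D \<in> tangent_space A p \<Longrightarrow> smooth_near A p f \<Longrightarrow> \<forall>\<^sub>F q in nhds p. f q = g q \<Longrightarrow> D f = D g"
  and tangent_cmult: "D \<in> tangent_space A p \<Longrightarrow> smooth_near A p f \<Longrightarrow> D (\<lambda>q. a * f q) = a * D f"
  and tangent_nonsmooth: "D \<in> tangent_space A p \<Longrightarrow> \<not> smooth_near A p f \<Longrightarrow> D f = 0"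
  by (auto simp: tangent_space_def)

lemma tangent_const:
  assumes "smooth_manifold A" "D \<in> tangent_space A p"
  shows "D (\<lambda>q. a) = 0"
proof -
  have "D (\<lambda>q. 1 * 1) = 1 * D (\<lambda>q. 1) + 1 * D (\<lambda>q. 1)"
    using tangent_mult[OF assms(2) smooth_near_const[OF assms(1)] smooth_near_const[OF assms(1)], of 1 1] by simp
  then have "D (\<lambda>q. 1) = 0" by simp
  then show ?thesis using tangent_cmult[OF assms(2) smooth_near_const[OF assms(1)], of a 1] by simp
qed

lemma tangent_sum:
  assumes "smooth_manifold A" "D \<in> tangent_space A p" "\<And>i. i \<in> I \<Longrightarrow> smooth_near A p (f i)"
  shows "D (\<lambda>q. \<Sum>i\<in>I. f i q) = (\<Sum>i\<in>I. D (f i))"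
  using assms(3)
proof (induction I rule: infinite_finite_induct)
  case (insert i I)
  then show ?case
    using tangent_add[OF assms(2), of "f i" "\<lambda>q. \<Sum>i\<in>I. f i q"] smooth_near_sum[OF assms(1), of I p f] by simp
qed (auto simp: tangent_const[OF assms(1,2)])

lemma radial_int_sum_cmult:
  fixes f :: "'i \<Rightarrow> 'a::euclidean_space \<Rightarrow> real"
  assumes "star0 S" "\<And>i. i \<in> I \<Longrightarrow> continuous_on S (f i)" "x \<in> S"
  shows "radial_int m (\<lambda>y. \<Sum>i\<in>I. c i * f i y) x = (\<Sum>i\<in>I. c i * radial_int m (f i) x)"
proof -
  have "radial_int m (\<lambda>y. c i * f i y) x = c i * radial_int m (f i) x" for i
    unfolding radial_int_def integral_mult_right[symmetric] by (rule arg_cong[where f = "integral {0..1}"]) auto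
  moreover have "radial_int m (\<lambda>y. \<Sum>i\<in>I. c i * f i y) x = (\<Sum>i\<in>I. radial_int m (\<lambda>y. c i * f i y) x)"
    using assms(2)
  proof (induction I rule: infinite_finite_induct)
    case (insert i I)
    then show ?case
      using radial_int_add[OF assms(1) _ _ assms(3), of "\<lambda>y. c i * f i y" "\<lambda>y. \<Sum>i\<in>I. c i * f i y" m]
      by (simp add: continuous_intros)
  qed (simp_all add: radial_int_def)
  ultimately show ?thesis by simp
qed

text \<open>Hadamard's lemma: a tangent vector is determined by its values on the coordinates.\<close>

lemma tangent_chart:
  assumes A: "smooth_manifold A" and c: "smooth_chart A c" and p: "p \<in> fst c"
    and D: "D \<in> tangent_space A p" and f: "smooth_near A p f"
  shows "D f = (\<Sum>k\<in>UNIV. D (\<lambda>q. snd c q $ k) * dir_deriv (axis k 1) (\<lambda>x. f (chart_inv c x)) (snd c p))"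
proof -
  note ic = smooth_chartD[OF c]
  define F where "F x = f (chart_inv c x)" for x
  define x0 where "x0 = snd c p"
  obtain W where W: "open W" "x0 \<in> W" "W \<subseteq> snd c ` fst c" "smooth_on W F"
    using f unfolding smooth_near_chart_iff[OF A c p] F_def[abs_def] x0_def by blast
  obtain e where e: "e > 0" "ball x0 e \<subseteq> W" using W open_contains_ball by blast
  define Fs where "Fs z = F (x0 + z)" for z
  have tr: "smooth_on S (\<lambda>z. x0 + z)" if "open S" for S
    unfolding smooth_on_vec_iff[OF that] using that by (auto intro: smooth_on_add)
  have tr': "smooth_on S (\<lambda>z. z - x0)" if "open S" for S
    unfolding smooth_on_vec_iff[OF that] using that by (auto intro: smooth_on_diff)
  have Fs: "smooth_on (ball 0 e) Fs"
    unfolding Fs_def by (rule smooth_on_compose[OF _ W(1,4) tr]) (use e in \<open>auto simp: dist_norm\<close>)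
  \<comment> \<open>Hadamard's coefficients: near \<open>x0\<close>, \<open>F y\<close> is
    \<open>F x0\<close> plus the sum of \<open>(y $ k - x0 $ k) * g k y\<close>, and
    \<open>g k x0\<close> is the partial derivative of \<open>F\<close>. Applied to this expression
    the product rule leaves only values on coordinates.\<close>
  define g where "g k y = radial_int 0 (dir_deriv (axis k 1) Fs) (y - x0)" for k y
  have g: "smooth_on (ball x0 e) (g k)" for k
    unfolding g_def
    by (rule smooth_on_compose[OF _ open_ball smooth_on_radial_int[OF open_ball star0_ball smooth_on_dir_deriv[OF Fs]] tr'])
      (auto simp: dist_norm norm_minus_commute)
  have g0: "g k x0 = dir_deriv (axis k 1) F x0" for k
  proof -
    have "dir_deriv (axis k 1) Fs 0 = dir_deriv (axis k 1) F (x0 + 0)"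
      unfolding Fs_def
    proof (rule has_derivative_dir_deriv)
      have "(F has_derivative (\<lambda>v. dir_deriv v F (x0 + 0))) (at (x0 + 0))"
        using smooth_on_has_derivative[OF W(4), of x0] W(2) by simp
      moreover have "((\<lambda>z. x0 + z) has_derivative (\<lambda>v. v)) (at 0)" by (auto intro!: derivative_eq_intros)
      ultimately show "((\<lambda>z. F (x0 + z)) has_derivative (\<lambda>v. dir_deriv v F (x0 + 0))) (at 0)"
        using has_derivative_compose[of "\<lambda>z. x0 + z" "\<lambda>v. v" 0 UNIV F] by auto
    qed
    then show ?thesis by (simp add: g_def radial_int_def)
  qed
  have had: "F y = F x0 + (\<Sum>k\<in>UNIV. (y $ k + - x0 $ k) * g k y)" if y: "y \<in> ball x0 e" for y
  proof -
    have z: "y - x0 \<in> ball 0 e" using y by (simp add: dist_norm norm_minus_commute)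
    have "Fs (y - x0) = Fs 0 + radial_int 0 (\<lambda>u. dir_deriv (y - x0) Fs u) (y - x0)"
      by (rule radial_int_hadamard[OF star0_ball smooth_on_Ck[OF Fs] z])
    also have "radial_int 0 (\<lambda>u. dir_deriv (y - x0) Fs u) (y - x0) =
        radial_int 0 (\<lambda>u. \<Sum>k\<in>UNIV. (y - x0) $ k * dir_deriv (axis k 1) Fs u) (y - x0)"
    proof (rule radial_int_cong[OF star0_ball z])
      fix u :: "real^'b" assume "u \<in> ball 0 e"
      from dir_deriv_expand[OF smooth_on_differentiable[OF Fs this], of "y - x0"]
      show "dir_deriv (y - x0) Fs u = (\<Sum>k\<in>UNIV. (y - x0) $ k * dir_deriv (axis k 1) Fs u)"
        unfolding real_scaleR_def .
    qed
    also have "\<dots> = (\<Sum>k\<in>UNIV. (y - x0) $ k * radial_int 0 (dir_deriv (axis k 1) Fs) (y - x0))"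
      by (rule radial_int_sum_cmult[OF star0_ball smooth_on_continuous[OF smooth_on_dir_deriv[OF Fs]] z])
    finally show ?thesis by (simp add: Fs_def g_def)
  qed
  define N where "N = {q \<in> fst c. snd c q \<in> ball x0 e}"
  have N: "open N" "p \<in> N" using chart_preimage_open[OF ic, of "ball x0 e"] p e by (auto simp: N_def x0_def)
  define f' where "f' q = f p + (\<Sum>k\<in>UNIV. (snd c q $ k + - x0 $ k) * g k (snd c q))" for q
  have "f q = f' q" if "q \<in> N" for q
    using had[of "snd c q"] that chart_inv_left[OF ic] p by (simp add: f'_def F_def N_def x0_def)
  then have "\<forall>\<^sub>F q in nhds p. f q = f' q" using N eventually_nhds by blast
  then have "D f = D f'" by (rule tangent_cong[OF D f])
  have sg: "smooth_near A p (\<lambda>q. g k (snd c q))" for k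
    by (rule smooth_near_compose_chart[OF A c p open_ball _ g]) (use e in \<open>simp add: x0_def\<close>)
  have sc: "smooth_near A p (\<lambda>q. snd c q $ k + - x0 $ k)" for k
    by (intro smooth_near_add smooth_near_coord smooth_near_const A c p)
  have "D f' = D (\<lambda>q. f p) + (\<Sum>k\<in>UNIV. D (\<lambda>q. (snd c q $ k + - x0 $ k) * g k (snd c q)))"
    unfolding f'_def
    by (subst tangent_add[OF D], (intro smooth_near_const smooth_near_sum smooth_near_mult A sc sg)+)
      (subst tangent_sum[OF A D], intro smooth_near_mult A sc sg, simp)
  also have "\<dots> = (\<Sum>k\<in>UNIV. D (\<lambda>q. snd c q $ k) * g k x0)"
  proof -
    have "D (\<lambda>q. (snd c q $ k + - x0 $ k) * g k (snd c q)) = D (\<lambda>q. snd c q $ k) * g k x0" for k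
      using tangent_mult[OF D sc sg, of k k] tangent_const[OF A D]
        tangent_add[OF D smooth_near_coord[OF A c p] smooth_near_const[OF A], of k "- x0 $ k"]
      by (simp add: x0_def)
    then show ?thesis by (simp add: tangent_const[OF A D])
  qed
  finally have "D f = (\<Sum>k\<in>UNIV. D (\<lambda>q. snd c q $ k) * dir_deriv (axis k 1) F x0)"
    using \<open>D f = D f'\<close> by (simp only: g0)
  then show ?thesis by (simp only: F_def[abs_def] x0_def)
qed

lemma smooth_near_app:
  assumes A: "smooth_manifold A" and X: "smooth_vfield A U X" and U: "open U" "p \<in> U" and f: "smooth_near A p f"
  shows "smooth_near A p (app X f)"
proof -
  obtain d where d: "d \<in> A" "smooth_chart A d" "p \<in> fst d" using smooth_manifold_chart_at[OF A] .
  note id = smooth_chartD[OF d(2)]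
  obtain W where W: "open W" "snd d p \<in> W" "W \<subseteq> snd d ` fst d" "smooth_on W (\<lambda>x. f (chart_inv d x))"
    using f unfolding smooth_near_chart_iff[OF A d(2,3)] by blast
  define V where "V = snd d ` (U \<inter> fst d)"
  have V: "open V" unfolding V_def by (rule chart_image_open[OF id]) (use U chart_open[OF id] in auto)
  have h: "smooth_on V (\<lambda>x. X (chart_inv d x) (\<lambda>q. snd d q $ k))" for k
  proof -
    have "smooth_on (snd d ` (U \<inter> fst d \<inter> fst d)) ((\<lambda>p. X p (\<lambda>q. snd d q $ k)) \<circ> chart_inv d)"
      using X d(1) unfolding smooth_vfield_def smooth_fun_on_def by blast
    then show ?thesis by (simp add: V_def comp_def Int_assoc)
  qed
  have WV: "open (W \<inter> V)" using W V by auto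
  have "smooth_on (W \<inter> V) (\<lambda>x. \<Sum>k\<in>UNIV. X (chart_inv d x) (\<lambda>q. snd d q $ k) * dir_deriv (axis k 1) (\<lambda>x. f (chart_inv d x)) x)"
    by (intro smooth_on_sum smooth_on_mult WV smooth_on_subset[OF h] smooth_on_subset[OF smooth_on_dir_deriv[OF W(4)]]) auto
  moreover have "app X f (chart_inv d x) = (\<Sum>k\<in>UNIV. X (chart_inv d x) (\<lambda>q. snd d q $ k) * dir_deriv (axis k 1) (\<lambda>x. f (chart_inv d x)) x)"
    if x: "x \<in> W \<inter> V" for x
  proof -
    have q: "chart_inv d x \<in> fst d" "snd d (chart_inv d x) = x" "chart_inv d x \<in> U"
      using x W chart_inv_left[OF id] by (auto simp: V_def)
    have "smooth_near A (chart_inv d x) f"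
      unfolding smooth_near_chart_iff[OF A d(2) q(1)] q(2) using W x by blast
    then show ?thesis using tangent_chart[OF A d(2) q(1), of "X (chart_inv d x)" f] X q
      by (simp add: smooth_vfield_def app_def)
  qed
  ultimately have "smooth_on (W \<inter> V) (\<lambda>x. app X f (chart_inv d x))"
    using smooth_on_cong[OF WV, of "\<lambda>x. app X f (chart_inv d x)"] by simp
  then show ?thesis unfolding smooth_near_chart_iff[OF A d(2,3)]
    using W WV U d(3) by (intro exI[of _ "W \<inter> V"]) (auto simp: V_def)
qed

lemma coord_field_nth: "coord_field c X x $ k = app X (\<lambda>q. snd c q $ k) (chart_inv c x)"
  by (simp add: coord_field_def app_def)

lemma smooth_coord_field:
  assumes A: "smooth_manifold A" and X: "smooth_vfield A U X" and U: "open U" and c: "smooth_chart A c"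
  shows "smooth_on (snd c ` (U \<inter> fst c)) (coord_field c X)"
proof -
  note ic = smooth_chartD[OF c]
  have O: "open (snd c ` (U \<inter> fst c))"
    by (rule chart_image_open[OF ic]) (use U chart_open[OF ic] in auto)
  have "smooth_on (snd c ` (U \<inter> fst c)) (\<lambda>x. coord_field c X x $ k)" for k
  proof (rule smooth_on_locally)
    fix x assume "x \<in> snd c ` (U \<inter> fst c)"
    then obtain p where p: "p \<in> U" "p \<in> fst c" "x = snd c p" by auto
    have "smooth_near A p (app X (\<lambda>q. snd c q $ k))"
      by (rule smooth_near_app[OF A X U p(1) smooth_near_coord[OF A c p(2)]])
    then show "\<exists>T. open T \<and> x \<in> T \<and> smooth_on T (\<lambda>x. coord_field c X x $ k)"
      unfolding smooth_near_chart_iff[OF A c p(2)] coord_field_nth p(3) by blast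
  qed
  then show ?thesis using smooth_on_vec_iff[OF O] by blast
qed

section \<open>Uniqueness of integral curves\<close>

lemma smooth_locally_lipschitz:
  fixes V :: "real^'n \<Rightarrow> real^'n"
  assumes "open W" "smooth_on W V" "x0 \<in> W"
  obtains e L where "e > 0" "cball x0 e \<subseteq> W" "L > 0"
    "\<And>y z. y \<in> cball x0 e \<Longrightarrow> z \<in> cball x0 e \<Longrightarrow> norm (V y - V z) \<le> L * norm (y - z)"
proof -
  obtain e where e: "e > 0" "cball x0 e \<subseteq> W" using assms open_contains_cball by blast
  have Vk: "smooth_on W (\<lambda>x. V x $ k)" for k using assms smooth_on_vec_iff by blast
  have "continuous_on (cball x0 e) (dir_deriv (axis l 1) (\<lambda>x. V x $ k))" for k l
    using smooth_on_continuous[OF smooth_on_dir_deriv[OF Vk]] e continuous_on_subset by blast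
  then obtain B where B: "B > 0" "\<And>p x. x \<in> cball x0 e \<Longrightarrow> \<bar>dir_deriv (axis (snd p) 1) (\<lambda>x. V x $ (fst p)) x\<bar> \<le> B"
    using compact_bound_family[of "cball x0 e" "\<lambda>p. dir_deriv (axis (snd p) 1) (\<lambda>x. V x $ (fst p))", OF compact_cball] by blast
  define N where "N = real CARD('n)"
  have N: "N > 0" by (simp add: N_def)
  have "norm (V y - V z) \<le> N * (N * B) * norm (y - z)" if y: "y \<in> cball x0 e" and z: "z \<in> cball x0 e" for y z
  proof -
    have k: "\<bar>(V y - V z) $ k\<bar> \<le> N * B * norm (y - z)" for k
    proof -
      have "\<bar>V y $ k - V z $ k\<bar> \<le> (\<Sum>l\<in>UNIV. B * \<bar>y $ l - z $ l\<bar>)"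
        by (rule mean_value_partials[OF convex_cball smooth_on_differentiable[OF Vk] y z])
          (use e B(2)[of _ "(k, _)"] in auto)
      also have "\<dots> \<le> (\<Sum>l\<in>(UNIV::'n set). B * norm (y - z))"
        by (intro sum_mono mult_left_mono) (use B component_le_norm_cart[of "y - z"] in auto)
      finally show ?thesis by (simp add: N_def mult.assoc)
    qed
    have "norm (V y - V z) \<le> (\<Sum>k\<in>(UNIV::'n set). N * B * norm (y - z))"
      by (rule order_trans[OF norm_le_l1_cart sum_mono]) (rule k)
    then show ?thesis by (simp add: N_def mult.assoc)
  qed
  then show ?thesis using e B(1) N by (intro that[of e "N * (N * B)"]) auto
qed

lemma has_vector_derivative_vec:
  fixes y :: "real \<Rightarrow> real^'n"
  assumes "\<And>k. ((\<lambda>t. y t $ k) has_real_derivative v $ k) (at t within S)"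
  shows "(y has_vector_derivative v) (at t within S)"
  unfolding has_vector_derivative_def
  by (subst has_derivative_componentwise_within)
    (use assms in \<open>auto simp: Basis_vec_def inner_axis has_field_derivative_def mult.commute[of _ "v $ _"] intro!: has_derivative_eq_rhs[OF assms[unfolded has_field_derivative_def]]\<close>)

definition integral_curve :: "('m::topological_space, 'n::finite) chart set \<Rightarrow> 'm set \<Rightarrow> 'm vfield \<Rightarrow> (real \<Rightarrow> 'm) \<Rightarrow> bool" where
  "integral_curve A U Y \<gamma> \<longleftrightarrow> continuous_on {0..1} \<gamma> \<and> \<gamma> ` {0..1} \<subseteq> U \<and>
     (\<forall>t\<in>{0..1}. \<forall>f. smooth_near A (\<gamma> t) f \<longrightarrow>
        ((f \<circ> \<gamma>) has_real_derivative Y (\<gamma> t) f) (at t within {0..1}))"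

text \<open>In a chart the derivative of the difference \<open>z\<close> of the curves is bounded by
  \<open>L * norm (z t)\<close>. On an interval of radius \<delta> with
  \<open>L * \<delta> \<le> 1 / 2\<close> the maximal norm of \<open>z\<close> is at most half of
  itself, hence zero.\<close>

lemma integral_curves_locally_equal:
  assumes A: "smooth_manifold A" and U: "open U"
    and Y: "\<And>c. c \<in> A \<Longrightarrow> smooth_on (snd c ` (U \<inter> fst c)) (coord_field c Y)"
    and \<gamma>: "integral_curve A U Y \<gamma>1" "integral_curve A U Y \<gamma>2"
    and t0: "t0 \<in> {0..1}" "\<gamma>1 t0 = \<gamma>2 t0"
  shows "\<exists>\<delta>>0. \<forall>t\<in>{0..1}. \<bar>t - t0\<bar> < \<delta> \<longrightarrow> \<gamma>1 t = \<gamma>2 t"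
proof -
  obtain c where c: "c \<in> A" "smooth_chart A c" "\<gamma>1 t0 \<in> fst c" using smooth_manifold_chart_at[OF A] .
  note ic = smooth_chartD[OF c(2)]
  define x0 where "x0 = snd c (\<gamma>1 t0)"
  define W where "W = snd c ` (U \<inter> fst c)"
  have W: "open W" unfolding W_def by (rule chart_image_open[OF ic]) (use U chart_open[OF ic] in auto)
  have gU: "\<gamma>1 t \<in> U" "\<gamma>2 t \<in> U" if "t \<in> {0..1}" for t using \<gamma> that by (auto simp: integral_curve_def)
  have x0: "x0 \<in> W" using gU(1)[OF t0(1)] c(3) by (auto simp: W_def x0_def)
  define V where "V = coord_field c Y"
  obtain e L where e: "e > 0" "cball x0 e \<subseteq> W" "L > 0"
    "\<And>y z. y \<in> cball x0 e \<Longrightarrow> z \<in> cball x0 e \<Longrightarrow> norm (V y - V z) \<le> L * norm (y - z)"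
    using smooth_locally_lipschitz[OF W Y[OF c(1), folded W_def V_def] x0] by metis
  define N where "N = {q \<in> fst c. snd c q \<in> ball x0 e}"
  have N: "open N" "\<gamma>1 t0 \<in> N" using chart_preimage_open[OF ic, of "ball x0 e"] c(3) e by (auto simp: N_def x0_def)
  have near: "\<exists>d>0. \<forall>t\<in>{0..1}. \<bar>t - t0\<bar> < d \<longrightarrow> \<gamma> t \<in> N" if "integral_curve A U Y \<gamma>" "\<gamma> t0 \<in> N" for \<gamma>
  proof -
    have "continuous (at t0 within {0..1}) \<gamma>" using that t0 by (auto simp: integral_curve_def continuous_on_eq_continuous_within)
    then have "\<forall>\<^sub>F t in at t0 within {0..1}. \<gamma> t \<in> N"
      using N that by (auto simp: continuous_within tendsto_def)
    then show ?thesis using that(2) unfolding eventually_at dist_real_def by (metis abs_zero diff_self)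
  qed
  obtain d1 where d1: "d1 > 0" "\<And>t. t \<in> {0..1} \<Longrightarrow> \<bar>t - t0\<bar> < d1 \<Longrightarrow> \<gamma>1 t \<in> N" using near[OF \<gamma>(1)] N by blast
  obtain d2 where d2: "d2 > 0" "\<And>t. t \<in> {0..1} \<Longrightarrow> \<bar>t - t0\<bar> < d2 \<Longrightarrow> \<gamma>2 t \<in> N" using near[OF \<gamma>(2)] N t0 by auto
  \<comment> \<open>Halving \<open>min d1 d2\<close> keeps the closed interval \<open>J\<close>
    strictly within the range where both curves stay in \<open>N\<close>.\<close>
  define \<delta> where "\<delta> = min (min d1 d2 / 2) (1 / (2 * L))"
  have \<delta>: "\<delta> > 0" using d1 d2 e by (simp add: \<delta>_def)
  have L\<delta>: "L * \<delta> \<le> 1 / 2"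
  proof -
    have "L * \<delta> \<le> L * (1 / (2 * L))" using e by (intro mult_left_mono) (auto simp: \<delta>_def)
    then show ?thesis using e by simp
  qed
  define J where "J = {max 0 (t0 - \<delta>)..min 1 (t0 + \<delta>)}"
  have J: "J \<subseteq> {0..1}" "t0 \<in> J" "compact J" "convex J" using t0 \<delta> by (auto simp: J_def)
  have JN: "\<gamma>1 t \<in> N" "\<gamma>2 t \<in> N" if "t \<in> J" for t
  proof -
    have "\<bar>t - t0\<bar> \<le> \<delta>" "t \<in> {0..1}" using that J by (auto simp: J_def)
    moreover have "\<delta> < d1" "\<delta> < d2" using d1 d2 by (auto simp: \<delta>_def min_def)
    ultimately show "\<gamma>1 t \<in> N" "\<gamma>2 t \<in> N" using d1(2) d2(2) by auto
  qed
  define z where "z t = snd c (\<gamma>1 t) - snd c (\<gamma>2 t)" for t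
  have deriv: "((\<lambda>t. snd c (\<gamma> t)) has_vector_derivative V (snd c (\<gamma> t))) (at t within J)"
    if "integral_curve A U Y \<gamma>" "t \<in> J" "\<gamma> t \<in> N" for \<gamma> t
  proof (rule has_vector_derivative_vec)
    fix k
    have g: "\<gamma> t \<in> fst c" using that by (simp add: N_def)
    have "(((\<lambda>q. snd c q $ k) \<circ> \<gamma>) has_real_derivative Y (\<gamma> t) (\<lambda>q. snd c q $ k)) (at t within {0..1})"
      using that J smooth_near_coord[OF A c(2) g] by (auto simp: integral_curve_def)
    then show "((\<lambda>t. snd c (\<gamma> t) $ k) has_real_derivative V (snd c (\<gamma> t)) $ k) (at t within J)"
      using DERIV_subset[OF _ J(1)] chart_inv_left[OF ic g] by (auto simp: V_def coord_field_def comp_def)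
  qed
  have zd: "(z has_vector_derivative V (snd c (\<gamma>1 t)) - V (snd c (\<gamma>2 t))) (at t within J)" if "t \<in> J" for t
    unfolding z_def by (intro has_vector_derivative_diff deriv \<gamma> that JN)
  have "continuous_on J (\<lambda>t. norm (z t))"
    using has_vector_derivative_continuous[OF zd]
    by (intro continuous_on_norm) (auto simp: continuous_on_eq_continuous_within)
  then obtain tm where tm: "tm \<in> J" "\<And>t. t \<in> J \<Longrightarrow> norm (z t) \<le> norm (z tm)"
    using continuous_attains_sup[of J "\<lambda>t. norm (z t)"] J by blast
  have "norm (z tm - z t0) \<le> (L * norm (z tm)) * norm (tm - t0)"
  proof (rule differentiable_bound[OF J(4)])
    fix t assume t: "t \<in> J"
    show "(z has_derivative (\<lambda>h. h *\<^sub>R (V (snd c (\<gamma>1 t)) - V (snd c (\<gamma>2 t))))) (at t within J)"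
      using zd[OF t] by (simp add: has_vector_derivative_def)
    have "norm (V (snd c (\<gamma>1 t)) - V (snd c (\<gamma>2 t))) \<le> L * norm (z t)"
      unfolding z_def by (rule e(4)) (use JN[OF t] in \<open>auto simp: N_def\<close>)
    also have "\<dots> \<le> L * norm (z tm)" using tm(2)[OF t] e by simp
    finally show "onorm (\<lambda>h. h *\<^sub>R (V (snd c (\<gamma>1 t)) - V (snd c (\<gamma>2 t)))) \<le> L * norm (z tm)"
      by (intro onorm_le) (simp add: mult.commute mult_left_mono)
  qed (use tm J in auto)
  also have "z t0 = 0" using t0 by (simp add: z_def)
  also have "(L * norm (z tm)) * norm (tm - t0) \<le> (L * norm (z tm)) * \<delta>"
    using tm(1) e by (intro mult_left_mono) (auto simp: J_def)
  also have "\<dots> = (L * \<delta>) * norm (z tm)" by simp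
  also have "\<dots> \<le> 1 / 2 * norm (z tm)" using L\<delta> by (intro mult_right_mono) auto
  finally have "norm (z tm) = 0" by simp
  then have z0: "z t = 0" if "t \<in> J" for t using tm(2)[OF that] by simp
  show ?thesis
  proof (intro exI[of _ \<delta>] conjI ballI impI \<delta>)
    fix t assume "t \<in> {0..1}" "\<bar>t - t0\<bar> < \<delta>"
    then have t: "t \<in> J" by (auto simp: J_def)
    have "snd c (\<gamma>1 t) = snd c (\<gamma>2 t)" using z0[OF t] by (simp add: z_def)
    then show "\<gamma>1 t = \<gamma>2 t"
      using JN[OF t] chart_inv_left[OF ic] by (metis (no_types, lifting) N_def mem_Collect_eq)
  qed
qed

text \<open>The set of times at which the curves agree contains 0, is closed because the manifold is
  Hausdorff, and is open by the local result; the interval is connected.\<close>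

lemma integral_curves_equal:
  assumes A: "smooth_manifold A" and U: "open U"
    and Y: "\<And>c. c \<in> A \<Longrightarrow> smooth_on (snd c ` (U \<inter> fst c)) (coord_field c Y)"
    and \<gamma>: "integral_curve A U Y \<gamma>1" "integral_curve A U Y \<gamma>2" "\<gamma>1 0 = \<gamma>2 0"
    and t: "t \<in> {0..1}"
  shows "\<gamma>1 t = \<gamma>2 t"
proof -
  let ?E = "{0..1} \<inter> (\<lambda>t. (\<gamma>1 t, \<gamma>2 t)) -` {y. \<exists>x. y = (x, x)}"
  have "continuous_on {0..1} (\<lambda>t. (\<gamma>1 t, \<gamma>2 t))"
    using \<gamma> by (intro continuous_on_Pair) (auto simp: integral_curve_def)
  then have "closed ?E" by (intro continuous_closed_preimage closed_diagonal) auto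
  then have cl: "closedin (top_of_set {0..1}) ?E" by (intro closed_subset) auto
  have op: "openin (top_of_set {0..1}) ?E"
    unfolding openin_euclidean_subtopology_iff
  proof (intro conjI ballI)
    fix t0 assume "t0 \<in> ?E"
    then obtain \<delta> where "\<delta> > 0" "\<forall>t\<in>{0..1}. \<bar>t - t0\<bar> < \<delta> \<longrightarrow> \<gamma>1 t = \<gamma>2 t"
      using integral_curves_locally_equal[OF A U Y \<gamma>(1,2), of t0] by auto
    then show "\<exists>e>0. \<forall>t\<in>{0..1}. dist t t0 < e \<longrightarrow> t \<in> ?E"
      by (intro exI[of _ \<delta>]) (auto simp: dist_real_def)
  qed auto
  have "0 \<in> ?E" using \<gamma>(3) by auto
  moreover have "connected {0..1::real}" by simp
  ultimately have "?E = {0..1}" using op cl unfolding connected_clopen by blast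
  then have "t \<in> ?E" using t by blast
  then show ?thesis by simp
qed


section \<open>Frames of Carnot manifolds\<close>


definition coords :: "('m, 'n::finite) chart \<Rightarrow> 'm tvec \<Rightarrow> real^'n" where
  "coords c D = (\<chi> k. D (\<lambda>q. snd c q $ k))"

lemma coords_lincomb: "coords c (lincomb I a Y) = (\<Sum>i\<in>I. a i *\<^sub>R coords c (Y i))"
  by (simp add: coords_def lincomb_def vec_eq_iff)

lemma lincomb_chart:
  assumes A: "smooth_manifold A" and c: "smooth_chart A c" and p: "p \<in> fst c"
    and Y: "\<And>i. i \<in> I \<Longrightarrow> Y i \<in> tangent_space A p" and f: "smooth_near A p f"
  shows "lincomb I a Y f = (\<Sum>k\<in>UNIV. coords c (lincomb I a Y) $ k * dir_deriv (axis k 1) (\<lambda>x. f (chart_inv c x)) (snd c p))"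
proof -
  have "lincomb I a Y f = (\<Sum>i\<in>I. a i * (\<Sum>k\<in>UNIV. coords c (Y i) $ k * dir_deriv (axis k 1) (\<lambda>x. f (chart_inv c x)) (snd c p)))"
    unfolding lincomb_def
    by (rule sum.cong) (use tangent_chart[OF A c p Y f] in \<open>auto simp: coords_def\<close>)
  also have "\<dots> = (\<Sum>k\<in>UNIV. \<Sum>i\<in>I. a i * (coords c (Y i) $ k * dir_deriv (axis k 1) (\<lambda>x. f (chart_inv c x)) (snd c p)))"
    unfolding sum_distrib_left by (rule sum.swap)
  finally show ?thesis by (simp add: coords_lincomb sum_distrib_right mult.assoc)
qed

text \<open>On smooth functions tangent vectors are determined by their coordinates, and on all
  other functions they are 0 by convention.\<close>

lemma lincomb_eqI:
  assumes A: "smooth_manifold A" and c: "smooth_chart A c" and p: "p \<in> fst c"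
    and Y: "\<And>i. i \<in> I \<Longrightarrow> Y i \<in> tangent_space A p" and Z: "\<And>i. i \<in> J \<Longrightarrow> Z i \<in> tangent_space A p"
    and eq: "coords c (lincomb I a Y) = coords c (lincomb J b Z)"
  shows "lincomb I a Y = lincomb J b Z"
proof
  fix f
  show "lincomb I a Y f = lincomb J b Z f"
  proof (cases "smooth_near A p f")
    case True
    then show ?thesis
      using lincomb_chart[OF A c p Y True, where a = a] lincomb_chart[OF A c p Z True, where a = b] eq by simp
  next
    case False
    then show ?thesis using tangent_nonsmooth[OF Y False] tangent_nonsmooth[OF Z False] by (simp add: lincomb_def)
  qed
qed

lemma lincomb_singleton: "lincomb {i} (\<lambda>_. 1) (\<lambda>_. D) = D"
  by (simp add: lincomb_def)

text \<open>Passing from tangent vectors, which are functionals, to their coordinates makes the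
  dimension theory of Euclidean space applicable to fibres of subbundles.\<close>

lemma coords_basis_of:
  assumes A: "smooth_manifold A" and c: "smooth_chart A c" and p: "p \<in> fst c"
    and I: "finite I" and Y: "\<And>i. i \<in> I \<Longrightarrow> Y i \<in> tangent_space A p" and bas: "basis_of I Y E"
  shows "coords c ` E = span ((\<lambda>i. coords c (Y i)) ` I)" "inj_on (\<lambda>i. coords c (Y i)) I"
    "independent ((\<lambda>i. coords c (Y i)) ` I)" "dim (coords c ` E) = card I"
proof -
  let ?y = "\<lambda>i. coords c (Y i)"
  have uniq: "\<forall>i\<in>I. a i = b i" if "(\<Sum>i\<in>I. a i *\<^sub>R ?y i) = (\<Sum>i\<in>I. b i *\<^sub>R ?y i)" for a b
  proof -
    have "lincomb I a Y = lincomb I b Y"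
      by (rule lincomb_eqI[OF A c p Y Y]) (simp_all add: coords_lincomb that)
    then show ?thesis using bas by (simp add: basis_of_def)
  qed
  show inj: "inj_on ?y I"
  proof (rule inj_onI, rule ccontr)
    fix i j assume ij: "i \<in> I" "j \<in> I" "?y i = ?y j" "i \<noteq> j"
    have "(\<Sum>l\<in>I. (if l = i then 1 else 0) *\<^sub>R ?y l) = (\<Sum>l\<in>I. (if l = j then 1 else 0) *\<^sub>R ?y l)"
      using ij I by (simp add: if_distrib[of "\<lambda>s. s *\<^sub>R _"] sum.delta cong: if_cong)
    from uniq[OF this] ij show False by auto
  qed
  show ind: "independent (?y ` I)"
  proof
    assume "dependent (?y ` I)"
    then obtain u v where u: "v \<in> ?y ` I" "u v \<noteq> 0" "(\<Sum>v\<in>?y ` I. u v *\<^sub>R v) = 0"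
      using real_vector.dependent_finite[of "?y ` I"] I by auto
    have "(\<Sum>i\<in>I. u (?y i) *\<^sub>R ?y i) = (\<Sum>i\<in>I. 0 *\<^sub>R ?y i)"
      using u(3) by (simp add: sum.reindex[OF inj])
    from uniq[OF this] u(1,2) show False by auto
  qed
  show sp: "coords c ` E = span (?y ` I)"
  proof -
    have "span (?y ` I) = {\<Sum>i\<in>I. a i *\<^sub>R ?y i | a. True}"
    proof (intro subset_antisym subsetI)
      fix x assume "x \<in> span (?y ` I)"
      then obtain u where "x = (\<Sum>v\<in>?y ` I. u v *\<^sub>R v)" using I by (auto simp: span_finite)
      then show "x \<in> {\<Sum>i\<in>I. a i *\<^sub>R ?y i | a. True}"
        by (auto simp: sum.reindex[OF inj] intro!: exI[of _ "\<lambda>i. u (?y i)"])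
    next
      fix x assume "x \<in> {\<Sum>i\<in>I. a i *\<^sub>R ?y i | a. True}"
      then obtain a where "x = (\<Sum>i\<in>I. a i *\<^sub>R ?y i)" by blast
      then show "x \<in> span (?y ` I)" by (simp only:) (intro span_sum span_scale span_base imageI)
    qed
    moreover have "coords c ` E = {\<Sum>i\<in>I. a i *\<^sub>R ?y i | a. True}"
      using bas by (auto simp: basis_of_def coords_lincomb image_iff) (metis coords_lincomb)
    ultimately show ?thesis by simp
  qed
  show "dim (coords c ` E) = card I"
    unfolding sp dim_span using dim_eq_card_independent[OF ind] card_image[OF inj] by simp
qed

lemma subbundle_dim:
  assumes A: "smooth_manifold A" and c: "smooth_chart A c" and p: "p \<in> fst c" and E: "subbundle A k E"
  shows "dim (coords c ` E p) = k" "subspace (coords c ` E p)"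
proof -
  obtain V Y where Y: "p \<in> V" "\<forall>i<k. smooth_vfield A V (Y i)" "\<forall>q\<in>V. basis_of {..<k} (\<lambda>i. Y i q) (E q)"
    using E unfolding subbundle_def by metis
  have t: "Y i p \<in> tangent_space A p" if "i \<in> {..<k}" for i using Y that by (auto simp: smooth_vfield_def)
  have b: "basis_of {..<k} (\<lambda>i. Y i p) (E p)" using Y by blast
  show "dim (coords c ` E p) = k" using coords_basis_of(4)[OF A c p finite_lessThan t b] by simp
  show "subspace (coords c ` E p)" using coords_basis_of(1)[OF A c p finite_lessThan t b] subspace_span by metis
qed

text \<open>The definite description in \<open>rk\<close> is proper because any admissible rank is
  the dimension of the fibre at \<open>p\<close>.\<close>

lemma rk_eq_dim:
  assumes A: "smooth_manifold A" and c: "smooth_chart A c" and p: "p \<in> fst c" and E: "subbundle A k E"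
  shows "rk A E = dim (coords c ` E p)"
  unfolding rk_def subbundle_dim(1)[OF A c p E]
  by (rule the_equality[of "\<lambda>k. subbundle A k E", OF E]) (use subbundle_dim(1)[OF A c p] E in metis)

lemma card_atMost_bij: "bij_betw (\<lambda>j::'n::{finite, linorder}. card {..j}) UNIV {1..CARD('n)}"
proof -
  have inj: "inj (\<lambda>j::'n. card {..j})"
  proof (rule linorder_injI)
    fix i j :: 'n assume "i < j"
    then have "{..i} \<subset> {..j}" by auto
    then have "card {..i} < card {..j}" by (simp add: psubset_card_mono)
    then show "card {..i} \<noteq> card {..j}" by simp
  qed
  have sub: "range (\<lambda>j::'n. card {..j}) \<subseteq> {1..CARD('n)}"
  proof clarify
    fix j :: 'n
    have "card {..j} > 0" by (auto simp: card_gt_0_iff)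
    moreover have "card {..j} \<le> CARD('n)" by (rule card_mono) auto
    ultimately show "card {..j} \<in> {1..CARD('n)}" by simp
  qed
  have "range (\<lambda>j::'n. card {..j}) = {1..CARD('n)}"
    by (rule card_subset_eq) (use sub inj in \<open>auto simp: card_image\<close>)
  then show ?thesis using inj by (simp add: bij_betw_def)
qed

lemma card_card_atMost_le:
  assumes "k \<le> CARD('n::{finite, linorder})"
  shows "card {j::'n. card {..j} \<le> k} = k"
proof -
  let ?f = "\<lambda>j::'n. card {..j}"
  have "?f ` {j. ?f j \<le> k} = {1..k}"
  proof (intro subset_antisym subsetI)
    fix m assume "m \<in> ?f ` {j. ?f j \<le> k}"
    then obtain j where "m = ?f j" "?f j \<le> k" by auto
    moreover have "?f j \<in> {1..CARD('n)}" using card_atMost_bij bij_betwE by blast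
    ultimately show "m \<in> {1..k}" by simp
  next
    fix m assume m: "m \<in> {1..k}"
    then have "m \<in> ?f ` UNIV" using card_atMost_bij[where 'n = 'n] assms by (auto simp: bij_betw_def)
    then show "m \<in> ?f ` {j. ?f j \<le> k}" using m by auto
  qed
  moreover have "inj_on ?f {j. ?f j \<le> k}"
    using card_atMost_bij[where 'n = 'n] by (auto simp: bij_betw_def intro: inj_on_subset)
  ultimately show ?thesis using card_image by (metis card_atLeastAtMost diff_Suc_1)
qed

text \<open>At a point of \<open>U\<close> the frame is a basis of the tangent space indexed by
  \<open>'n\<close>; from it the rank of \<open>H r\<close> is read off, which is why
  \<open>U\<close> has to contain a point.\<close>

locale carnot_frame =
  fixes A :: "('m::{t2_space, second_countable_topology}, 'n::{finite, linorder}) chart set"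
    and r :: nat and H :: "nat \<Rightarrow> 'm distribution" and U :: "'m set" and X :: "'n \<Rightarrow> 'm vfield"
  assumes carnot: "carnot_manifold A r H" and frame: "H_frame A H U X" and U_nonempty: "U \<noteq> {}"
begin

abbreviation w :: "'n \<Rightarrow> nat" where "w \<equiv> wt A H"

lemma A: "smooth_manifold A" using carnot by (simp add: carnot_manifold_def)
lemma r: "r \<ge> 1" using carnot by (simp add: carnot_manifold_def)
lemma U: "open U" using frame by (simp add: H_frame_def)
lemma X_smooth: "smooth_vfield A U (X j)" using frame by (simp add: H_frame_def section_on_def)
lemma X_tangent: "p \<in> U \<Longrightarrow> X j p \<in> tangent_space A p" using X_smooth by (simp add: smooth_vfield_def)
lemma X_basis: "p \<in> U \<Longrightarrow> basis_of UNIV (\<lambda>j. X j p) (tangent_space A p)"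
  using frame by (simp add: H_frame_def)
lemma H_r: "H r p = tangent_space A p" using carnot by (simp add: carnot_manifold_def)

lemma H_subbundle: "1 \<le> v \<Longrightarrow> v \<le> r \<Longrightarrow> \<exists>k. subbundle A k (H v)"
  using carnot by (auto simp: carnot_manifold_def)

lemma H_mono: "1 \<le> v \<Longrightarrow> v \<le> v' \<Longrightarrow> v' \<le> r \<Longrightarrow> H v p \<subseteq> H v' p"
proof (induction v')
  case (Suc k)
  show ?case
  proof (cases "v = Suc k")
    case False
    then have "H v p \<subseteq> H k p" using Suc by simp
    moreover have "H k p \<subseteq> H (Suc k) p" using carnot Suc.prems False by (auto simp: carnot_manifold_def)
    ultimately show ?thesis by simp
  qed simp
qed simp

lemma rk_H:
  assumes "smooth_chart A c" "p \<in> fst c" "1 \<le> v" "v \<le> r"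
  shows "rk A (H v) = dim (coords c ` H v p)" "subspace (coords c ` H v p)"
  using H_subbundle[OF assms(3,4)] rk_eq_dim[OF A assms(1,2)] subbundle_dim(2)[OF A assms(1,2)] by blast+

lemma rk_H_mono:
  assumes "1 \<le> v" "v \<le> v'" "v' \<le> r"
  shows "rk A (H v) \<le> rk A (H v')"
proof -
  obtain c where c: "c \<in> A" "smooth_chart A c" "undefined \<in> fst c" using smooth_manifold_chart_at[OF A] .
  have "coords c ` H v undefined \<subseteq> coords c ` H v' undefined" using H_mono[OF assms] by blast
  then show ?thesis using rk_H[OF c(2,3)] assms dim_subset by simp
qed

lemma rk_H_r: "rk A (H r) = CARD('n)"
proof -
  obtain p where p: "p \<in> U" using U_nonempty by blast
  obtain c where c: "c \<in> A" "smooth_chart A c" "p \<in> fst c" using smooth_manifold_chart_at[OF A] .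
  show ?thesis
    using rk_H(1)[OF c(2,3) r] coords_basis_of(4)[OF A c(2,3) finite X_tangent[OF p] X_basis[OF p]]
    by (simp add: H_r)
qed

lemma wt_bounds: "1 \<le> w j" "w j \<le> r"
proof -
  have "card {..j} \<le> CARD('n)" by (rule card_mono) auto
  then have ex: "1 \<le> r \<and> card {..j} \<le> rk A (H r)" using r by (simp add: rk_H_r)
  show "1 \<le> w j" unfolding wt_def using LeastI[of "\<lambda>w. 1 \<le> w \<and> card {..j} \<le> rk A (H w)", OF ex] by blast
  show "w j \<le> r" unfolding wt_def by (rule Least_le) (rule ex)
qed

lemma wt_le_iff:
  assumes "1 \<le> v" "v \<le> r"
  shows "w j \<le> v \<longleftrightarrow> card {..j} \<le> rk A (H v)"
proof
  have "card {..j} \<le> CARD('n)" by (rule card_mono) auto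
  then have ex: "1 \<le> r \<and> card {..j} \<le> rk A (H r)" using r by (simp add: rk_H_r)
  have "card {..j} \<le> rk A (H (w j))"
    unfolding wt_def using LeastI[of "\<lambda>w. 1 \<le> w \<and> card {..j} \<le> rk A (H w)", OF ex] by blast
  then show "card {..j} \<le> rk A (H v)" if "w j \<le> v"
    using rk_H_mono[OF wt_bounds(1) that assms(2)] by simp
  show "w j \<le> v" if "card {..j} \<le> rk A (H v)" unfolding wt_def by (rule Least_le) (use that assms in simp)
qed

lemma card_wt_le:
  assumes "1 \<le> v" "v \<le> r"
  shows "card {j. w j \<le> v} = rk A (H v)"
  unfolding wt_le_iff[OF assms]
  by (rule card_card_atMost_le) (use rk_H_mono[OF assms(1,2) order_refl] rk_H_r in simp)

text \<open>By the choice of the weights exactly \<open>rk A (H v)\<close> indices have weight at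
  most \<open>v\<close>. The corresponding frame vectors lie in \<open>H v p\<close> and are
  independent, so they span it.\<close>

lemma H_expansion:
  assumes p: "p \<in> U" and v: "1 \<le> v" "v \<le> r" and D: "D \<in> H v p"
  shows "\<exists>\<mu>. D = lincomb UNIV \<mu> (\<lambda>l. X l p) \<and> (\<forall>l. w l > v \<longrightarrow> \<mu> l = 0)"
proof -
  obtain c where c: "c \<in> A" "smooth_chart A c" "p \<in> fst c" using smooth_manifold_chart_at[OF A] .
  define e where "e j = coords c (X j p)" for j
  define J where "J = {j. w j \<le> v}"
  note bas = coords_basis_of[OF A c(2,3) finite X_tangent[OF p] X_basis[OF p], folded e_def]
  have sub: "e ` J \<subseteq> coords c ` H v p"
  proof clarify
    fix j assume "j \<in> J"
    then have "H (w j) p \<subseteq> H v p" using H_mono[OF wt_bounds(1) _ v(2)] by (simp add: J_def)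
    moreover have "X j p \<in> H (w j) p" using frame p by (simp add: H_frame_def section_on_def)
    ultimately show "e j \<in> coords c ` H v p" unfolding e_def by blast
  qed
  have inj: "inj_on e J" using bas(2) inj_on_subset by blast
  have ind: "independent (e ` J)" by (rule independent_mono[OF bas(3)]) auto
  have "dim (coords c ` H v p) \<le> card (e ` J)"
    using card_image[OF inj] card_wt_le[OF v] rk_H(1)[OF c(2,3) v] by (simp add: J_def)
  then have "coords c ` H v p \<subseteq> span (e ` J)" using card_ge_dim_independent[OF sub ind] by simp
  then have "coords c D \<in> span (e ` J)" using D by blast
  then obtain u where u: "coords c D = (\<Sum>x\<in>e ` J. u x *\<^sub>R x)" by (auto simp: span_finite)
  define \<mu> where "\<mu> l = (if l \<in> J then u (e l) else 0)" for l
  have "coords c D = coords c (lincomb UNIV \<mu> (\<lambda>l. X l p))"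
    unfolding coords_lincomb u sum.reindex[OF inj] comp_def e_def[symmetric]
    by (rule sum.mono_neutral_cong_left) (auto simp: \<mu>_def)
  moreover have "D \<in> tangent_space A p" using D H_mono[OF v order_refl] H_r by blast
  \<comment> \<open>\<open>D\<close> is presented as a combination over a one-element index set so
    that \<open>lincomb_eqI\<close> applies.\<close>
  ultimately have "lincomb {undefined} (\<lambda>_. 1) (\<lambda>_. D) = lincomb UNIV \<mu> (\<lambda>l. X l p)"
    by (intro lincomb_eqI[OF A c(2,3)] X_tangent p) (simp_all add: lincomb_singleton)
  then show ?thesis by (intro exI[of _ \<mu>]) (auto simp: lincomb_singleton \<mu>_def J_def)
qed

lemma lincomb_X_inj:
  "p \<in> U \<Longrightarrow> lincomb UNIV a (\<lambda>l. X l p) = lincomb UNIV b (\<lambda>l. X l p) \<Longrightarrow> a = b"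
  using X_basis[of p] by (auto simp: basis_of_def fun_eq_iff)

lemma structure_fun_expansion:
  assumes p: "p \<in> U" and ij: "w i + w j \<le> r"
  shows "lie_bracket A (X i) (X j) p = lincomb UNIV (\<lambda>l. structure_fun A X i j l p) (\<lambda>l. X l p)"
    "w l > w i + w j \<Longrightarrow> structure_fun A X i j l p = 0"
proof -
  have "section_on A U (H (w i + w j)) (lie_bracket A (X i) (X j))"
    using carnot frame wt_bounds(1)[of i] wt_bounds(1)[of j] ij unfolding carnot_manifold_def H_frame_def by blast
  then have "lie_bracket A (X i) (X j) p \<in> H (w i + w j) p" using p by (simp add: section_on_def)
  then obtain \<mu> where \<mu>: "lie_bracket A (X i) (X j) p = lincomb UNIV \<mu> (\<lambda>l. X l p)" "\<forall>l. w l > w i + w j \<longrightarrow> \<mu> l = 0"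
    using H_expansion[OF p _ ij] wt_bounds(1)[of i] by auto
  have "(THE c. lie_bracket A (X i) (X j) p = lincomb UNIV c (\<lambda>l. X l p)) = \<mu>"
    by (rule the_equality) (use \<mu> lincomb_X_inj[OF p] in metis)+
  then have "structure_fun A X i j l p = \<mu> l" for l by (simp add: structure_fun_def)
  then show "lie_bracket A (X i) (X j) p = lincomb UNIV (\<lambda>l. structure_fun A X i j l p) (\<lambda>l. X l p)"
    "w l > w i + w j \<Longrightarrow> structure_fun A X i j l p = 0" using \<mu> by auto
qed

lemma coords_X:
  assumes "smooth_chart A c" "p \<in> fst c"
  shows "coords c (X j p) = coord_field c (X j) (snd c p)"
  using chart_inv_left[OF smooth_chartD[OF assms(1)] assms(2)] by (simp add: coords_def coord_field_def)

lemma lie_bracket_coord: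
  assumes c: "smooth_chart A c" and p: "p \<in> U" "p \<in> fst c"
  shows "lie_bracket A (X i) (X j) p (\<lambda>q. snd c q $ k) =
    (\<Sum>m\<in>UNIV. coord_field c (X i) (snd c p) $ m * dir_deriv (axis m 1) (\<lambda>x. coord_field c (X j) x $ k) (snd c p)) -
    (\<Sum>m\<in>UNIV. coord_field c (X j) (snd c p) $ m * dir_deriv (axis m 1) (\<lambda>x. coord_field c (X i) x $ k) (snd c p))"
proof -
  note sc = smooth_near_coord[OF A c p(2), of k]
  have sa: "smooth_near A p (app (X j) (\<lambda>q. snd c q $ k))" for j
    by (rule smooth_near_app[OF A X_smooth U p(1) sc])
  have "X i p (app (X j) (\<lambda>q. snd c q $ k)) =
      (\<Sum>m\<in>UNIV. coord_field c (X i) (snd c p) $ m * dir_deriv (axis m 1) (\<lambda>x. coord_field c (X j) x $ k) (snd c p))" for i j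
    using tangent_chart[OF A c p(2) X_tangent[OF p(1)] sa] chart_inv_left[OF smooth_chartD[OF c] p(2)]
    by (simp add: coord_field_def app_def)
  then show ?thesis using sc by (simp add: lie_bracket_def)
qed

lemma frame_matrix_invertible:
  assumes c: "smooth_chart A c" and p: "p \<in> U" "p \<in> fst c"
  shows "invertible (\<chi> j k. coord_field c (X j) (snd c p) $ k)"
  unfolding invertible_right_inverse matrix_right_invertible_independent_rows
proof (intro allI impI)
  fix a :: "'n \<Rightarrow> real" and i
  assume "(\<Sum>i\<in>UNIV. a i *s row i (\<chi> j k. coord_field c (X j) (snd c p) $ k)) = 0"
  moreover have "row i (\<chi> j k. coord_field c (X j) (snd c p) $ k) = coords c (X i p)" for i
    by (simp add: row_def coords_X[OF c p(2)] vec_eq_iff)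
  ultimately have "coords c (lincomb UNIV a (\<lambda>l. X l p)) = coords c (lincomb UNIV (\<lambda>_. 0) (\<lambda>l. X l p))"
    by (simp add: coords_lincomb scalar_mult_eq_scaleR)
  then have "lincomb UNIV a (\<lambda>l. X l p) = lincomb UNIV (\<lambda>_. 0) (\<lambda>l. X l p)"
    by (intro lincomb_eqI[OF A c p(2)] X_tangent p)
  from lincomb_X_inj[OF p(1) this] show "a i = 0" by simp
qed

text \<open>Multiplying the coordinate expression of the bracket by the inverse frame matrix gives
  coefficients that are smooth and defined for all \<open>i\<close> and \<open>j\<close>. When
  \<open>w i + w j > r\<close> the filtration does not constrain the bracket, but then no index
  \<open>l\<close> has weight above \<open>w i + w j\<close> either.\<close>

lemma structure_functions_in_chart:
  assumes c: "smooth_chart A c"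
  defines "S \<equiv> snd c ` (U \<inter> fst c)" and "B \<equiv> \<lambda>j k x. coord_field c (X j) x $ k"
  obtains L where "\<And>i j l. smooth_on S (L i j l)"
    "\<And>i j k x. x \<in> S \<Longrightarrow> (\<Sum>l\<in>UNIV. L i j l x * B l k x) =
       (\<Sum>m\<in>UNIV. B i m x * dir_deriv (axis m 1) (B j k) x) - (\<Sum>m\<in>UNIV. B j m x * dir_deriv (axis m 1) (B i k) x)"
    "\<And>i j l x. x \<in> S \<Longrightarrow> w l > w i + w j \<Longrightarrow> L i j l x = 0"
    "\<And>i j l p. p \<in> U \<Longrightarrow> p \<in> fst c \<Longrightarrow> w i + w j \<le> r \<Longrightarrow> structure_fun A X i j l p = L i j l (snd c p)"
    "\<And>i j l x. x \<in> S \<Longrightarrow> L i j l x = - L j i l x"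
proof -
  note ic = smooth_chartD[OF c]
  have S: "open S" unfolding S_def by (rule chart_image_open[OF ic]) (use U chart_open[OF ic] in auto)
  have Bs: "smooth_on S (B j k)" for j k
    using smooth_coord_field[OF A X_smooth U c] smooth_on_vec_iff[OF S] unfolding S_def B_def by blast
  define M where "M x = (\<chi> j k. B j k x)" for x
  have "invertible (M x)" if "x \<in> S" for x
    using that frame_matrix_invertible[OF c] by (auto simp: S_def M_def B_def)
  then obtain N where N: "\<And>i j. smooth_on S (\<lambda>x. N x $ i $ j)"
    "\<And>x. x \<in> S \<Longrightarrow> M x ** N x = mat 1" "\<And>x. x \<in> S \<Longrightarrow> N x ** M x = mat 1"
    using smooth_matrix_inv[OF S, of M] Bs by (auto simp: M_def)
  have MN: "(\<Sum>k\<in>UNIV. B j k x * N x $ k $ l) = (if j = l then 1 else 0)" if "x \<in> S" for x j l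
    using arg_cong[OF N(2)[OF that], of "\<lambda>m. m $ j $ l"] by (simp add: matrix_matrix_mult_def mat_def M_def)
  have NM: "(\<Sum>l\<in>UNIV. N x $ j $ l * B l k x) = (if j = k then 1 else 0)" if "x \<in> S" for x j k
    using arg_cong[OF N(3)[OF that], of "\<lambda>m. m $ j $ k"] by (simp add: matrix_matrix_mult_def mat_def M_def)
  define K where "K i j k x = (\<Sum>m\<in>UNIV. B i m x * dir_deriv (axis m 1) (B j k) x) - (\<Sum>m\<in>UNIV. B j m x * dir_deriv (axis m 1) (B i k) x)" for i j k x
  define L where "L i j l x = (\<Sum>k\<in>UNIV. K i j k x * N x $ k $ l)" for i j l x
  have LK: "L i j l x = a l" if x: "x \<in> S" and a: "\<And>k. K i j k x = (\<Sum>m\<in>UNIV. a m * B m k x)" for i j l x a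
  proof -
    have "L i j l x = (\<Sum>k\<in>UNIV. \<Sum>m\<in>UNIV. a m * (B m k x * N x $ k $ l))"
      by (simp add: L_def a sum_distrib_right mult.assoc)
    also have "\<dots> = (\<Sum>m\<in>UNIV. a m * (\<Sum>k\<in>UNIV. B m k x * N x $ k $ l))"
      unfolding sum_distrib_left by (rule sum.swap)
    also have "\<dots> = a l" by (simp add: MN[OF x] if_distrib cong: if_cong)
    finally show ?thesis .
  qed
  have st: "structure_fun A X i j l p = L i j l (snd c p)" if p: "p \<in> U" "p \<in> fst c" and ij: "w i + w j \<le> r" for i j l p
  proof -
    have "K i j k (snd c p) = (\<Sum>m\<in>UNIV. structure_fun A X i j m p * B m k (snd c p))" for k
    proof -
      have "K i j k (snd c p) = coords c (lie_bracket A (X i) (X j) p) $ k"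
        using lie_bracket_coord[OF c p] by (simp add: coords_def K_def B_def)
      also have "\<dots> = (\<Sum>m\<in>UNIV. structure_fun A X i j m p * B m k (snd c p))"
        unfolding structure_fun_expansion(1)[OF p(1) ij] coords_lincomb
        by (simp add: coords_X[OF c p(2)] B_def)
      finally show ?thesis .
    qed
    from LK[OF _ this] p show ?thesis by (simp add: S_def)
  qed
  show ?thesis
  proof (rule that[of L])
    show "smooth_on S (L i j l)" for i j l
      unfolding L_def K_def
      by (intro smooth_on_sum smooth_on_mult smooth_on_diff Bs N(1) smooth_on_dir_deriv S)
    show "(\<Sum>l\<in>UNIV. L i j l x * B l k x) =
       (\<Sum>m\<in>UNIV. B i m x * dir_deriv (axis m 1) (B j k) x) - (\<Sum>m\<in>UNIV. B j m x * dir_deriv (axis m 1) (B i k) x)"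
      if x: "x \<in> S" for i j k x
    proof -
      have "(\<Sum>l\<in>UNIV. L i j l x * B l k x) = (\<Sum>l\<in>UNIV. \<Sum>m\<in>UNIV. K i j m x * (N x $ m $ l * B l k x))"
        by (simp add: L_def sum_distrib_right mult.assoc)
      also have "\<dots> = (\<Sum>m\<in>UNIV. K i j m x * (\<Sum>l\<in>UNIV. N x $ m $ l * B l k x))"
        unfolding sum_distrib_left by (rule sum.swap)
      also have "\<dots> = K i j k x" by (simp add: NM[OF x] if_distrib cong: if_cong)
      finally show ?thesis by (simp add: K_def)
    qed
    show "L i j l x = 0" if x: "x \<in> S" and "w l > w i + w j" for i j l x
    proof -
      obtain p where p: "p \<in> U" "p \<in> fst c" "x = snd c p" using x by (auto simp: S_def)
      have "w i + w j \<le> r" using that(2) wt_bounds(2)[of l] by simp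
      then show ?thesis using st[OF p(1,2), of i j l] structure_fun_expansion(2)[OF p(1), of i j l] that(2) p(3) by simp
    qed
    show "L i j l x = - L j i l x" for i j l x
      by (simp add: L_def K_def sum_negf[symmetric] algebra_simps)
  qed (rule st)
qed

end


section \<open>Canonical coordinates\<close>


lemma integral_curve_rescale:
  assumes g: "integral_curve A U (\<lambda>p. lincomb UNIV (\<lambda>j. x $ j) (\<lambda>j. X j p)) \<gamma>" and t: "t \<in> {0..1}"
  shows "integral_curve A U (\<lambda>p. lincomb UNIV (\<lambda>j. (t *\<^sub>R x) $ j) (\<lambda>j. X j p)) (\<lambda>s. \<gamma> (t * s))"
  unfolding integral_curve_def
proof (intro conjI ballI allI impI)
  have ts: "t * s \<in> {0..1}" if "s \<in> {0..1}" for s using t that by (auto simp: mult_le_one)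
  show "continuous_on {0..1} (\<lambda>s. \<gamma> (t * s))"
    by (rule continuous_on_compose2[of "{0..1}" \<gamma>])
      (use g ts in \<open>auto simp: integral_curve_def intro!: continuous_intros\<close>)
  show "(\<lambda>s. \<gamma> (t * s)) ` {0..1} \<subseteq> U" using g ts by (auto simp: integral_curve_def)
  fix s f assume s: "s \<in> {0..1}" and f: "smooth_near A (\<gamma> (t * s)) f"
  let ?Y = "\<lambda>p. lincomb UNIV (\<lambda>j. x $ j) (\<lambda>j. X j p)"
  have 1: "((f \<circ> \<gamma>) has_real_derivative ?Y (\<gamma> (t * s)) f) (at (t * s) within {0..1})"
    using g ts[OF s] f by (auto simp: integral_curve_def)
  have 2: "((\<lambda>s. t * s) has_real_derivative t) (at s within {0..1})"
    by (auto intro!: derivative_eq_intros)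
  have "((f \<circ> \<gamma> \<circ> (\<lambda>s. t * s)) has_real_derivative ?Y (\<gamma> (t * s)) f * t) (at s within {0..1})"
    by (rule DERIV_image_chain[OF DERIV_subset[OF 1] 2]) (use ts in auto)
  moreover have "?Y (\<gamma> (t * s)) f * t = lincomb UNIV (\<lambda>j. (t *\<^sub>R x) $ j) (\<lambda>j. X j (\<gamma> (t * s))) f"
    by (simp add: lincomb_def sum_distrib_left sum_distrib_right mult_ac)
  ultimately show "((f \<circ> (\<lambda>s. \<gamma> (t * s))) has_real_derivative
      lincomb UNIV (\<lambda>j. (t *\<^sub>R x) $ j) (\<lambda>j. X j (\<gamma> (t * s))) f) (at s within {0..1})"
    by (simp add: comp_def)
qed

lemma sum_mult_delta:
  fixes f :: "'n::finite \<Rightarrow> real"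
  shows "(\<Sum>l\<in>UNIV. f l * (if l = k then 1 else 0)) = f k" "(\<Sum>l\<in>UNIV. (if j = l then 1 else 0) * f l) = f j"
  by (simp_all add: if_distrib if_distribR cong: if_cong)

lemma partials_const: "ds \<noteq> [] \<Longrightarrow> partials ds (\<lambda>y. c) = (\<lambda>y. 0)"
proof (induction ds)
  case (Cons d ds) then show ?case by (cases "ds = []") auto
qed simp

lemma partials_nth_at_0:
  assumes "partials ds (\<lambda>x::real^'n. x $ i) 0 \<noteq> 0"
  shows "ds = [i]"
proof (cases ds rule: rev_cases)
  case Nil then show ?thesis using assms by simp
next
  case (snoc ds' d)
  have eq: "partials ds (\<lambda>x::real^'n. x $ i) = partials ds' (\<lambda>x. axis d 1 $ i)"
    unfolding snoc partials_append by simp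
  have "ds' = []"
  proof (rule ccontr)
    assume "ds' \<noteq> []"
    then have "partials ds' (\<lambda>x::real^'n. axis d (1::real) $ i) = (\<lambda>x. 0)" by (rule partials_const)
    then show False using assms eq by simp
  qed
  then show ?thesis using assms eq snoc by (auto simp: axis_def split: if_splits)
qed

text \<open>At 0 only the list \<open>[i]\<close> gives a nonzero derivative of
  \<open>x $ i\<close>, so multiplication by \<open>x $ i\<close> raises the weighted order by
  \<open>w i\<close>.\<close>

lemma partials_coord_mult_zero:
  fixes f :: "real^'n \<Rightarrow> real"
  assumes "open S" "0 \<in> S" "smooth_on S f"
    and "\<And>q. wsum w q + w i = wsum w ds \<Longrightarrow> partials q f 0 = 0"
  shows "partials ds (\<lambda>x. x $ i * f x) 0 = 0"
proof (rule partials_mult_zero[OF assms(1,2) smooth_on_nth assms(3), where w = w])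
  fix p q assume "length p + length q = length ds" "wsum w p + wsum w q = wsum w ds"
  then show "partials p (\<lambda>x. x $ i) 0 = 0 \<or> partials q f 0 = 0"
    using partials_nth_at_0[of p i] assms(4)[of q] by fastforce
qed

lemma partials_coord_sum_zero:
  fixes f :: "'n::finite \<Rightarrow> real^'n \<Rightarrow> real"
  assumes S: "open S" "0 \<in> S" and f: "\<And>i. smooth_on S (f i)"
    and "\<And>i q. wsum w q + w i = wsum w ds \<Longrightarrow> partials q (f i) 0 = 0"
  shows "partials ds (\<lambda>x. \<Sum>i\<in>UNIV. x $ i * f i x) 0 = 0"
proof -
  have "partials ds (\<lambda>x. \<Sum>i\<in>UNIV. x $ i * f i x) 0 = (\<Sum>i\<in>UNIV. partials ds (\<lambda>x. x $ i * f i x) 0)"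
    by (rule partials_sum[OF S(1) _ S(2)]) (intro smooth_on_mult smooth_on_nth f S)
  also have "\<dots> = 0"
    by (intro sum.neutral ballI partials_coord_mult_zero[OF S f]) (rule assms(4))
  finally show ?thesis .
qed

locale canonical_chart = carnot_frame A r H U X
  for A :: "('m::{t2_space, second_countable_topology}, 'n::{finite, linorder}) chart set"
    and r H U and X :: "'n \<Rightarrow> 'm vfield" +
  fixes a :: 'm and c :: "('m, 'n) chart"
  assumes a: "a \<in> U" and canonical: "canonical_coords_1 A U X a c"
begin

definition B :: "'n \<Rightarrow> 'n \<Rightarrow> (real, 'n) vec \<Rightarrow> real" where
  "B j k x = coord_field c (X j) x $ k"

lemma c: "smooth_chart A c" and c_a: "a \<in> fst c" "snd c a = 0"
  using canonical by (auto simp: canonical_coords_1_def centered_chart_def)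

lemma flow:
  assumes "x \<in> snd c ` fst c"
  obtains \<gamma> where "integral_curve A U (\<lambda>p. lincomb UNIV (\<lambda>j. x $ j) (\<lambda>j. X j p)) \<gamma>" "\<gamma> 0 = a" "\<gamma> 1 = chart_inv c x"
  using canonical assms unfolding canonical_coords_1_def time_one_flow_def integral_curve_def by metis

lemma image_open: "open (snd c ` (U \<inter> fst c))"
  by (rule chart_image_open[OF smooth_chartD[OF c]]) (use U chart_open[OF smooth_chartD[OF c]] in auto)

lemma smooth_lincomb_coord_field:
  assumes "smooth_chart A d"
  shows "smooth_on (snd d ` (U \<inter> fst d)) (coord_field d (\<lambda>p. lincomb UNIV (\<lambda>j. x $ j) (\<lambda>j. X j p)))"
proof -
  have O: "open (snd d ` (U \<inter> fst d))"
    by (rule chart_image_open[OF smooth_chartD[OF assms]]) (use U chart_open[OF smooth_chartD[OF assms]] in auto)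
  have "smooth_on (snd d ` (U \<inter> fst d)) (\<lambda>y. coord_field d (X j) y $ k)" for j k
    using smooth_coord_field[OF A X_smooth U assms] smooth_on_vec_iff[OF O] by blast
  then have "smooth_on (snd d ` (U \<inter> fst d)) (\<lambda>y. \<Sum>j\<in>UNIV. x $ j * coord_field d (X j) y $ k)" for k
    by (intro smooth_on_sum smooth_on_mult O smooth_on_const)
  then show ?thesis unfolding smooth_on_vec_iff[OF O] by (simp add: coord_field_def lincomb_def)
qed

text \<open>By uniqueness of integral curves, the rays through the origin are the integral curves of the
  fields \<open>\<Sum>\<^sub>j x\<^sub>j X\<^sub>j\<close>; differentiating them at time one shows that \<open>\<Sum>\<^sub>j x\<^sub>j X\<^sub>j\<close> is the Euler field.\<close>

lemma euler_field:
  obtains \<rho> where "\<rho> > 0" "ball 0 \<rho> \<subseteq> snd c ` (U \<inter> fst c)"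
    "\<And>x k. x \<in> ball 0 \<rho> \<Longrightarrow> x $ k = (\<Sum>j\<in>UNIV. x $ j * B j k x)"
proof -
  have "0 \<in> snd c ` (U \<inter> fst c)" using a c_a by force
  then obtain \<rho> where \<rho>: "\<rho> > 0" "ball 0 \<rho> \<subseteq> snd c ` (U \<inter> fst c)" using image_open open_contains_ball by blast
  have "x $ k = (\<Sum>j\<in>UNIV. x $ j * B j k x)" if x: "x \<in> ball 0 \<rho>" for x k
  proof -
    let ?Y = "\<lambda>x p. lincomb UNIV (\<lambda>j. x $ j) (\<lambda>j. X j p)"
    have xi: "x \<in> snd c ` fst c" using \<rho> x by blast
    obtain \<gamma> where \<gamma>: "integral_curve A U (?Y x) \<gamma>" "\<gamma> 0 = a" "\<gamma> 1 = chart_inv c x"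
      using flow[OF xi] .
    have ray: "\<gamma> t = chart_inv c (t *\<^sub>R x)" if t: "t \<in> {0..1}" for t
    proof -
      have tx: "t *\<^sub>R x \<in> ball 0 \<rho>" using star0D[OF star0_ball x] t by simp
      then have "t *\<^sub>R x \<in> snd c ` fst c" using \<rho> by blast
      then obtain \<eta> where \<eta>: "integral_curve A U (?Y (t *\<^sub>R x)) \<eta>" "\<eta> 0 = a" "\<eta> 1 = chart_inv c (t *\<^sub>R x)"
        using flow by metis
      \<comment> \<open>The curve \<open>\<eta>\<close> attached to \<open>t *\<^sub>R x\<close> is
        a choice unrelated to \<open>\<gamma>\<close>; by uniqueness it is \<open>\<gamma>\<close>
        run at speed \<open>t\<close>.\<close>
      have "\<gamma> (t * 1) = \<eta> 1"
        by (rule integral_curves_equal[OF A U smooth_lincomb_coord_field[OF smooth_manifold_chart[OF A]]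
              integral_curve_rescale[OF \<gamma>(1) t] \<eta>(1)]) (use \<gamma> \<eta> in auto)
      then show ?thesis using \<eta> by simp
    qed
    have p: "chart_inv c x \<in> fst c" using chart_inv_in[OF xi] .
    have "(((\<lambda>q. snd c q $ k) \<circ> \<gamma>) has_real_derivative ?Y x (\<gamma> 1) (\<lambda>q. snd c q $ k)) (at 1 within {0..1})"
    proof -
      have "smooth_near A (\<gamma> 1) (\<lambda>q. snd c q $ k)" using smooth_near_coord[OF A c p] \<gamma>(3) by simp
      moreover have "(1::real) \<in> {0..1}" by simp
      ultimately show ?thesis using \<gamma>(1) unfolding integral_curve_def by blast
    qed
    \<comment> \<open>Time 1 is an endpoint of the interval, so both derivatives are one-sided; they
      are unique all the same.\<close>
    then have D1: "((\<lambda>t. t * x $ k) has_real_derivative ?Y x (\<gamma> 1) (\<lambda>q. snd c q $ k)) (at 1 within {0..1})"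
    proof (rule has_field_derivative_transform_within[OF _ zero_less_one])
      fix t :: real assume t: "t \<in> {0..1}"
      have "t *\<^sub>R x \<in> ball 0 \<rho>" using star0D[OF star0_ball x, of t] t by simp
      then have "t *\<^sub>R x \<in> snd c ` fst c" using \<rho>(2) by blast
      then show "((\<lambda>q. snd c q $ k) \<circ> \<gamma>) t = t * x $ k"
        using ray[OF t] chart_inv_right[of "t *\<^sub>R x" c] by simp
    qed simp
    have D2: "((\<lambda>t. t * x $ k) has_real_derivative x $ k) (at 1 within {0..1})"
      by (auto intro!: derivative_eq_intros)
    have "?Y x (\<gamma> 1) (\<lambda>q. snd c q $ k) = x $ k"
      by (rule vector_derivative_unique_within_closed_interval[of 0 1 1 "\<lambda>t. t * x $ k"])
        (use D1 D2 in \<open>auto simp: has_real_derivative_iff_has_vector_derivative\<close>)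
    then show ?thesis using \<gamma>(3) by (simp add: lincomb_def B_def coord_field_def)
  qed
  with \<rho> show ?thesis by (rule that)
qed

definition \<rho> :: real where
  "\<rho> = (SOME \<rho>. \<rho> > 0 \<and> ball 0 \<rho> \<subseteq> snd c ` (U \<inter> fst c) \<and>
     (\<forall>x\<in>ball 0 \<rho>. \<forall>k. x $ k = (\<Sum>j\<in>UNIV. x $ j * B j k x)))"

abbreviation S :: "(real, 'n) vec set" where "S \<equiv> ball 0 \<rho>"

lemma \<rho>: "\<rho> > 0" "S \<subseteq> snd c ` (U \<inter> fst c)"
  and euler: "x \<in> S \<Longrightarrow> x $ k = (\<Sum>j\<in>UNIV. x $ j * B j k x)"
proof -
  have "\<exists>\<rho>>0. ball 0 \<rho> \<subseteq> snd c ` (U \<inter> fst c) \<and>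
     (\<forall>x\<in>ball 0 \<rho>. \<forall>k. x $ k = (\<Sum>j\<in>UNIV. x $ j * B j k x))"
    by (rule euler_field) blast
  from someI_ex[OF this]
  show "\<rho> > 0" "S \<subseteq> snd c ` (U \<inter> fst c)" "x \<in> S \<Longrightarrow> x $ k = (\<Sum>j\<in>UNIV. x $ j * B j k x)"
    unfolding \<rho>_def[symmetric] by blast+
qed

lemma zero_S: "0 \<in> S" using \<rho> by simp

lemma B_smooth: "smooth_on S (B j k)"
proof -
  have "smooth_on S (coord_field c (X j))"
    using smooth_coord_field[OF A X_smooth U c] smooth_on_subset \<rho>(2) by blast
  then show ?thesis unfolding smooth_on_vec_iff[OF open_ball] B_def by blast
qed

lemma B_differentiable: "x \<in> S \<Longrightarrow> B j k differentiable (at x)"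
  by (rule smooth_on_differentiable[OF B_smooth])

text \<open>The Euler identity is differentiated in direction \<open>v\<close>. At 0 this gives
  \<open>B_0\<close>; with the value of \<open>X j\<close> as direction it supplies, in
  \<open>C_riccati\<close>, the derivatives of the \<open>X i\<close> along
  \<open>X j\<close>.\<close>

lemma euler_derivative:
  assumes x: "x \<in> S"
  shows "v $ k = (\<Sum>j\<in>UNIV. v $ j * B j k x) + (\<Sum>j\<in>UNIV. x $ j * dir_deriv v (B j k) x)"
proof -
  have "v $ k = dir_deriv v (\<lambda>y. y $ k) x" by simp
  also have "\<dots> = dir_deriv v (\<lambda>y. \<Sum>j\<in>UNIV. y $ j * B j k y) x"
    using frechet_derivative_cong_open[OF open_ball x euler] by simp
  also have "\<dots> = (\<Sum>j\<in>UNIV. x $ j * dir_deriv v (B j k) x + v $ j * B j k x)"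
    using B_differentiable[OF x] by (simp add: dir_deriv_sum dir_deriv_mult)
  finally show ?thesis by (simp add: sum.distrib)
qed

lemma B_0: "B j k 0 = (if j = k then 1 else 0)"
proof -
  have "axis j 1 $ k = (\<Sum>i\<in>UNIV. axis j 1 $ i * B i k 0)"
    using euler_derivative[OF zero_S, of "axis j 1" k] by simp
  also have "\<dots> = B j k 0" by (simp add: axis_def if_distrib[of "\<lambda>s. s * _"] cong: if_cong)
  finally show ?thesis by (auto simp: axis_def)
qed

definition C :: "'n \<Rightarrow> 'n \<Rightarrow> (real, 'n) vec \<Rightarrow> real" where
  "C j k x = B j k x - (if j = k then 1 else 0)"

lemma C_smooth: "smooth_on S (C j k)"
  unfolding C_def by (intro smooth_on_diff B_smooth) auto

text \<open>This is \<open>[\<Sum>\<^sub>i x\<^sub>i X\<^sub>i, X\<^sub>j] = \<Sum>\<^sub>i x\<^sub>i [X\<^sub>i, X\<^sub>j] - \<Sum>\<^sub>i X\<^sub>j(x\<^sub>i) X\<^sub>i\<close> written in coordinates, the sum on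
  the left being the Euler field.\<close>

lemma C_riccati:
  assumes L: "\<And>i j l. smooth_on S (L i j l)"
    "\<And>i j k x. x \<in> S \<Longrightarrow> (\<Sum>l\<in>UNIV. L i j l x * B l k x) =
       (\<Sum>m\<in>UNIV. B i m x * dir_deriv (axis m 1) (B j k) x) - (\<Sum>m\<in>UNIV. B j m x * dir_deriv (axis m 1) (B i k) x)"
  shows "riccati S (\<lambda>j k x. \<Sum>i\<in>UNIV. x $ i * L i j k x) C"
  unfolding riccati_def
proof (intro allI conjI ballI)
  let ?A = "\<lambda>j k x. \<Sum>i\<in>UNIV. x $ i * L i j k x"
  fix j k
  show "smooth_on S (?A j k)" by (intro smooth_on_sum smooth_on_mult L smooth_on_nth) auto
  show "smooth_on S (C j k)" by (rule C_smooth)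
  show "?A j k 0 = 0" by simp
  show "C j k 0 = 0" by (simp add: C_def B_0)
  fix x assume x: "x \<in> S"
  have eq: "C j k y + dir_deriv y (C j k) y = ?A j k y + (\<Sum>l\<in>UNIV. ?A j l y * C l k y) - (\<Sum>l\<in>UNIV. C j l y * C l k y)"
    if y: "y \<in> S" for y
  proof -
    have dC: "dir_deriv y (C j k) y = dir_deriv y (B j k) y"
      unfolding C_def using B_differentiable[OF y] by (simp add: dir_deriv_diff)
    have dB: "dir_deriv v (B i k) y = (\<Sum>m\<in>UNIV. v $ m * dir_deriv (axis m 1) (B i k) y)" for v i
      using dir_deriv_expand[OF B_differentiable[OF y], where v = v] unfolding real_scaleR_def .
    \<comment> \<open>The value of \<open>X j\<close> at \<open>y\<close>; differentiating in this
      direction is the action of \<open>X j\<close>.\<close>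
    define row where "row = (\<chi> m. B j m y)"
    have dBrow: "dir_deriv row (B i k) y = (\<Sum>m\<in>UNIV. B j m y * dir_deriv (axis m 1) (B i k) y)" for i
      using dB[where v = row and i = i] by (simp add: row_def)
    have "dir_deriv y (B j k) y = (\<Sum>m\<in>UNIV. y $ m * dir_deriv (axis m 1) (B j k) y)"
      by (rule dB)
    \<comment> \<open>The Euler field is replaced by the combination of the \<open>X i\<close> with
      coefficients \<open>y $ i\<close>, so that brackets with \<open>X j\<close> can be
      formed.\<close>
    also have "\<dots> = (\<Sum>m\<in>UNIV. (\<Sum>i\<in>UNIV. y $ i * B i m y) * dir_deriv (axis m 1) (B j k) y)"
      unfolding euler[OF y, symmetric] ..
    also have "\<dots> = (\<Sum>i\<in>UNIV. y $ i * (\<Sum>m\<in>UNIV. B i m y * dir_deriv (axis m 1) (B j k) y))"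
      unfolding sum_distrib_left sum_distrib_right mult.assoc by (rule sum.swap)
    also have "\<dots> = (\<Sum>i\<in>UNIV. y $ i * (\<Sum>l\<in>UNIV. L i j l y * B l k y)) + (\<Sum>i\<in>UNIV. y $ i * dir_deriv row (B i k) y)"
      unfolding sum.distrib[symmetric] distrib_left[symmetric] L(2)[OF y] dBrow by simp
    also have "(\<Sum>i\<in>UNIV. y $ i * dir_deriv row (B i k) y) = B j k y - (\<Sum>l\<in>UNIV. B j l y * B l k y)"
      using euler_derivative[OF y, of row k] by (simp add: row_def)
    also have "(\<Sum>i\<in>UNIV. y $ i * (\<Sum>l\<in>UNIV. L i j l y * B l k y)) = (\<Sum>l\<in>UNIV. ?A j l y * B l k y)"
      unfolding sum_distrib_left sum_distrib_right mult.assoc by (rule sum.swap)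
    finally have D: "dir_deriv y (B j k) y = (\<Sum>l\<in>UNIV. ?A j l y * B l k y) + (B j k y - (\<Sum>l\<in>UNIV. B j l y * B l k y))" .
    \<comment> \<open>With B = 1 + C one has B - B^2 = - C - C^2; the term - C goes to the left side
      and turns E into 1 + E.\<close>
    have B: "B l k y = C l k y + (if l = k then 1 else 0)" for l k by (simp add: C_def)
    have 1: "(\<Sum>l\<in>UNIV. ?A j l y * B l k y) = ?A j k y + (\<Sum>l\<in>UNIV. ?A j l y * C l k y)"
      unfolding B distrib_left sum.distrib sum_mult_delta by simp
    have 2: "(\<Sum>l\<in>UNIV. B j l y * B l k y) = (\<Sum>l\<in>UNIV. C j l y * C l k y) + 2 * C j k y + (if j = k then 1 else 0)"
      unfolding B distrib_left distrib_right sum.distrib sum_mult_delta by simp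
    show ?thesis unfolding dC D 1 2 unfolding B by simp
  qed
  have "C j k x = radial_int 0 (\<lambda>y. C j k y + dir_deriv y (C j k) y) x"
    using radial_int_euler[OF star0_ball smooth_on_Ck[OF C_smooth] x] by simp
  also have "\<dots> = radial_int 0 (\<lambda>y. ?A j k y + (\<Sum>l\<in>UNIV. ?A j l y * C l k y) - (\<Sum>l\<in>UNIV. C j l y * C l k y)) x"
    by (rule radial_int_cong[OF star0_ball x eq])
  finally show "C j k x = radial_int 0 (\<lambda>y. ?A j k y + (\<Sum>l\<in>UNIV. ?A j l y * C l k y) - (\<Sum>l\<in>UNIV. C j l y * C l k y)) x" .
qed

end

section \<open>The graded algebra and its left-invariant fields\<close>

locale graded_algebra =
  fixes w :: "'n::finite \<Rightarrow> nat" and r :: nat and L :: "'n \<Rightarrow> 'n \<Rightarrow> 'n \<Rightarrow> real"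
  assumes w: "\<And>j. 1 \<le> w j" "\<And>j. w j \<le> r"
    and L_alt: "\<And>i j k. w k = w i + w j \<Longrightarrow> L i j k = - L j i k"
begin

abbreviation br :: "(real, 'n) vec \<Rightarrow> (real, 'n) vec \<Rightarrow> (real, 'n) vec" where
  "br \<equiv> graded_bracket w L"

lemma br_nth: "br x y $ k = (\<Sum>i\<in>UNIV. \<Sum>j\<in>UNIV. if w k = w i + w j then L i j k * x $ i * y $ j else 0)"
  by (simp add: graded_bracket_def)

lemma br_bilinear: "bounded_bilinear br"
  unfolding bilinear_conv_bounded_bilinear[symmetric] bilinear_def
  by (intro conjI allI linearI)
    (auto simp: vec_eq_iff br_nth sum.distrib[symmetric] sum_distrib_left algebra_simps intro!: sum.cong)

lemma br_alt: "br x y = - br y x"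
proof -
  have "br x y $ k = - br y x $ k" for k
  proof -
    have "br x y $ k = (\<Sum>j\<in>UNIV. \<Sum>i\<in>UNIV. if w k = w i + w j then L i j k * x $ i * y $ j else 0)"
      unfolding br_nth by (rule sum.swap)
    also have "\<dots> = (\<Sum>j\<in>UNIV. \<Sum>i\<in>UNIV. - (if w k = w j + w i then L j i k * y $ j * x $ i else 0))"
    proof (intro sum.cong refl)
      fix i j
      show "(if w k = w i + w j then L i j k * x $ i * y $ j else 0) =
          - (if w k = w j + w i then L j i k * y $ j * x $ i else 0)"
        by (cases "w k = w i + w j") (simp_all add: L_alt[of k i j] add.commute mult_ac)
    qed
    also have "\<dots> = - br y x $ k" by (simp add: br_nth sum_negf)
    finally show ?thesis .
  qed
  then show ?thesis by (simp add: vec_eq_iff)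
qed

lemma br_linear: "linear (br x)"
  using bounded_bilinear.bounded_linear_right[OF br_bilinear] bounded_linear.linear by blast

lemma br_pow_linear: "linear (br x ^^ N)"
proof (induction N)
  case 0 then show ?case by (simp add: linear_id[unfolded id_def] id_def)
next
  case (Suc N) then show ?case using linear_compose[OF Suc br_linear] by (simp add: comp_def)
qed

text \<open>All weights being positive, each bracket with \<open>x\<close> raises the weight by at
  least 1. Above weight \<open>r\<close> nothing is left, so power series in the bracket with
  \<open>x\<close> may be cut off at \<open>r\<close>.\<close>

lemma br_pow_weight: "w k < w j + N \<Longrightarrow> (br x ^^ N) (axis j 1) $ k = 0"
proof (induction N arbitrary: k)
  case 0 then show ?case by (auto simp: axis_def)
next
  case (Suc N)
  have "(if w k = w i + w l then L i l k * x $ i * (br x ^^ N) (axis j 1) $ l else 0) = 0" for i l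
    using Suc.IH[of l] Suc.prems w(1)[of i] by auto
  then show ?case by (simp add: br_nth)
qed

lemma br_pow_zero: "r \<le> N \<Longrightarrow> (br x ^^ N) (axis j 1) = 0"
proof -
  assume "r \<le> N"
  then have "w k < w j + N" for k using w(1)[of j] w(2)[of k] by linarith
  then show ?thesis by (simp add: vec_eq_iff br_pow_weight)
qed

lemma br_scale: "(br (s *\<^sub>R x) ^^ N) v = s ^ N *\<^sub>R (br x ^^ N) v"
proof (induction N)
  case (Suc N)
  interpret bounded_bilinear br by (rule br_bilinear)
  show ?case using Suc by (simp add: scaleR_left scaleR_right)
qed simp

lemma br_dil: "br (dil w t x) (dil w t y) = dil w t (br x y)"
  unfolding vec_eq_iff dil_nth br_nth sum_distrib_left
  by (intro allI sum.cong refl) (auto simp: power_add)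

lemma br_dil_pow: "(br (dil w t x) ^^ N) (dil w t y) = dil w t ((br x ^^ N) y)"
  by (induction N) (simp_all add: br_dil)

definition Z :: "'n \<Rightarrow> (real, 'n) vec \<Rightarrow> (real, 'n) vec" where
  "Z j x = (\<Sum>N<r. left_trans_coeff N *\<^sub>R (br x ^^ N) (axis j 1))"

lemma left_inv_field_eq_Z: "left_inv_field (dynkin_product r br) (axis j 1) = Z j"
  by (rule ext) (simp add: Z_def left_inv_field_dynkin[OF br_bilinear br_alt])

lemma br_pow_smooth: "smooth_on UNIV (\<lambda>x. (br x ^^ N) v $ k)"
proof (induction N arbitrary: k)
  case (Suc N)
  have "smooth_on UNIV (\<lambda>x. if w k = w i + w j then L i j k * x $ i * (br x ^^ N) v $ j else 0)" for i j
    using Suc by (cases "w k = w i + w j") (auto intro!: smooth_on_mult)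
  then show ?case unfolding funpow.simps comp_def br_nth by (intro smooth_on_sum) auto
qed simp

lemma Z_nth: "Z j x $ k = (\<Sum>N<r. left_trans_coeff N * (br x ^^ N) (axis j 1) $ k)"
  by (simp add: Z_def)

lemma Z_smooth: "smooth_on UNIV (Z j)"
  unfolding smooth_on_vec_iff[OF open_UNIV] Z_nth
  by (intro allI smooth_on_sum smooth_on_mult br_pow_smooth smooth_on_const) auto

text \<open>Dilations are compatible with the graded bracket and multiply the basis vector
  \<open>j\<close> by \<open>t ^ w j\<close>.\<close>

lemma Z_homogeneous: "t ^ w j * Z j (dil w t x) $ k = t ^ w k * Z j x $ k"
proof -
  have "dil w t (axis j 1) = t ^ w j *\<^sub>R axis j 1" by (simp add: vec_eq_iff axis_def)
  moreover have "linear (br (dil w t x) ^^ N)" for N by (rule br_pow_linear)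
  ultimately have "t ^ w j *\<^sub>R (br (dil w t x) ^^ N) (axis j 1) = dil w t ((br x ^^ N) (axis j 1))" for N
    using br_dil_pow[where t = t and x = x and N = N and y = "axis j 1"]
      linear_cmul[of "br (dil w t x) ^^ N" "t ^ w j" "axis j 1"] by simp
  then have "t ^ w j * (br (dil w t x) ^^ N) (axis j 1) $ k = t ^ w k * (br x ^^ N) (axis j 1) $ k" for N
    by (metis dil_nth real_scaleR_def vector_scaleR_component)
  then show ?thesis unfolding Z_nth sum_distrib_left by (intro sum.cong refl) (simp add: mult.left_commute)
qed

text \<open>\<open>Z l x\<close> is the image of the basis vector \<open>l\<close> under a power
  series in the bracket with \<open>x\<close>, so by linearity the sum is the image of
  \<open>u\<close>. In this way the matrix products of the Riccati equation become products of power
  series.\<close>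

lemma sum_Z_eq: "(\<Sum>l\<in>UNIV. u $ l * Z l x $ k) = (\<Sum>N<r. left_trans_coeff N * (br x ^^ N) u $ k)"
proof -
  have u: "(br x ^^ N) u $ k = (\<Sum>l\<in>UNIV. u $ l * (br x ^^ N) (axis l 1) $ k)" for N
  proof -
    have "u = (\<Sum>l\<in>UNIV. u $ l *\<^sub>R axis l 1)" by (simp add: basis_expansion flip: scalar_mult_eq_scaleR)
    then have "(br x ^^ N) u = (br x ^^ N) (\<Sum>l\<in>UNIV. u $ l *\<^sub>R axis l 1)" by simp
    also have "\<dots> = (\<Sum>l\<in>UNIV. u $ l *\<^sub>R (br x ^^ N) (axis l 1))"
      by (simp only: linear_sum[OF br_pow_linear] linear_cmul[OF br_pow_linear])
    finally show ?thesis by simp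
  qed
  have "(\<Sum>l\<in>UNIV. u $ l * Z l x $ k) = (\<Sum>l\<in>UNIV. \<Sum>N<r. left_trans_coeff N * (u $ l * (br x ^^ N) (axis l 1) $ k))"
    by (simp add: Z_nth sum_distrib_left mult_ac)
  also have "\<dots> = (\<Sum>N<r. left_trans_coeff N * (\<Sum>l\<in>UNIV. u $ l * (br x ^^ N) (axis l 1) $ k))"
    unfolding sum_distrib_left by (rule sum.swap)
  finally show ?thesis by (simp add: u)
qed

lemma sum_br_Z: "(\<Sum>l\<in>UNIV. br x (axis j 1) $ l * Z l x $ k) =
    (\<Sum>N<r. (if N = 0 then 0 else left_trans_coeff (N - 1)) * (br x ^^ N) (axis j 1) $ k)"
proof -
  let ?g = "\<lambda>N. (if N = 0 then 0 else left_trans_coeff (N - 1)) * (br x ^^ N) (axis j 1) $ k"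
  have "(\<Sum>l\<in>UNIV. br x (axis j 1) $ l * Z l x $ k) = (\<Sum>N<r. ?g (Suc N))"
    unfolding sum_Z_eq by (simp add: funpow_swap1)
  also have "\<dots> = (\<Sum>N<Suc r. ?g N)" unfolding sum.lessThan_Suc_shift by simp
  also have "\<dots> = (\<Sum>N<r. ?g N)" using br_pow_zero[of r x j] by simp
  finally show ?thesis .
qed

lemma sum_Z_Z: "(\<Sum>l\<in>UNIV. Z j x $ l * Z l x $ k) =
    (\<Sum>N<r. (\<Sum>i=0..N. left_trans_coeff i * left_trans_coeff (N - i)) * (br x ^^ N) (axis j 1) $ k)"
proof -
  let ?c = left_trans_coeff and ?P = "\<lambda>N. (br x ^^ N) (axis j 1) $ k"
  have "(br x ^^ N) (Z j x) = (\<Sum>i<r. ?c i *\<^sub>R (br x ^^ (N + i)) (axis j 1))" for N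
    unfolding Z_def by (simp add: linear_sum[OF br_pow_linear] linear_cmul[OF br_pow_linear] funpow_add)
  then have "(\<Sum>l\<in>UNIV. Z j x $ l * Z l x $ k) = (\<Sum>N<r. \<Sum>i<r. ?c N * ?c i * ?P (N + i))"
    unfolding sum_Z_eq by (simp add: sum_distrib_left mult.assoc)
  also have "\<dots> = (\<Sum>(N, i)\<in>{..<r} \<times> {..<r}. ?c N * ?c i * ?P (N + i))"
    by (rule sum.cartesian_product)
  \<comment> \<open>Terms with \<open>N + i \<ge> r\<close> vanish by nilpotency, which makes the
    truncated product a Cauchy product.\<close>
  also have "\<dots> = (\<Sum>(N, i)\<in>{(N, i). N + i < r}. ?c N * ?c i * ?P (N + i))"
  proof (rule sum.mono_neutral_right)
    show "\<forall>p\<in>{..<r} \<times> {..<r} - {(N, i). N + i < r}. (case p of (N, i) \<Rightarrow> ?c N * ?c i * ?P (N + i)) = 0"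
    proof
      fix p assume "p \<in> {..<r} \<times> {..<r} - {(N, i). N + i < r}"
      then obtain N i where "p = (N, i)" "r \<le> N + i" by (cases p) auto
      then show "(case p of (N, i) \<Rightarrow> ?c N * ?c i * ?P (N + i)) = 0" using br_pow_zero[of "N + i" x j] by simp
    qed
  qed auto
  also have "\<dots> = (\<Sum>N<r. \<Sum>i\<le>N. ?c i * ?c (N - i) * ?P (i + (N - i)))"
    by (rule sum.triangle_reindex)
  also have "\<dots> = (\<Sum>N<r. (\<Sum>i=0..N. ?c i * ?c (N - i)) * ?P N)"
    by (simp add: sum_distrib_right atMost_atLeast0)
  finally show ?thesis .
qed

text \<open>The term with \<open>br x ^^ N\<close> is homogeneous of degree \<open>N\<close> in
  \<open>x\<close>, so radial integration divides it by \<open>N + 1\<close>. The equation then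
  reduces to the recursion \<open>left_trans_coeff_rec\<close> for the coefficients.\<close>

lemma Z_riccati:
  assumes "r \<ge> 1"
  shows "riccati UNIV (\<lambda>j k x. br x (axis j 1) $ k) (\<lambda>j k x. Z j x $ k - (if j = k then 1 else 0))"
  unfolding riccati_def
proof (intro allI conjI ballI)
  let ?A = "\<lambda>j k x. br x (axis j 1) $ k" and ?\<delta> = "\<lambda>j k. if j = k then 1 else 0 :: real"
  let ?C = "\<lambda>j k x. Z j x $ k - ?\<delta> j k" and ?c = left_trans_coeff
  fix j k x
  show "smooth_on UNIV (?A j k)" using br_pow_smooth[where N = 1 and v = "axis j 1" and k = k] by simp
  show "smooth_on UNIV (?C j k)"
    using Z_smooth[of j] by (intro smooth_on_diff smooth_on_const) (auto simp: smooth_on_vec_iff[OF open_UNIV])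
  interpret bounded_bilinear br by (rule br_bilinear)
  show "?A j k 0 = 0" by (simp add: zero_left)
  have "Z j 0 $ k = (\<Sum>N<r. if N = 0 then axis j 1 $ k else 0)"
    unfolding Z_nth
  proof (intro sum.cong refl)
    fix N
    show "?c N * (br 0 ^^ N) (axis j 1) $ k = (if N = 0 then axis j 1 $ k else 0)"
      using br_scale[where s = 0 and x = 0 and N = N and v = "axis j 1"]
      by (auto simp: left_trans_coeff_0 power_0_left)
  qed
  then show "?C j k 0 = 0" using assms by (simp add: sum.delta axis_def)
  have R: "?A j k y + (\<Sum>l\<in>UNIV. ?A j l y * ?C l k y) - (\<Sum>l\<in>UNIV. ?C j l y * ?C l k y) =
     (\<Sum>N<r. real (N + 1) * ?c N * (br y ^^ N) (axis j 1) $ k) - ?\<delta> j k" for y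
  proof -
    have 1: "?A j k y + (\<Sum>l\<in>UNIV. ?A j l y * ?C l k y) = (\<Sum>l\<in>UNIV. br y (axis j 1) $ l * Z l y $ k)"
      unfolding right_diff_distrib sum_subtractf sum_mult_delta by simp
    have 2: "(\<Sum>l\<in>UNIV. ?C j l y * ?C l k y) = (\<Sum>l\<in>UNIV. Z j y $ l * Z l y $ k) - 2 * Z j y $ k + ?\<delta> j k"
      unfolding right_diff_distrib left_diff_distrib sum_subtractf sum_mult_delta by simp
    \<comment> \<open>The summand \<open>2 * ?c N\<close> matches the mixed term in the square of Z
      - 1.\<close>
    have "real (N + 1) * ?c N = (if N = 0 then 0 else ?c (N - 1)) - (\<Sum>i=0..N. ?c i * ?c (N - i)) + 2 * ?c N" for N
      using left_trans_coeff_rec[of N] by (simp add: algebra_simps)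
    then have "(\<Sum>N<r. real (N + 1) * ?c N * (br y ^^ N) (axis j 1) $ k) =
      (\<Sum>N<r. (if N = 0 then 0 else ?c (N - 1)) * (br y ^^ N) (axis j 1) $ k) -
      (\<Sum>N<r. (\<Sum>i=0..N. ?c i * ?c (N - i)) * (br y ^^ N) (axis j 1) $ k) + 2 * Z j y $ k"
      unfolding Z_nth sum_distrib_left sum_subtractf[symmetric] sum.distrib[symmetric]
      by (intro sum.cong refl) (simp only: ring_distribs mult.assoc)
    then show ?thesis unfolding 1 2 sum_br_Z sum_Z_Z by simp
  qed
  show "?C j k x = radial_int 0 (\<lambda>y. ?A j k y + (\<Sum>l\<in>UNIV. ?A j l y * ?C l k y) - (\<Sum>l\<in>UNIV. ?C j l y * ?C l k y)) x"
  proof -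
    let ?F = "\<lambda>s. (\<Sum>N<r. ?c N * (br x ^^ N) (axis j 1) $ k * s ^ (N + 1)) - ?\<delta> j k * s"
    have "((\<lambda>s. (\<Sum>N<r. real (N + 1) * ?c N * (br (s *\<^sub>R x) ^^ N) (axis j 1) $ k) - ?\<delta> j k) has_integral ?F 1 - ?F 0) {0..1}"
    proof (rule fundamental_theorem_of_calculus)
      show "(?F has_vector_derivative (\<Sum>N<r. real (N + 1) * ?c N * (br (s *\<^sub>R x) ^^ N) (axis j 1) $ k) - ?\<delta> j k) (at s within {0..1})" for s
        unfolding has_real_derivative_iff_has_vector_derivative[symmetric] br_scale
        by (rule derivative_eq_intros refl)+ (auto intro!: sum.cong simp: mult_ac)
    qed simp
    then show ?thesis unfolding R unfolding radial_int_def Z_nth by (auto dest: integral_unique)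
  qed
qed

end


lemma riccati_subset: "riccati T A C \<Longrightarrow> S \<subseteq> T \<Longrightarrow> riccati S A C"
  unfolding riccati_def by (intro allI) (auto intro: smooth_on_subset)

section \<open>Canonical coordinates are Carnot coordinates\<close>

context canonical_chart
begin

text \<open>Applying \<open>X i\<close> lowers the weighted order by at most \<open>w i\<close>: the
  partial derivative in direction \<open>k\<close> costs \<open>w k\<close>, and its coefficient
  \<open>B i k\<close> gives back \<open>w k - w i\<close>. The function \<open>g\<close> is the
  iterated derivative read in the chart.\<close>

lemma iter_app_vanish:
  assumes vanB: "\<And>ds j k. wsum w ds + w j < w k \<Longrightarrow> partials ds (B j k) 0 = 0"
  shows "\<exists>g. smooth_on S g \<and> (\<forall>x\<in>S. iter_app X I (\<lambda>q. snd c q $ j) (chart_inv c x) = g x) \<and>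
    (\<forall>ds. wsum w ds + wsum w I < w j \<longrightarrow> partials ds g 0 = 0)"
proof (induction I)
  case Nil
  have "partials ds (\<lambda>x. x $ j) 0 = 0" if "wsum w ds < w j" for ds
    using partials_nth_at_0[of ds j] that by fastforce
  moreover have "iter_app X [] (\<lambda>q. snd c q $ j) (chart_inv c x) = x $ j" if "x \<in> S" for x
    using chart_inv_right[of x c] \<rho>(2) that by (auto simp: iter_app_def)
  ultimately show ?case by (intro exI[of _ "\<lambda>x. x $ j"]) auto
next
  case (Cons i I)
  define F where "F = iter_app X I (\<lambda>q. snd c q $ j)"
  obtain g where g: "smooth_on S g" "\<And>x. x \<in> S \<Longrightarrow> F (chart_inv c x) = g x"
    "\<And>ds. wsum w ds + wsum w I < w j \<Longrightarrow> partials ds g 0 = 0"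
    using Cons unfolding F_def by blast
  have gd: "smooth_on S (dir_deriv v g)" for v by (rule smooth_on_dir_deriv[OF g(1)])
  have "iter_app X (i # I) (\<lambda>q. snd c q $ j) (chart_inv c x) = (\<Sum>k\<in>UNIV. B i k x * dir_deriv (axis k 1) g x)"
    if x: "x \<in> S" for x
  proof -
    have q: "chart_inv c x \<in> fst c" "chart_inv c x \<in> U" "snd c (chart_inv c x) = x"
      using \<rho>(2) x chart_inv_left[OF smooth_chartD[OF c]] by auto
    have eq: "smooth_on S (\<lambda>x. F (chart_inv c x)) \<longleftrightarrow> smooth_on S g"
      by (rule smooth_on_cong[OF open_ball g(2)])
    have "smooth_near A (chart_inv c x) F"
      unfolding smooth_near_chart_iff[OF A c q(1)] q(3)
      by (intro exI[of _ S]) (use x \<rho>(2) g(1) eq in auto)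
    from tangent_chart[OF A c q(1) X_tangent[OF q(2)] this, of i]
    have "iter_app X (i # I) (\<lambda>q. snd c q $ j) (chart_inv c x) =
        (\<Sum>k\<in>UNIV. B i k x * dir_deriv (axis k 1) (\<lambda>x. F (chart_inv c x)) x)"
      by (simp add: q(3) iter_app_def app_def F_def B_def coord_field_def)
    then show ?thesis
      using frechet_derivative_cong_open[OF open_ball x g(2)] by simp
  qed
  moreover have "partials ds (\<lambda>x. \<Sum>k\<in>UNIV. B i k x * dir_deriv (axis k 1) g x) 0 = 0"
    if ds: "wsum w ds + wsum w (i # I) < w j" for ds
  proof -
    have "partials ds (\<lambda>x. B i k x * dir_deriv (axis k 1) g x) 0 = 0" for k
    proof (rule partials_mult_zero[OF open_ball zero_S B_smooth gd, where w = w])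
      fix p q assume pq: "length p + length q = length ds" "wsum w p + wsum w q = wsum w ds"
      have "partials q (dir_deriv (axis k 1) g) = partials (q @ [k]) g" by (simp add: partials_append)
      then show "partials p (B i k) 0 = 0 \<or> partials q (dir_deriv (axis k 1) g) 0 = 0"
        using vanB[of p i k] g(3)[of "q @ [k]"] pq ds by fastforce
    qed
    then show ?thesis
      using partials_sum[OF open_ball _ zero_S, of UNIV "\<lambda>k x. B i k x * dir_deriv (axis k 1) g x" ds]
        smooth_on_mult[OF open_ball B_smooth gd] by simp
  qed
  ultimately show ?case
    by (intro exI[of _ "\<lambda>x. \<Sum>k\<in>UNIV. B i k x * dir_deriv (axis k 1) g x"])
      (auto intro!: smooth_on_sum smooth_on_mult B_smooth gd)
qed

lemma a_eq: "chart_inv c 0 = a"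
  using chart_inv_left[OF smooth_chartD[OF c] c_a(1)] c_a(2) by simp

lemma privileged_if:
  assumes vanB: "\<And>ds j k. wsum w ds + w j < w k \<Longrightarrow> partials ds (B j k) 0 = 0"
  shows "privileged A w X a c"
  unfolding privileged_def
proof (intro conjI allI)
  show "centered_chart A a c" using canonical by (simp add: canonical_coords_1_def)
  show "coord_field c (X j) 0 = axis j 1" for j
    using B_0[of j] by (auto simp: B_def vec_eq_iff axis_def)
  fix j
  show "has_order w X a (\<lambda>p. snd c p $ j) (w j)"
    unfolding has_order_def
  proof (intro conjI allI impI)
    fix I assume I: "wsum w I < w j"
    obtain g where g: "\<forall>x\<in>S. iter_app X I (\<lambda>q. snd c q $ j) (chart_inv c x) = g x"
      "\<forall>ds. wsum w ds + wsum w I < w j \<longrightarrow> partials ds g 0 = 0"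
      using iter_app_vanish[OF vanB, of I j] by blast
    have "g 0 = 0" using g(2)[rule_format, of "[]"] I by simp
    then have "iter_app X I (\<lambda>q. snd c q $ j) (chart_inv c 0) = 0" using g(1) zero_S by simp
    then show "iter_app X I (\<lambda>p. snd c p $ j) a = 0" by (simp add: a_eq)
  next
    have "iter_app X [j] (\<lambda>p. snd c p $ j) a = B j j 0"
      by (simp add: iter_app_def app_def B_def coord_field_def a_eq)
    then show "\<exists>I. wsum w I = w j \<and> iter_app X I (\<lambda>p. snd c p $ j) a \<noteq> 0"
      by (intro exI[of _ "[j]"]) (simp add: B_0)
  qed
qed

text \<open>\<open>A1\<close> and \<open>A2\<close> are the coefficients of the Riccati equations of
  the frame and of the model. Their difference vanishes up to the critical weight: there
  \<open>L i j k\<close> enters only through its value at 0, and only for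
  \<open>w k = w i + w j\<close>.\<close>

lemma carnot_coordinates: "carnot_coords A r H X a c"
proof (rule structure_functions_in_chart[OF c])
  fix L assume L: "\<And>i j l. smooth_on (snd c ` (U \<inter> fst c)) (L i j l)"
    "\<And>i j k x. x \<in> snd c ` (U \<inter> fst c) \<Longrightarrow> (\<Sum>l\<in>UNIV. L i j l x * coord_field c (X l) x $ k) =
       (\<Sum>m\<in>UNIV. coord_field c (X i) x $ m * dir_deriv (axis m 1) (\<lambda>x. coord_field c (X j) x $ k) x) -
       (\<Sum>m\<in>UNIV. coord_field c (X j) x $ m * dir_deriv (axis m 1) (\<lambda>x. coord_field c (X i) x $ k) x)"
    "\<And>i j l x. x \<in> snd c ` (U \<inter> fst c) \<Longrightarrow> w l > w i + w j \<Longrightarrow> L i j l x = 0"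
    "\<And>i j l p. p \<in> U \<Longrightarrow> p \<in> fst c \<Longrightarrow> w i + w j \<le> r \<Longrightarrow> structure_fun A X i j l p = L i j l (snd c p)"
    "\<And>i j l x. x \<in> snd c ` (U \<inter> fst c) \<Longrightarrow> L i j l x = - L j i l x"
  have SL: "smooth_on S (L i j l)" for i j l by (rule smooth_on_subset[OF L(1) \<rho>(2)])
  have L0: "structure_fun A X i j l a = L i j l 0" if "w i + w j \<le> r" for i j l
    using L(4)[OF a c_a(1) that] by (simp add: c_a)
  define Lg where "Lg i j l = structure_fun A X i j l a" for i j l
  have zero: "0 \<in> snd c ` (U \<inter> fst c)" using zero_S \<rho>(2) by blast
  interpret G: graded_algebra w r Lg
  proof
    show "1 \<le> w j" "w j \<le> r" for j by (rule wt_bounds)+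
    \<comment> \<open>As \<open>w k \<le> r\<close>, also \<open>w i + w j \<le> r\<close>, and in
      this range \<open>structure_fun\<close> agrees with the antisymmetric
      \<open>L\<close>.\<close>
    show "Lg i j k = - Lg j i k" if "w k = w i + w j" for i j k
      using that wt_bounds(2)[of k] L(5)[OF zero, of i j k] L0[of i j k] L0[of j i k] by (simp add: Lg_def add.commute)
  qed
  define A1 where "A1 j k x = (\<Sum>i\<in>UNIV. x $ i * L i j k x)" for j k and x :: "(real, 'n) vec"
  define A2 where "A2 j k x = (\<Sum>i\<in>UNIV. x $ i * (if w k = w i + w j then Lg i j k else 0))" for j k and x :: "(real, 'n) vec"
  define C2 where "C2 j k x = G.Z j x $ k - (if j = k then 1 else 0)" for j k x
  have r1: "riccati S A1 C"
    unfolding A1_def[abs_def]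
  proof (rule C_riccati[OF SL])
    fix i j k x assume "x \<in> S"
    then have "x \<in> snd c ` (U \<inter> fst c)" using \<rho>(2) by blast
    from L(2)[OF this, of i j k]
    show "(\<Sum>l\<in>UNIV. L i j l x * B l k x) =
       (\<Sum>m\<in>UNIV. B i m x * dir_deriv (axis m 1) (B j k) x) - (\<Sum>m\<in>UNIV. B j m x * dir_deriv (axis m 1) (B i k) x)"
      unfolding B_def[abs_def] .
  qed
  have br: "G.br x (axis j 1) $ k = A2 j k x" for j k x
  proof -
    have "(\<Sum>l\<in>UNIV. if w k = w i + w l then Lg i l k * x $ i * axis j 1 $ l else 0) =
        x $ i * (if w k = w i + w j then Lg i j k else 0)" for i
    proof -
      have "(\<Sum>l\<in>UNIV. if w k = w i + w l then Lg i l k * x $ i * axis j 1 $ l else 0) =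
         (\<Sum>l\<in>UNIV. (if w k = w i + w l then Lg i l k * x $ i else 0) * (if l = j then 1 else 0))"
        by (intro sum.cong refl) (auto simp: axis_def)
      then show ?thesis unfolding sum_mult_delta by simp
    qed
    then show ?thesis by (simp add: G.br_nth A2_def)
  qed
  have r2: "riccati S A2 C2"
    using riccati_subset[OF G.Z_riccati[OF r] subset_UNIV, of S] unfolding br C2_def[abs_def] .
  have van1: "partials ds (A1 j k) 0 = 0" if "wsum w ds + w j < w k" for ds j k
    unfolding A1_def
  proof (rule partials_coord_sum_zero[OF open_ball zero_S SL, where w = w])
    fix i q assume "wsum w q + w i = wsum w ds"
    then have "w i + w j < w k" using that by linarith
    then have "L i j k x = 0" if "x \<in> S" for x using L(3) \<rho>(2) that by blast
    then show "partials q (L i j k) 0 = 0"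
      using partials_cong[OF open_ball _ zero_S, of "L i j k" "\<lambda>_. 0" q] by simp
  qed
  have van2: "partials ds (A2 j k) 0 = 0" if "wsum w ds + w j < w k" for ds j k
    unfolding A2_def
  proof (rule partials_coord_sum_zero[OF open_ball zero_S smooth_on_const, where w = w])
    fix i q assume "wsum w q + w i = wsum w ds"
    then have "w k \<noteq> w i + w j" using that by linarith
    then show "partials q (\<lambda>x. if w k = w i + w j then Lg i j k else 0) 0 = 0" by simp
  qed
  have vanD: "partials ds (\<lambda>x. A1 j k x - A2 j k x) 0 = 0" if ds: "wsum w ds + w j \<le> w k" for ds j k
  proof -
    define f where "f i x = L i j k x - (if w k = w i + w j then Lg i j k else 0)" for i x
    have "(\<lambda>x. A1 j k x - A2 j k x) = (\<lambda>x. \<Sum>i\<in>UNIV. x $ i * f i x)"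
      by (simp add: A1_def A2_def f_def right_diff_distrib sum_subtractf)
    moreover have "partials ds (\<lambda>x. \<Sum>i\<in>UNIV. x $ i * f i x) 0 = 0"
    proof (rule partials_coord_sum_zero[OF open_ball zero_S, where w = w])
      show "smooth_on S (f i)" for i unfolding f_def by (intro smooth_on_diff SL smooth_on_const) auto
      fix i q assume q: "wsum w q + w i = wsum w ds"
      show "partials q (f i) 0 = 0"
      proof (cases "w k = w i + w j")
        case True
        \<comment> \<open>The factor \<open>x $ i\<close> uses up all the weight available. Weights
          being positive, no derivative is left for \<open>f i\<close>, and \<open>f i 0\<close> is
          zero.\<close>
        then have "wsum w q = 0" using q ds by linarith
        have "q = []"
        proof (cases q)
          case (Cons b bs)
          then show ?thesis using \<open>wsum w q = 0\<close> wt_bounds(1)[of b] by simp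
        qed
        then show ?thesis using True L0[of i j k] wt_bounds(2)[of k] by (simp add: f_def Lg_def)
      next
        case False
        then have "w i + w j < w k" using q ds by linarith
        then have "f i x = 0" if "x \<in> S" for x using L(3) \<rho>(2) that False by (auto simp: f_def)
        then show ?thesis
          using partials_cong[OF open_ball _ zero_S, of "f i" "\<lambda>_. 0" q] by simp
      qed
    qed
    ultimately show ?thesis by simp
  qed
  have vanC: "partials ds (C j k) 0 = 0" if "wsum w ds + w j < w k" for ds j k
    by (rule riccati_vanish[OF open_ball star0_ball zero_S r1 van1 that])
  have vanB: "partials ds (B j k) 0 = 0" if "wsum w ds + w j < w k" for ds j k
  proof -
    have "j \<noteq> k" using that by auto
    then have "B j k = C j k" by (auto simp: C_def)
    then show ?thesis using vanC[OF that] by simp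
  qed
  have vanBZ: "partials ds (\<lambda>x. coord_field c (X j) x $ k - G.Z j x $ k) 0 = 0" if "wsum w ds + w j \<le> w k" for ds j k
  proof -
    have "(\<lambda>x. coord_field c (X j) x $ k - G.Z j x $ k) = (\<lambda>x. C j k x - C2 j k x)"
      by (simp add: C_def C2_def B_def)
    then show ?thesis
      using riccati_diff_vanish[OF open_ball star0_ball zero_S r1 r2 van1 van2 vanD that] by simp
  qed
  have "model_field w X c j (G.Z j)" for j
    unfolding model_field_def
  proof (intro allI impI)
    fix K :: "(real, 'n) vec set" and ds :: "'n list" assume K: "compact K"
    show "uniform_limit K (\<lambda>t. partials ds (\<lambda>x. t ^ w j *\<^sub>R dil_pullback w t (coord_field c (X j)) x))
        (partials ds (G.Z j)) (at 0)"
    proof (rule uniform_limit_dil_pullback[OF \<rho>(1) wt_bounds(1) _ G.Z_smooth G.Z_homogeneous vanBZ K])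
      show "smooth_on S (coord_field c (X j))"
        using B_smooth unfolding smooth_on_vec_iff[OF open_ball] B_def by blast
    qed
  qed
  then show ?thesis
    using privileged_if[OF vanB] G.left_inv_field_eq_Z
    by (simp add: carnot_coords_def tangent_group_mult_def Lg_def[abs_def])
qed

end

text \<open>The other composition of the two inverse operations: 1 + E is applied after the radial
  integration. Moving E under the integral sign reduces it to \<open>radial_int_euler\<close>. It
  turns the integral equation of the Picard iteration into the differential equation along
  rays.\<close>

lemma dir_deriv_radial_euler:
  fixes f :: "'a::euclidean_space \<Rightarrow> real"
  assumes S: "open S" "star0 S" and f: "Ck_on 1 S f" and x: "x \<in> S"
  shows "radial_int 0 f x + dir_deriv x (radial_int 0 f) x = f x"
proof -
  have lin: "dir_deriv (s *\<^sub>R x) f y = s * dir_deriv x f y" if "y \<in> S" for y s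
    using linear_cmul[OF has_derivative_linear[OF Ck_has_derivative[of 0 S f y]]] f that by simp
  have cont: "continuous_on S f" "continuous_on S (dir_deriv x f)"
    using Ck_on_imp_continuous[OF f] f by simp_all
  have "integral {0..1} (\<lambda>s. s ^ 0 * f (s *\<^sub>R x)) + integral {0..1} (\<lambda>s. s ^ 1 * dir_deriv x f (s *\<^sub>R x)) =
      integral {0..1} (\<lambda>s. s ^ 0 * f (s *\<^sub>R x) + s ^ 1 * dir_deriv x f (s *\<^sub>R x))"
    by (rule integral_add[symmetric]) (rule radial_integrable[OF S(2) cont(1) x] radial_integrable[OF S(2) cont(2) x])+
  also have "\<dots> = radial_int 0 (\<lambda>y. f y + dir_deriv y f y) x"
    unfolding radial_int_def by (rule integral_cong) (simp add: lin star0D[OF S(2) x])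
  also have "\<dots> = f x" by (rule radial_int_euler[OF S(2) f x])
  finally show ?thesis
    using dir_deriv_radial_int[OF S f x, where v = x and m = 0] by (simp add: radial_int_def)
qed

text \<open>The derivative of \<open>g\<close> at \<open>y\<close> is \<open>N (g y)\<close>, with
  \<open>N\<close> the smooth inverse of the Jacobian. If \<open>g\<close> is k times continuously
  differentiable then so is this expression; the induction starts from the continuity of
  \<open>g\<close>.\<close>

lemma smooth_inverse_function:
  fixes f :: "real^'n \<Rightarrow> real^'n"
  assumes "open S" "x0 \<in> S" "smooth_on S f" and inj: "\<And>v. dir_deriv v f x0 = 0 \<Longrightarrow> v = 0"
  obtains W V g where "open W" "W \<subseteq> S" "x0 \<in> W" "open V" "f x0 \<in> V" "homeomorphism W V f g" "smooth_on V g"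
proof -
  have D: "(f has_derivative (\<lambda>v. dir_deriv v f x)) (at x)" if "x \<in> S" for x
    by (rule smooth_on_has_derivative[OF assms(3) that])
  define f' where "f' x = Blinfun (\<lambda>v. dir_deriv v f x)" for x
  have f': "blinfun_apply (f' x) = (\<lambda>v. dir_deriv v f x)" if "x \<in> S" for x
    unfolding f'_def by (rule bounded_linear_Blinfun_apply[OF has_derivative_bounded_linear[OF D[OF that]]])
  have cont: "continuous_on S f'"
  proof (rule continuous_on_blinfun_componentwise)
    fix i :: "real^'n"
    show "continuous_on S (\<lambda>x. blinfun_apply (f' x) i)"
      by (rule continuous_on_eq[OF smooth_on_continuous[OF smooth_on_dir_deriv[OF assms(3)], of i]]) (simp add: f')
  qed
  have lin0: "linear (\<lambda>v. dir_deriv v f x0)" using has_derivative_linear[OF D[OF assms(2)]] .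
  have "inj (\<lambda>v. dir_deriv v f x0)" using linear_injective_0[OF lin0] inj by blast
  then obtain h where h: "linear h" "h \<circ> (\<lambda>v. dir_deriv v f x0) = id"
    using linear_injective_left_inverse[OF lin0] by blast
  have "Blinfun h o\<^sub>L f' x0 = id_blinfun"
  proof (rule blinfun_eqI)
    fix v
    have "bounded_linear h" using h(1) by (simp add: linear_conv_bounded_linear)
    then show "blinfun_apply (Blinfun h o\<^sub>L f' x0) v = blinfun_apply id_blinfun v"
      using h(2) by (simp add: bounded_linear_Blinfun_apply f'[OF assms(2)] fun_eq_iff)
  qed
  then obtain W V g g' where W: "open W" "W \<subseteq> S" "x0 \<in> W" "open V" "f x0 \<in> V" "homeomorphism W V f g"
    and g': "\<And>y. y \<in> V \<Longrightarrow> (g has_derivative (g' y)) (at y)"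
      "\<And>y. y \<in> V \<Longrightarrow> g' y = inv (blinfun_apply (f' (g y)))"
      "\<And>y. y \<in> V \<Longrightarrow> bij (blinfun_apply (f' (g y)))"
    using inverse_function_theorem[OF assms(1) _ cont assms(2), of f "Blinfun h"] D f' by metis
  have gW: "g y \<in> W" if "y \<in> V" for y using W(6) that by (auto simp: homeomorphism_def)
  define J where "J x = (\<chi> k i. dir_deriv (axis i 1) f x $ k)" for x
  have J: "J x *v v = dir_deriv v f x" if "x \<in> S" for x v
    using dir_deriv_expand[OF smooth_on_differentiable[OF assms(3) that], of v]
    by (simp add: J_def matrix_vector_mult_def vec_eq_iff mult.commute)
  have "invertible (J x)" if x: "x \<in> W" for x
  proof -
    have xS: "x \<in> S" using x W by blast
    have "f x \<in> V" "g (f x) = x" using W(6) x by (auto simp: homeomorphism_def)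
    then have "bij (\<lambda>v. dir_deriv v f x)" using g'(3)[of "f x"] f'[OF xS] by simp
    moreover have "(*v) (J x) = (\<lambda>v. dir_deriv v f x)" using J[OF xS] by blast
    ultimately have "inj ((*v) (J x))" by (simp only: bij_is_inj)
    then show ?thesis using invertible_left_inverse matrix_left_invertible_injective by blast
  qed
  moreover have "smooth_on W (\<lambda>x. J x $ i $ j)" for i j
  proof -
    have "smooth_on S (dir_deriv (axis j 1) f)" by (rule smooth_on_dir_deriv[OF assms(3)])
    then have "smooth_on S (\<lambda>x. dir_deriv (axis j 1) f x $ i)"
      using smooth_on_vec_iff[OF assms(1), of "dir_deriv (axis j 1) f"] by simp
    then show ?thesis using smooth_on_subset W(2) by (auto simp: J_def)
  qed
  ultimately obtain N where N: "\<And>i j. smooth_on W (\<lambda>x. N x $ i $ j)" "\<And>x. x \<in> W \<Longrightarrow> J x ** N x = mat 1"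
    using smooth_matrix_inv[OF W(1), of J] by metis
  have Dg: "(g has_derivative (\<lambda>v. N (g y) *v v)) (at y)" if y: "y \<in> V" for y
  proof -
    have gS: "g y \<in> S" using gW[OF y] W by blast
    have "g' y v = N (g y) *v v" for v
      unfolding g'(2)[OF y]
    proof (rule inv_f_eq)
      show "inj (blinfun_apply (f' (g y)))" using g'(3)[OF y] by (simp add: bij_def)
      have "blinfun_apply (f' (g y)) (N (g y) *v v) = J (g y) *v (N (g y) *v v)"
        by (simp add: f'[OF gS] J[OF gS])
      also have "\<dots> = v" by (simp add: matrix_vector_mul_assoc N(2)[OF gW[OF y]])
      finally show "blinfun_apply (f' (g y)) (N (g y) *v v) = v" .
    qed
    then have "g' y = (\<lambda>v. N (g y) *v v)" by blast
    then show ?thesis using g'(1)[OF y] by simp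
  qed
  have "Ck_on k V g" for k
  proof (induction k)
    case 0 then show ?case using W(6) by (simp add: homeomorphism_def)
  next
    case (Suc k)
    show ?case
    proof (rule Ck_on_SucI[OF W(4) Dg])
      fix v
      have "Ck_on k V (\<lambda>y. \<Sum>l\<in>UNIV. N (g y) $ i $ l * v $ l)" for i
        by (intro Ck_on_sum Ck_on_mult W(4) Ck_on_const Ck_on_compose[OF W(4) W(1) smooth_on_Ck[OF N(1)] Suc])
          (use gW in auto)
      then show "Ck_on k V (\<lambda>y. N (g y) *v v)"
        unfolding Ck_on_vec_iff[OF W(4)] by (simp add: matrix_vector_mult_def)
    qed
  qed
  then show ?thesis using W by (intro that[of W V g]) (auto simp: smooth_on_def)
qed

section \<open>Existence of canonical coordinates\<close>

context carnot_frame
begin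

text \<open>A chart \<open>d\<close> around \<open>a\<close> is translated so that \<open>a\<close>
  goes to 0, and the time-one map \<phi> is constructed there. Its derivative at 0 takes
  \<open>v\<close> to the combination of the \<open>X i\<close> at \<open>a\<close> with
  coefficients \<open>v $ i\<close>, which is injective because the \<open>X i\<close> form a frame.
  The new chart is the translated \<open>d\<close> followed by the local inverse of \<phi>.\<close>

lemma canonical_chart_exists:
  assumes a: "a \<in> U"
  shows "\<exists>c. canonical_coords_1 A U X a c"
proof -
  obtain d where d: "d \<in> A" "smooth_chart A d" "a \<in> fst d" using smooth_manifold_chart_at[OF A] .
  note id = smooth_chartD[OF d(2)]
  define x0 where "x0 = snd d a"
  define T where "T = snd d ` (U \<inter> fst d)"
  have T: "open T" unfolding T_def by (rule chart_image_open[OF id]) (use U chart_open[OF id] in auto)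
  have shift: "smooth_on R (\<lambda>y. x0 + y)" "smooth_on R (\<lambda>y. y - x0)" if "open R" for R
    unfolding smooth_on_vec_iff[OF that] using that by (auto intro: smooth_on_add smooth_on_diff)
  define \<Omega> where "\<Omega> = (\<lambda>y. x0 + y) -` T"
  have \<Omega>: "open \<Omega>" unfolding \<Omega>_def by (intro open_vimage T continuous_intros)
  have zero: "0 \<in> \<Omega>" using a d(3) by (simp add: \<Omega>_def T_def x0_def)
  define V where "V i k y = coord_field d (X i) (x0 + y) $ k" for i k y
  have V: "smooth_on \<Omega> (V i k)" for i k
  proof -
    have "smooth_on T (\<lambda>z. coord_field d (X i) z $ k)"
      using smooth_coord_field[OF A X_smooth U d(2), of i] unfolding T_def[symmetric] smooth_on_vec_iff[OF T] by blast
    then show ?thesis unfolding V_def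
      by (rule smooth_on_compose[OF \<Omega> T _ shift(1)[OF \<Omega>]]) (auto simp: \<Omega>_def)
  qed
  have "\<exists>\<rho> \<phi>. \<rho> > 0 \<and> smooth_on (ball 0 \<rho>) \<phi> \<and> \<phi> ` ball 0 \<rho> \<subseteq> \<Omega> \<and>
      (\<forall>x\<in>ball 0 \<rho>. \<forall>k. \<phi> x $ k = (\<Sum>i\<in>UNIV. x $ i * radial_int 0 (\<lambda>y. V i k (\<phi> y)) x))"
    by (rule smooth_time_one_map[of \<Omega> V, OF \<Omega> zero V]) blast
  then obtain \<rho> \<phi> where \<rho>: "\<rho> > 0" and \<phi>: "smooth_on (ball 0 \<rho>) \<phi>" "\<phi> ` ball 0 \<rho> \<subseteq> \<Omega>"
    and eq: "\<And>x k. x \<in> ball 0 \<rho> \<Longrightarrow> \<phi> x $ k = (\<Sum>i\<in>UNIV. x $ i * radial_int 0 (\<lambda>y. V i k (\<phi> y)) x)"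
    by blast
  define S where "S = ball (0 :: (real, 'n) vec) \<rho>"
  have S: "open S" "star0 S" "0 \<in> S" using \<rho> by (auto simp: S_def)
  note \<phi> = \<phi>[folded S_def] and eq = eq[folded S_def]
  define f where "f i k y = V i k (\<phi> y)" for i k y
  have f: "smooth_on S (f i k)" for i k
    unfolding f_def by (rule smooth_on_compose[OF S(1) \<Omega> V \<phi>(1,2)])
  have deriv: "dir_deriv v \<phi> y $ k = (\<Sum>i\<in>UNIV. v $ i * radial_int 0 (f i k) y + y $ i * dir_deriv v (radial_int 0 (f i k)) y)"
    if y: "y \<in> S" for v y k
  proof -
    have dI: "radial_int 0 (f i k) differentiable at y" for i
      by (rule smooth_on_differentiable[OF smooth_on_radial_int[OF S(1,2) f] y])
    have "dir_deriv v \<phi> y $ k = dir_deriv v (\<lambda>x. \<phi> x $ k) y"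
      by (rule dir_deriv_component[symmetric, OF smooth_on_differentiable[OF \<phi>(1) y]])
    also have "\<dots> = dir_deriv v (\<lambda>x. \<Sum>i\<in>UNIV. x $ i * radial_int 0 (f i k) x) y"
      using frechet_derivative_cong_open[OF S(1) y eq] by (simp add: f_def[abs_def])
    also have "\<dots> = (\<Sum>i\<in>UNIV. y $ i * dir_deriv v (radial_int 0 (f i k)) y + v $ i * radial_int 0 (f i k) y)"
      using dI by (simp add: dir_deriv_sum dir_deriv_mult)
    finally show ?thesis by (simp add: add.commute)
  qed
  have \<phi>0: "\<phi> 0 = 0" using eq[OF S(3)] by (simp add: vec_eq_iff)
  have ray: "dir_deriv x \<phi> (t *\<^sub>R x) $ k = (\<Sum>i\<in>UNIV. x $ i * V i k (\<phi> (t *\<^sub>R x)))" if "t *\<^sub>R x \<in> S" for x t k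
  proof -
    have "x $ i * radial_int 0 (f i k) (t *\<^sub>R x) + (t *\<^sub>R x) $ i * dir_deriv x (radial_int 0 (f i k)) (t *\<^sub>R x) = x $ i * f i k (t *\<^sub>R x)" for i
    proof -
      have "linear (\<lambda>v. dir_deriv v (radial_int 0 (f i k)) (t *\<^sub>R x))"
        by (rule has_derivative_linear[OF smooth_on_has_derivative[OF smooth_on_radial_int[OF S(1,2) f] that]])
      \<comment> \<open>The factor \<open>t\<close> is moved into the direction of the derivative,
        so that \<open>dir_deriv_radial_euler\<close> applies for every \<open>t\<close>, including
        0.\<close>
      from linear_cmul[OF this, of t x]
      have "t * dir_deriv x (radial_int 0 (f i k)) (t *\<^sub>R x) = dir_deriv (t *\<^sub>R x) (radial_int 0 (f i k)) (t *\<^sub>R x)" by simp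
      moreover have "radial_int 0 (f i k) (t *\<^sub>R x) + dir_deriv (t *\<^sub>R x) (radial_int 0 (f i k)) (t *\<^sub>R x) = f i k (t *\<^sub>R x)"
        by (rule dir_deriv_radial_euler[OF S(1,2) smooth_on_Ck[OF f] that])
      ultimately have "radial_int 0 (f i k) (t *\<^sub>R x) + t * dir_deriv x (radial_int 0 (f i k)) (t *\<^sub>R x) = f i k (t *\<^sub>R x)" by simp
      then have "x $ i * f i k (t *\<^sub>R x) = x $ i * (radial_int 0 (f i k) (t *\<^sub>R x) + t * dir_deriv x (radial_int 0 (f i k)) (t *\<^sub>R x))"
        by simp
      then show ?thesis by (simp only: distrib_left vector_scaleR_component real_scaleR_def mult_ac)
    qed
    then show ?thesis unfolding deriv[OF that] by (simp add: f_def)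
  qed
  have inj: "v = 0" if "dir_deriv v \<phi> 0 = 0" for v
  proof -
    have "(\<Sum>i\<in>UNIV. v $ i * V i k 0) = 0" for k
      using ray[of 0 v k] S(3) that \<phi>0 by simp
    then have "(\<Sum>i\<in>UNIV. v $ i *s row i (\<chi> j k. coord_field d (X j) (snd d a) $ k)) = 0"
      by (simp add: vec_eq_iff row_def V_def x0_def)
    moreover have "invertible (\<chi> j k. coord_field d (X j) (snd d a) $ k)"
      by (rule frame_matrix_invertible[OF d(2) a d(3)])
    ultimately have "\<forall>i. v $ i = 0"
      unfolding invertible_right_inverse matrix_right_invertible_independent_rows by blast
    then show ?thesis by (simp add: vec_eq_iff)
  qed
  obtain W R g where W: "open W" "W \<subseteq> S" "0 \<in> W" "open R" "0 \<in> R" "homeomorphism W R \<phi> g" "smooth_on R g"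
    using smooth_inverse_function[OF S(1,3) \<phi>(1) inj] unfolding \<phi>0 .
  have W': "\<And>x. x \<in> W \<Longrightarrow> \<phi> x \<in> R" "\<And>x. x \<in> W \<Longrightarrow> g (\<phi> x) = x"
    "\<And>y. y \<in> R \<Longrightarrow> g y \<in> W" "\<And>y. y \<in> R \<Longrightarrow> \<phi> (g y) = y"
    using W(6) by (auto simp: homeomorphism_def)
  have in_T: "x0 + \<phi> x \<in> T" if "x \<in> S" for x using \<phi>(2) that by (auto simp: \<Omega>_def)
  define dom where "dom = {q \<in> fst d. snd d q \<in> (\<lambda>z. z - x0) -` R}"
  define c where "c = (dom, \<lambda>q. g (snd d q - x0))"
  have fst_c [simp]: "fst c = dom" and snd_c [simp]: "snd c q = g (snd d q - x0)" for q
    by (simp_all add: c_def)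
  have dom: "open dom" unfolding dom_def
    by (rule chart_preimage_open[OF id]) (intro open_vimage W continuous_intros)
  \<comment> \<open>The exponential map with values in the manifold, available on all of
    \<open>S\<close>; on \<open>W\<close> it is inverse to the new chart.\<close>
  define \<psi> where "\<psi> x = chart_inv d (x0 + \<phi> x)" for x
  have \<psi>: "\<psi> x \<in> fst d" "\<psi> x \<in> U" "snd d (\<psi> x) = x0 + \<phi> x" if "x \<in> S" for x
    using in_T[OF that] chart_inv_left[OF id] by (auto simp: T_def \<psi>_def)
  have \<psi>W: "\<psi> x \<in> dom" "snd c (\<psi> x) = x" if "x \<in> W" for x
    using \<psi>[of x] W' W(2) that by (auto simp: dom_def)
  have \<psi>_inv: "snd c q \<in> W" "\<psi> (snd c q) = q" if "q \<in> dom" for q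
    using that W' chart_inv_left[OF id] by (auto simp: dom_def \<psi>_def)
  have im: "snd c ` fst c = W"
  proof (intro subset_antisym subsetI)
    fix x assume "x \<in> snd c ` fst c" then show "x \<in> W" using \<psi>_inv(1) by (auto simp del: snd_c)
  next
    fix x assume "x \<in> W" then show "x \<in> snd c ` fst c" using \<psi>W[of x] by (metis fst_c imageI)
  qed
  have inj_c: "inj_on (snd c) (fst c)" using \<psi>_inv(2) by (metis fst_c inj_on_inverseI)
  have inv_c: "chart_inv c x = \<psi> x" if "x \<in> W" for x
    by (rule inv_into_f_eq[OF inj_c]) (use \<psi>W[OF that] in auto)
  have cont_\<psi>: "continuous_on S \<psi>"
    unfolding \<psi>_def
    by (rule continuous_on_compose2[OF chart_continuous(2)[OF id]])
      (use in_T smooth_on_continuous[OF \<phi>(1)] in \<open>auto simp: T_def intro!: continuous_intros\<close>)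
  have is_c: "is_chart c"
    unfolding is_chart_def im
  proof (intro conjI)
    show "open (fst c)" "open W" using dom W by simp_all
    show "homeomorphism (fst c) W (snd c) (chart_inv c)"
    proof (rule homeomorphismI)
      have "continuous_on dom (snd d)" 
        by (rule continuous_on_subset[OF chart_continuous(1)[OF id]]) (auto simp: dom_def)
      then have "continuous_on dom (\<lambda>q. g (snd d q - x0))"
        by (intro continuous_on_compose2[OF smooth_on_continuous[OF W(7)]] continuous_intros) (auto simp: dom_def)
      then show "continuous_on (fst c) (snd c)" by (simp add: c_def)
      show "continuous_on W (chart_inv c)"
        by (rule continuous_on_eq[OF continuous_on_subset[OF cont_\<psi> W(2)]]) (rule inv_c[symmetric])
      show "snd c ` fst c \<subseteq> W" using im by simp
      show "chart_inv c ` W \<subseteq> fst c" using inv_c \<psi>W(1) by auto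
      show "chart_inv c (snd c x) = x" if "x \<in> fst c" for x
        using \<psi>_inv[of x] that inv_c[OF \<psi>_inv(1)] by (simp del: snd_c)
      show "snd c (chart_inv c y) = y" if "y \<in> W" for y using \<psi>W(2)[OF that] inv_c[OF that] by simp
    qed
  qed
  have "compatible c e" if e: "e \<in> A" for e
  proof -
    note ie = smooth_chartD[OF smooth_manifold_chart[OF A e]]
    have comp: "smooth_on (snd d ` (fst d \<inter> fst e)) (snd e \<circ> chart_inv d)"
      "smooth_on (snd e ` (fst d \<inter> fst e)) (snd d \<circ> chart_inv e)"
      using d(2) e by (auto simp: smooth_chart_def compatible_def)
    have O1: "open (snd c ` (fst c \<inter> fst e))"
      by (rule chart_image_open[OF is_c]) (use dom chart_open[OF ie] in auto)
    have O2: "open (snd d ` (fst d \<inter> fst e))"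
      by (rule chart_image_open[OF id]) (use chart_open[OF ie] chart_open[OF id] in auto)
    have O3: "open (snd e ` (fst c \<inter> fst e))"
      by (rule chart_image_open[OF ie]) (use dom chart_open[OF ie] in auto)
    have sub1: "snd c ` (fst c \<inter> fst e) \<subseteq> W" using im by blast
    have s1: "smooth_on (snd c ` (fst c \<inter> fst e)) (\<lambda>x. x0 + \<phi> x)"
      by (rule smooth_on_compose_vec[OF O1 open_UNIV shift(1)[OF open_UNIV] smooth_on_subset[OF \<phi>(1)]])
        (use sub1 W(2) in auto)
    have m1: "(\<lambda>x. x0 + \<phi> x) ` snd c ` (fst c \<inter> fst e) \<subseteq> snd d ` (fst d \<inter> fst e)"
    proof clarify
      fix q assume q: "q \<in> fst c" "q \<in> fst e"
      have "x0 + \<phi> (snd c q) = snd d q" using q W' by (auto simp: dom_def)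
      then show "x0 + \<phi> (snd c q) \<in> snd d ` (fst d \<inter> fst e)" using q by (auto simp: dom_def)
    qed
    have "smooth_on (snd c ` (fst c \<inter> fst e)) (\<lambda>x. (snd e \<circ> chart_inv d) (x0 + \<phi> x))"
      by (rule smooth_on_compose_vec[OF O1 O2 comp(1) s1 m1])
    moreover have "(snd e \<circ> chart_inv d) (x0 + \<phi> x) = (snd e \<circ> chart_inv c) x" if "x \<in> snd c ` (fst c \<inter> fst e)" for x
      using inv_c[of x] sub1 that by (auto simp: \<psi>_def)
    ultimately have "smooth_on (snd c ` (fst c \<inter> fst e)) (snd e \<circ> chart_inv c)"
      using smooth_on_cong[OF O1, of "\<lambda>x. (snd e \<circ> chart_inv d) (x0 + \<phi> x)" "snd e \<circ> chart_inv c"] by blast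
    moreover have "smooth_on (snd e ` (fst c \<inter> fst e)) (snd c \<circ> chart_inv e)"
    proof -
      have sub: "fst c \<inter> fst e \<subseteq> fst d \<inter> fst e" by (auto simp: dom_def)
      have s2: "smooth_on (snd e ` (fst c \<inter> fst e)) (\<lambda>z. (snd d \<circ> chart_inv e) z - x0)"
        by (rule smooth_on_compose_vec[OF O3 open_UNIV shift(2)[OF open_UNIV] smooth_on_subset[OF comp(2)]])
          (use sub in auto)
      have m2: "(\<lambda>z. (snd d \<circ> chart_inv e) z - x0) ` snd e ` (fst c \<inter> fst e) \<subseteq> R"
        using chart_inv_left[OF ie] by (auto simp: dom_def)
      have "smooth_on (snd e ` (fst c \<inter> fst e)) (\<lambda>z. g ((snd d \<circ> chart_inv e) z - x0))"
        by (rule smooth_on_compose_vec[OF O3 W(4) W(7) s2 m2])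
      then show ?thesis by (simp add: comp_def)
    qed
    ultimately show ?thesis by (simp add: compatible_def)
  qed
  then have smooth_c: "smooth_chart A c" using is_c by (simp add: smooth_chart_def)
  have "a \<in> dom" using d(3) W(5) by (simp add: dom_def x0_def)
  moreover have "snd c a = 0" using W'(2)[OF W(3)] \<phi>0 by (simp add: x0_def)
  ultimately have centered: "centered_chart A a c" using smooth_c by (simp add: centered_chart_def)
  have "time_one_flow A U (\<lambda>p. lincomb UNIV (\<lambda>j. x $ j) (\<lambda>j. X j p)) a (chart_inv c x)" if x: "x \<in> W" for x
    unfolding time_one_flow_def
  proof (intro exI[of _ "\<lambda>t. \<psi> (t *\<^sub>R x)"] conjI ballI allI impI)
    have xS: "x \<in> S" using x W by blast
    have tS: "t *\<^sub>R x \<in> S" if "t \<in> {0..1}" for t using star0D[OF S(2) xS] that by simp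
    show "continuous_on {0..1} (\<lambda>t. \<psi> (t *\<^sub>R x))"
      by (rule continuous_on_compose2[OF cont_\<psi>]) (use tS in \<open>auto intro!: continuous_intros\<close>)
    show "(\<lambda>t. \<psi> (t *\<^sub>R x)) ` {0..1} \<subseteq> U" using \<psi>(2) tS by blast
    show "\<psi> (0 *\<^sub>R x) = a" using \<phi>0 chart_inv_left[OF id d(3)] by (simp add: \<psi>_def x0_def)
    show "\<psi> (1 *\<^sub>R x) = chart_inv c x" using inv_c[OF x] by simp
    fix t :: real and h assume t: "t \<in> {0..1}" and h: "smooth_near A (\<psi> (t *\<^sub>R x)) h"
    let ?Y = "lincomb UNIV (\<lambda>j. x $ j) (\<lambda>j. X j (\<psi> (t *\<^sub>R x)))"
    define F where "F z = h (chart_inv d z)" for z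
    note q = \<psi>[OF tS[OF t]]
    obtain Q where Q: "open Q" "snd d (\<psi> (t *\<^sub>R x)) \<in> Q" "smooth_on Q F"
      using h unfolding smooth_near_chart_iff[OF A d(2) q(1)] F_def[abs_def] by blast
    have DF: "(F has_derivative (\<lambda>v. dir_deriv v F (x0 + \<phi> (t *\<^sub>R x)))) (at (x0 + \<phi> (t *\<^sub>R x)))"
      using smooth_on_has_derivative[OF Q(3,2)] q(3) by simp
    have D1: "((\<lambda>s. s *\<^sub>R x) has_derivative (\<lambda>s. s *\<^sub>R x)) (at t within {0..1})"
      by (auto intro!: derivative_eq_intros)
    have D2: "((\<lambda>s. x0 + \<phi> (s *\<^sub>R x)) has_derivative (\<lambda>s. dir_deriv (s *\<^sub>R x) \<phi> (t *\<^sub>R x))) (at t within {0..1})"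
      using has_derivative_add[OF has_derivative_const has_derivative_compose[OF D1 smooth_on_has_derivative[OF \<phi>(1) tS[OF t]]], of x0]
      by simp
    have D3: "((\<lambda>s. F (x0 + \<phi> (s *\<^sub>R x))) has_derivative (\<lambda>s. dir_deriv (dir_deriv (s *\<^sub>R x) \<phi> (t *\<^sub>R x)) F (x0 + \<phi> (t *\<^sub>R x)))) (at t within {0..1})"
      by (rule has_derivative_compose[OF D2 DF])
    have lin: "linear (\<lambda>v. dir_deriv v F (x0 + \<phi> (t *\<^sub>R x)))" "linear (\<lambda>v. dir_deriv v \<phi> (t *\<^sub>R x))"
      using has_derivative_linear[OF DF] has_derivative_linear[OF smooth_on_has_derivative[OF \<phi>(1) tS[OF t]]] by blast+
    have vel: "dir_deriv x \<phi> (t *\<^sub>R x) = coords d ?Y"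
      unfolding coords_lincomb coords_X[OF d(2) q(1)] q(3)
      by (simp add: vec_eq_iff ray[OF tS[OF t]] V_def)
    have val: "dir_deriv (coords d ?Y) F (x0 + \<phi> (t *\<^sub>R x)) = ?Y h"
    proof -
      have "dir_deriv (coords d ?Y) F (x0 + \<phi> (t *\<^sub>R x)) =
          (\<Sum>k\<in>UNIV. coords d ?Y $ k *\<^sub>R dir_deriv (axis k 1) F (x0 + \<phi> (t *\<^sub>R x)))"
        by (rule dir_deriv_expand) (use DF in \<open>auto simp: differentiable_def\<close>)
      also have "\<dots> = ?Y h"
        using lincomb_chart[OF A d(2) q(1) X_tangent[OF q(2)] h, where a = "\<lambda>j. x $ j" and I = UNIV]
        by (simp add: q(3) F_def[abs_def])
      finally show ?thesis .
    qed
    have "(\<lambda>s. dir_deriv (dir_deriv (s *\<^sub>R x) \<phi> (t *\<^sub>R x)) F (x0 + \<phi> (t *\<^sub>R x))) = (*) (?Y h)"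
      using val by (simp add: linear_cmul[OF lin(2)] linear_cmul[OF lin(1)] vel mult.commute[of "?Y h"] fun_eq_iff)
    then have "((\<lambda>s. F (x0 + \<phi> (s *\<^sub>R x))) has_real_derivative ?Y h) (at t within {0..1})"
      using D3 by (simp add: has_field_derivative_def)
    then show "((h \<circ> (\<lambda>t. \<psi> (t *\<^sub>R x))) has_real_derivative ?Y h) (at t within {0..1})"
      by (simp add: comp_def \<psi>_def F_def)
  qed
  then have "canonical_coords_1 A U X a c"
    using centered unfolding canonical_coords_1_def im by blast
  then show ?thesis by blast
qed

end

theorem proposition6p2:
  fixes A :: "('m::{t2_space, second_countable_topology}, 'n::{finite, linorder}) chart set"
    and r :: nat
    and H :: "nat \<Rightarrow> 'm distribution"
    and U :: "'m set"
    and X :: "'n \<Rightarrow> 'm vfield"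
    and a :: 'm
  assumes "carnot_manifold A r H"
    and "H_frame A H U X"
    and "a \<in> U"
  shows "(\<exists>c. canonical_coords_1 A U X a c) \<and>
         (\<forall>c. canonical_coords_1 A U X a c \<longrightarrow> carnot_coords A r H X a c)"
proof -
  interpret carnot_frame A r H U X
    using assms by unfold_locales auto
  have "carnot_coords A r H X a c" if "canonical_coords_1 A U X a c" for c
  proof -
    interpret canonical_chart A r H U X a c
      using assms(3) that by unfold_locales
    show ?thesis by (rule carnot_coordinates)
  qed
  then show ?thesis using canonical_chart_exists[OF assms(3)] by blast
qed


end
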